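(* The assignment $\mathbf{C}\mapsto\mathcal{T}(\mathbf{C})$ extends to a functor $\mathcal{T}\colon\mathbf{Cat}\to\mathbf{CBCat}$ (sending a functor $F$ to the morphism $\mathcal{T}(F)$ that acts as $F$ on objects letterwise, sends $\underline c$ to $\underline{F(c)}$ and preserves all other generators, $;$ and $\oplus$), and $\mathcal{T}$ is left adjoint to the forgetful functor $U\colon\mathbf{CBCat}\to\mathbf{Cat}$, with unit $\mathbf{C}\to\mathcal{T}(\mathbf{C})$ the identity-on-objects functor $c\mapsto\underline c$.
   Context: Composition is diagrammatic. $\mathbf{Cat}$ is the category of locally small categories. A pca is a set with $\star$ and $+_p$ ($p\in(0,1)$) satisfying $(x_1+_q x_2)+_p x_3=x_1+_{pq}(x_2+_{\tilde q}x_3)$ ($\tilde q=\frac{p(1-q)}{1-pq}$), $x_1+_px_2=x_2+_{1-p}x_1$, $x+_px=x$; $p\cdot x:=x+_p\star$. A convex biproduct category is a category with pca hom-sets and composition preserving $+_p,\star$ in each argument, with an object $0$ both initial and terminal and, for all $X_1,X_2$, an object $X_1\oplus X_2$ with $\iota_i,\pi_i$ making it a coproduct (via $\iota_i$) and a convex product (via $\pi_i$: for all $p_1+p_2\le1$ in $[0,1]$ and $f_i\colon A\to X_i$ a unique $h$ with $h;\pi_i=p_i\cdot f_i$), with $\iota_i;\pi_j=\mathrm{id}$ if $i=j$, $\star$ otherwise. $\mathbf{CBCat}$ has these as objects and, as morphisms, functors preserving the pca structure on hom-sets and finite coproducts. The tape category $\mathcal{T}(\mathbf{C})$: objects finite words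 over $\mathrm{Ob}(\mathbf{C})$ (empty word $0$); arrows are terms from generators $\Delta^p_U\colon U\to U\oplus U$ ($p\in(0,1)$), $!_U\colon U\to0$, $\nabla_U\colon U\oplus U\to U$, $¡_U\colon0\to U$, $\sigma_{U,V}$, $\mathrm{id}_U$, $\mathrm{id}_0$, $\underline c$ ($c\in\mathbf{C}[U,V]$), under $;$ and $\oplus$, modulo: strict symmetric monoidal category axioms; $\underline{\mathrm{id}_U}=\mathrm{id}_U$, $\underline{c;d}=\underline c;\underline d$; commutative monoid laws for $(\nabla,¡)$ plus naturality $¡_P;f=¡_Q$, $\nabla_P;f=(f\oplus f);\nabla_Q$; co-pca laws $\Delta^p_P;(\Delta^q_P\oplus\mathrm{id}_P)=\Delta^{pq}_P;(\mathrm{id}_P\oplus\Delta^{\tilde q}_P)$, $\Delta^p_P;\nabla_P=\mathrm{id}_P$, $\Delta^p_P;\sigma_{P,P}=\Delta^{1-p}_P$ plus naturality $f;!_Q=\,!_P$, $f;\Delta^p_Q=\Delta^p_P;(f\oplus f)$; structure on words defined inductively ($\Delta^p_{UP}=(\Delta^p_U\oplus\Delta^p_P);(\mathrm{id}_U\oplus\sigma_{U,P}\oplus\mathrm{id}_P)$, $\nabla_{UP}=(\mathrm{id}_U\oplus\sigma_{P,U}\oplus\mathrm{id}_P);(\nabla_U\oplus\nabla_P)$, $!_{UP}=!_U\oplus!_P$, $¡_{UP}=¡_U\oplus¡_P$, all equal to $\mathrm{id}_0$ on $0$). $\mathcal{T}(\mathbf{C})$ is a convex biproduct category with $f+_pg=\Delta^p_P;(f\oplus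 g);\nabla_Q$, $\star=!_P;¡_Q$ and $\oplus$ concatenation.
   Formalization: Read literally, factorizations need not be unique or exist. Proved: a hom-set bijection for targets with strictly associative, unital chosen coproducts and functors preserving these strictly; for all targets and functors, an equivalence of hom-categories, surjective on objects. *)

theory Defs
  imports Complex_Main "HOL-Library.FuncSet"
begin

section \<open>Categories, functors, natural transformations\<close>

text \<open>Composition is written in diagrammatic order. Since hom-collections are sets of a HOL
  type, every category below is locally small. The operations of a record are only
  constrained on its carrier sets.\<close>

record ('o, 'a) cat =
  obj :: "'o set"
  arr :: "'a set"
  src :: "'a \<Rightarrow> 'o"
  tgt :: "'a \<Rightarrow> 'o"
  idn :: "'o \<Rightarrow> 'a"
  cmp :: "'a \<Rightarrow> 'a \<Rightarrow> 'a"  (infixl ";;\<index>" 70)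

definition hom :: "('o, 'a, 'z) cat_scheme \<Rightarrow> 'o \<Rightarrow> 'o \<Rightarrow> 'a set" where
  "hom C A B = {f \<in> arr C. src C f = A \<and> tgt C f = B}"

locale category =
  fixes C :: "('o, 'a, 'z) cat_scheme" (structure)
  assumes src_obj: "f \<in> arr C \<Longrightarrow> src C f \<in> obj C"
    and tgt_obj: "f \<in> arr C \<Longrightarrow> tgt C f \<in> obj C"
    and idn_hom: "A \<in> obj C \<Longrightarrow> idn C A \<in> hom C A A"
    and cmp_hom: "f \<in> hom C A B \<Longrightarrow> g \<in> hom C B D \<Longrightarrow> f ;; g \<in> hom C A D"
    and cmp_idl: "f \<in> hom C A B \<Longrightarrow> idn C A ;; f = f"
    and cmp_idr: "f \<in> hom C A B \<Longrightarrow> f ;; idn C B = f"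
    and cmp_assoc: "f \<in> hom C A B \<Longrightarrow> g \<in> hom C B D \<Longrightarrow> h \<in> hom C D E \<Longrightarrow>
      (f ;; g) ;; h = f ;; (g ;; h)"

text \<open>The two components of a functor are extensional functions (fixed to
  \<open>undefined\<close> outside the carriers), so that equality of records is equality of functors.\<close>

record ('o, 'a, 'p, 'b) ftor =
  fob :: "'o \<Rightarrow> 'p"
  far :: "'a \<Rightarrow> 'b"

locale cat_functor = S: category C + T: category D
  for C :: "('o, 'a, 'y) cat_scheme" and D :: "('p, 'b, 'z) cat_scheme" +
  fixes F :: "('o, 'a, 'p, 'b) ftor"
  assumes fob_ext: "fob F \<in> obj C \<rightarrow>\<^sub>E obj D"
    and far_ext: "far F \<in> arr C \<rightarrow>\<^sub>E arr D"
    and far_hom: "f \<in> hom C A B \<Longrightarrow> far F f \<in> hom D (fob F A) (fob F B)"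
    and far_idn: "A \<in> obj C \<Longrightarrow> far F (idn C A) = idn D (fob F A)"
    and far_cmp: "f \<in> hom C A B \<Longrightarrow> g \<in> hom C B E \<Longrightarrow>
      far F (f ;;\<^bsub>C\<^esub> g) = far F f ;;\<^bsub>D\<^esub> far F g"

definition id_functor :: "('o, 'a, 'z) cat_scheme \<Rightarrow> ('o, 'a, 'o, 'a) ftor" where
  "id_functor C = \<lparr>fob = (\<lambda>A\<in>obj C. A), far = (\<lambda>f\<in>arr C. f)\<rparr>"

definition comp_functor ::
  "('o, 'a, 'z) cat_scheme \<Rightarrow> ('o, 'a, 'p, 'b) ftor \<Rightarrow> ('p, 'b, 'q, 'c) ftor \<Rightarrow> ('o, 'a, 'q, 'c) ftor"
  where
  "comp_functor C F G =
    \<lparr>fob = (\<lambda>A\<in>obj C. fob G (fob F A)), far = (\<lambda>f\<in>arr C. far G (far F f))\<rparr>"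

definition nat_trans ::
  "('o, 'a, 'y) cat_scheme \<Rightarrow> ('p, 'b, 'z) cat_scheme \<Rightarrow>
    ('o, 'a, 'p, 'b) ftor \<Rightarrow> ('o, 'a, 'p, 'b) ftor \<Rightarrow> ('o \<Rightarrow> 'b) set" where
  "nat_trans C D F G =
    {\<alpha> \<in> obj C \<rightarrow>\<^sub>E arr D.
      (\<forall>A\<in>obj C. \<alpha> A \<in> hom D (fob F A) (fob G A)) \<and>
      (\<forall>A B f. f \<in> hom C A B \<longrightarrow> far F f ;;\<^bsub>D\<^esub> \<alpha> B = \<alpha> A ;;\<^bsub>D\<^esub> far G f)}"

section \<open>Convex biproduct categories\<close>

text \<open>Pointed convex algebras, with the pca operations given on a carrier set.\<close>

definition pca :: "'a set \<Rightarrow> (real \<Rightarrow> 'a \<Rightarrow> 'a \<Rightarrow> 'a) \<Rightarrow> 'a \<Rightarrow> bool" where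
  "pca X pl st \<longleftrightarrow>
    st \<in> X \<and>
    (\<forall>p\<in>{0<..<1}. \<forall>x\<in>X. \<forall>y\<in>X. pl p x y \<in> X) \<and>
    (\<forall>p\<in>{0<..<1}. \<forall>q\<in>{0<..<1}. \<forall>x1\<in>X. \<forall>x2\<in>X. \<forall>x3\<in>X.
      pl p (pl q x1 x2) x3 = pl (p * q) x1 (pl (p * (1 - q) / (1 - p * q)) x2 x3)) \<and>
    (\<forall>p\<in>{0<..<1}. \<forall>x1\<in>X. \<forall>x2\<in>X. pl p x1 x2 = pl (1 - p) x2 x1) \<and>
    (\<forall>p\<in>{0<..<1}. \<forall>x\<in>X. pl p x x = x)"

record ('o, 'a) pcacat = "('o, 'a) cat" +
  plus :: "real \<Rightarrow> 'a \<Rightarrow> 'a \<Rightarrow> 'a"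
  star :: "'o \<Rightarrow> 'o \<Rightarrow> 'a"

locale pca_category = category C
  for C :: "('o, 'a, 'z) pcacat_scheme" (structure) +
  assumes hom_pca: "A \<in> obj C \<Longrightarrow> B \<in> obj C \<Longrightarrow> pca (hom C A B) (plus C) (star C A B)"
    and cmp_plus_left: "p \<in> {0<..<1} \<Longrightarrow> f \<in> hom C A B \<Longrightarrow> g \<in> hom C A B \<Longrightarrow> h \<in> hom C B D \<Longrightarrow>
      plus C p f g ;; h = plus C p (f ;; h) (g ;; h)"
    and cmp_plus_right: "p \<in> {0<..<1} \<Longrightarrow> h \<in> hom C A B \<Longrightarrow> f \<in> hom C B D \<Longrightarrow> g \<in> hom C B D \<Longrightarrow>
      h ;; plus C p f g = plus C p (h ;; f) (h ;; g)"
    and cmp_star_left: "A \<in> obj C \<Longrightarrow> h \<in> hom C B D \<Longrightarrow> star C A B ;; h = star C A D"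
    and cmp_star_right: "D \<in> obj C \<Longrightarrow> h \<in> hom C A B \<Longrightarrow> h ;; star C B D = star C A D"

text \<open>The scaling \<open>p \<cdot> f\<close>, extended to the closed unit interval by
  \<open>0 \<cdot> f = \<star>\<close> and \<open>1 \<cdot> f = f\<close>.\<close>

definition scale :: "('o, 'a, 'z) pcacat_scheme \<Rightarrow> real \<Rightarrow> 'a \<Rightarrow> 'a" where
  "scale C p f =
    (if p = 0 then star C (src C f) (tgt C f)
     else if p = 1 then f
     else plus C p f (star C (src C f) (tgt C f)))"

definition is_initial :: "('o, 'a, 'z) cat_scheme \<Rightarrow> 'o \<Rightarrow> bool" where
  "is_initial C Z \<longleftrightarrow> Z \<in> obj C \<and> (\<forall>A\<in>obj C. \<exists>!f. f \<in> hom C Z A)"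

definition is_terminal :: "('o, 'a, 'z) cat_scheme \<Rightarrow> 'o \<Rightarrow> bool" where
  "is_terminal C Z \<longleftrightarrow> Z \<in> obj C \<and> (\<forall>A\<in>obj C. \<exists>!f. f \<in> hom C A Z)"

definition is_coproduct ::
  "('o, 'a, 'z) cat_scheme \<Rightarrow> 'o \<Rightarrow> 'o \<Rightarrow> 'o \<Rightarrow> 'a \<Rightarrow> 'a \<Rightarrow> bool" where
  "is_coproduct C X1 X2 S i1 i2 \<longleftrightarrow>
    X1 \<in> obj C \<and> X2 \<in> obj C \<and> S \<in> obj C \<and> i1 \<in> hom C X1 S \<and> i2 \<in> hom C X2 S \<and>
    (\<forall>A\<in>obj C. \<forall>f1\<in>hom C X1 A. \<forall>f2\<in>hom C X2 A.
      \<exists>!h. h \<in> hom C S A \<and> i1 ;;\<^bsub>C\<^esub> h = f1 \<and> i2 ;;\<^bsub>C\<^esub> h = f2)"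

definition is_convex_product ::
  "('o, 'a, 'z) pcacat_scheme \<Rightarrow> 'o \<Rightarrow> 'o \<Rightarrow> 'o \<Rightarrow> 'a \<Rightarrow> 'a \<Rightarrow> bool" where
  "is_convex_product C X1 X2 S q1 q2 \<longleftrightarrow>
    X1 \<in> obj C \<and> X2 \<in> obj C \<and> S \<in> obj C \<and> q1 \<in> hom C S X1 \<and> q2 \<in> hom C S X2 \<and>
    (\<forall>A\<in>obj C. \<forall>f1\<in>hom C A X1. \<forall>f2\<in>hom C A X2. \<forall>p1\<in>{0..1}. \<forall>p2\<in>{0..1}. p1 + p2 \<le> 1 \<longrightarrow>
      (\<exists>!h. h \<in> hom C A S \<and> h ;;\<^bsub>C\<^esub> q1 = scale C p1 f1 \<and> h ;;\<^bsub>C\<^esub> q2 = scale C p2 f2))"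

record ('o, 'a) cbcat = "('o, 'a) pcacat" +
  zob :: "'o"
  osum :: "'o \<Rightarrow> 'o \<Rightarrow> 'o"
  inj1 :: "'o \<Rightarrow> 'o \<Rightarrow> 'a"
  inj2 :: "'o \<Rightarrow> 'o \<Rightarrow> 'a"
  prj1 :: "'o \<Rightarrow> 'o \<Rightarrow> 'a"
  prj2 :: "'o \<Rightarrow> 'o \<Rightarrow> 'a"

locale convex_biproduct_category = pca_category C
  for C :: "('o, 'a, 'z) cbcat_scheme" (structure) +
  assumes zob_initial: "is_initial C (zob C)"
    and zob_terminal: "is_terminal C (zob C)"
    and osum_coproduct: "X1 \<in> obj C \<Longrightarrow> X2 \<in> obj C \<Longrightarrow>
      is_coproduct C X1 X2 (osum C X1 X2) (inj1 C X1 X2) (inj2 C X1 X2)"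
    and osum_convex_product: "X1 \<in> obj C \<Longrightarrow> X2 \<in> obj C \<Longrightarrow>
      is_convex_product C X1 X2 (osum C X1 X2) (prj1 C X1 X2) (prj2 C X1 X2)"
    and inj1_prj1: "X1 \<in> obj C \<Longrightarrow> X2 \<in> obj C \<Longrightarrow> inj1 C X1 X2 ;; prj1 C X1 X2 = idn C X1"
    and inj2_prj2: "X1 \<in> obj C \<Longrightarrow> X2 \<in> obj C \<Longrightarrow> inj2 C X1 X2 ;; prj2 C X1 X2 = idn C X2"
    and inj1_prj2: "X1 \<in> obj C \<Longrightarrow> X2 \<in> obj C \<Longrightarrow> inj1 C X1 X2 ;; prj2 C X1 X2 = star C X1 X2"
    and inj2_prj1: "X1 \<in> obj C \<Longrightarrow> X2 \<in> obj C \<Longrightarrow> inj2 C X1 X2 ;; prj1 C X1 X2 = star C X2 X1"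

text \<open>A morphism of convex biproduct categories preserves finite coproducts in the usual sense:
  it sends initial objects to initial objects and coproduct cocones to coproduct cocones.\<close>

locale cb_functor = cat_functor C D F +
  S: convex_biproduct_category C + T: convex_biproduct_category D
  for C :: "('o, 'a, 'y) cbcat_scheme" and D :: "('p, 'b, 'z) cbcat_scheme"
    and F :: "('o, 'a, 'p, 'b) ftor" +
  assumes far_plus: "p \<in> {0<..<1} \<Longrightarrow> f \<in> hom C A B \<Longrightarrow> g \<in> hom C A B \<Longrightarrow>
      far F (plus C p f g) = plus D p (far F f) (far F g)"
    and far_star: "A \<in> obj C \<Longrightarrow> B \<in> obj C \<Longrightarrow> far F (star C A B) = star D (fob F A) (fob F B)"
    and fob_initial: "is_initial C Z \<Longrightarrow> is_initial D (fob F Z)"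
    and far_coproduct: "is_coproduct C X1 X2 S i1 i2 \<Longrightarrow>
      is_coproduct D (fob F X1) (fob F X2) (fob F S) (far F i1) (far F i2)"

text \<open>The strict variant. The chosen coproducts form a strict monoidal structure: the canonical
  associativity and unit isomorphisms, which are determined by the injections, are
  identities. Strict morphisms preserve the chosen finite coproducts on the nose.
  Factorisations through the free category are unique on the nose only for strict morphisms, which
  in turn need a strict target because concatenation of words is strictly associative and unital;
  for arbitrary targets and morphisms they are unique up to unique natural isomorphism.\<close>

locale strict_convex_biproduct_category = convex_biproduct_category C
  for C :: "('o, 'a, 'z) cbcat_scheme" (structure) +
  assumes osum_zob_left: "A \<in> obj C \<Longrightarrow> osum C (zob C) A = A"
    and inj2_zob: "A \<in> obj C \<Longrightarrow> inj2 C (zob C) A = idn C A"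
    and osum_zob_right: "A \<in> obj C \<Longrightarrow> osum C A (zob C) = A"
    and inj1_zob: "A \<in> obj C \<Longrightarrow> inj1 C A (zob C) = idn C A"
    and osum_assoc: "A \<in> obj C \<Longrightarrow> B \<in> obj C \<Longrightarrow> E \<in> obj C \<Longrightarrow>
      osum C (osum C A B) E = osum C A (osum C B E)"
    and inj_assoc1: "A \<in> obj C \<Longrightarrow> B \<in> obj C \<Longrightarrow> E \<in> obj C \<Longrightarrow>
      inj1 C A B ;; inj1 C (osum C A B) E = inj1 C A (osum C B E)"
    and inj_assoc2: "A \<in> obj C \<Longrightarrow> B \<in> obj C \<Longrightarrow> E \<in> obj C \<Longrightarrow>
      inj2 C A B ;; inj1 C (osum C A B) E = inj1 C B E ;; inj2 C A (osum C B E)"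
    and inj_assoc3: "A \<in> obj C \<Longrightarrow> B \<in> obj C \<Longrightarrow> E \<in> obj C \<Longrightarrow>
      inj2 C (osum C A B) E = inj2 C B E ;; inj2 C A (osum C B E)"

locale strict_cb_functor = cb_functor C D F +
  S: strict_convex_biproduct_category C + T: strict_convex_biproduct_category D
  for C :: "('o, 'a, 'y) cbcat_scheme" and D :: "('p, 'b, 'z) cbcat_scheme"
    and F :: "('o, 'a, 'p, 'b) ftor" +
  assumes fob_zob: "fob F (zob C) = zob D"
    and fob_osum: "X1 \<in> obj C \<Longrightarrow> X2 \<in> obj C \<Longrightarrow>
      fob F (osum C X1 X2) = osum D (fob F X1) (fob F X2)"
    and far_inj1: "X1 \<in> obj C \<Longrightarrow> X2 \<in> obj C \<Longrightarrow>
      far F (inj1 C X1 X2) = inj1 D (fob F X1) (fob F X2)"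
    and far_inj2: "X1 \<in> obj C \<Longrightarrow> X2 \<in> obj C \<Longrightarrow>
      far F (inj2 C X1 X2) = inj2 D (fob F X1) (fob F X2)"

text \<open>The forgetful functor on objects; on morphisms it is the identity.\<close>

definition forget :: "('o, 'a, 'z) cbcat_scheme \<Rightarrow> ('o, 'a) cat" where
  "forget D = cat.truncate D"

section \<open>The tape category\<close>

datatype ('o, 'a) tape =
    Split real 'o     \<comment> \<open>\<open>\<Delta>\<^sup>p : U \<rightarrow> U \<oplus> U\<close>\<close>
  | Discard 'o        \<comment> \<open>\<open>! : U \<rightarrow> 0\<close>\<close>
  | Merge 'o          \<comment> \<open>\<open>\<nabla> : U \<oplus> U \<rightarrow> U\<close>\<close>
  | Init 'o           \<comment> \<open>\<open>\<exclamdown> : 0 \<rightarrow> U\<close>\<close>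
  | Swap 'o 'o
  | Idt 'o
  | Idt0
  | Box 'a
  | Seq "('o, 'a) tape" "('o, 'a) tape"  (infixl "\<Zsemi>" 65)
  | Par "('o, 'a) tape" "('o, 'a) tape"  (infixr "\<oplus>" 70)

inductive tape_typed ::
  "('o, 'a, 'z) cat_scheme \<Rightarrow> 'o list \<Rightarrow> 'o list \<Rightarrow> ('o, 'a) tape \<Rightarrow> bool" for C where
  "p \<in> {0<..<1} \<Longrightarrow> U \<in> obj C \<Longrightarrow> tape_typed C [U] [U, U] (Split p U)"
| "U \<in> obj C \<Longrightarrow> tape_typed C [U] [] (Discard U)"
| "U \<in> obj C \<Longrightarrow> tape_typed C [U, U] [U] (Merge U)"
| "U \<in> obj C \<Longrightarrow> tape_typed C [] [U] (Init U)"
| "U \<in> obj C \<Longrightarrow> V \<in> obj C \<Longrightarrow> tape_typed C [U, V] [V, U] (Swap U V)"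
| "U \<in> obj C \<Longrightarrow> tape_typed C [U] [U] (Idt U)"
| "tape_typed C [] [] Idt0"
| "c \<in> hom C U V \<Longrightarrow> U \<in> obj C \<Longrightarrow> V \<in> obj C \<Longrightarrow> tape_typed C [U] [V] (Box c)"
| "tape_typed C P Q s \<Longrightarrow> tape_typed C Q R t \<Longrightarrow> tape_typed C P R (s \<Zsemi> t)"
| "tape_typed C P Q s \<Longrightarrow> tape_typed C P' Q' t \<Longrightarrow> tape_typed C (P @ P') (Q @ Q') (s \<oplus> t)"

text \<open>The structural tapes on words.\<close>

primrec idw :: "'o list \<Rightarrow> ('o, 'a) tape" where
  "idw [] = Idt0"
| "idw (U # P) = Idt U \<oplus> idw P"

primrec swap1 :: "'o \<Rightarrow> 'o list \<Rightarrow> ('o, 'a) tape" where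
  "swap1 U [] = Idt U"
| "swap1 U (V # Q) = (Swap U V \<oplus> idw Q) \<Zsemi> (Idt V \<oplus> swap1 U Q)"

primrec swapw :: "'o list \<Rightarrow> 'o list \<Rightarrow> ('o, 'a) tape" where
  "swapw [] Q = idw Q"
| "swapw (U # P) Q = (Idt U \<oplus> swapw P Q) \<Zsemi> (swap1 U Q \<oplus> idw P)"

primrec splitw :: "real \<Rightarrow> 'o list \<Rightarrow> ('o, 'a) tape" where
  "splitw p [] = Idt0"
| "splitw p (U # P) = (Split p U \<oplus> splitw p P) \<Zsemi> (Idt U \<oplus> swapw [U] P \<oplus> idw P)"

primrec discardw :: "'o list \<Rightarrow> ('o, 'a) tape" where
  "discardw [] = Idt0"
| "discardw (U # P) = Discard U \<oplus> discardw P"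

primrec mergew :: "'o list \<Rightarrow> ('o, 'a) tape" where
  "mergew [] = Idt0"
| "mergew (U # P) = (Idt U \<oplus> swapw P [U] \<oplus> idw P) \<Zsemi> (Merge U \<oplus> mergew P)"

primrec initw :: "'o list \<Rightarrow> ('o, 'a) tape" where
  "initw [] = Idt0"
| "initw (U # P) = Init U \<oplus> initw P"

abbreviation words :: "('o, 'a, 'z) cat_scheme \<Rightarrow> 'o list set" where
  "words C \<equiv> lists (obj C)"

text \<open>\<open>tape_eq C P Q s t\<close>: the typed tapes \<open>s, t : P \<rightarrow> Q\<close> are identified.\<close>

inductive tape_eq ::
  "('o, 'a, 'z) cat_scheme \<Rightarrow> 'o list \<Rightarrow> 'o list \<Rightarrow> ('o, 'a) tape \<Rightarrow> ('o, 'a) tape \<Rightarrow> bool"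
  for C where
  \<comment> \<open>congruence\<close>
  refl: "tape_typed C P Q t \<Longrightarrow> tape_eq C P Q t t"
| sym: "tape_eq C P Q s t \<Longrightarrow> tape_eq C P Q t s"
| trans: "tape_eq C P Q s t \<Longrightarrow> tape_eq C P Q t u \<Longrightarrow> tape_eq C P Q s u"
| cong_seq: "tape_eq C P Q s s' \<Longrightarrow> tape_eq C Q R t t' \<Longrightarrow> tape_eq C P R (s \<Zsemi> t) (s' \<Zsemi> t')"
| cong_par: "tape_eq C P Q s s' \<Longrightarrow> tape_eq C P' Q' t t' \<Longrightarrow>
    tape_eq C (P @ P') (Q @ Q') (s \<oplus> t) (s' \<oplus> t')"
  \<comment> \<open>strict symmetric monoidal category\<close>
| seq_assoc: "tape_typed C P Q s \<Longrightarrow> tape_typed C Q R t \<Longrightarrow> tape_typed C R S u \<Longrightarrow>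
    tape_eq C P S ((s \<Zsemi> t) \<Zsemi> u) (s \<Zsemi> (t \<Zsemi> u))"
| seq_idl: "tape_typed C P Q t \<Longrightarrow> tape_eq C P Q (idw P \<Zsemi> t) t"
| seq_idr: "tape_typed C P Q t \<Longrightarrow> tape_eq C P Q (t \<Zsemi> idw Q) t"
| par_assoc: "tape_typed C P Q s \<Longrightarrow> tape_typed C P' Q' t \<Longrightarrow> tape_typed C P'' Q'' u \<Longrightarrow>
    tape_eq C (P @ P' @ P'') (Q @ Q' @ Q'') ((s \<oplus> t) \<oplus> u) (s \<oplus> (t \<oplus> u))"
| par_idl: "tape_typed C P Q t \<Longrightarrow> tape_eq C P Q (Idt0 \<oplus> t) t"
| par_idr: "tape_typed C P Q t \<Longrightarrow> tape_eq C P Q (t \<oplus> Idt0) t"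
| interchange: "tape_typed C P Q s \<Longrightarrow> tape_typed C Q R t \<Longrightarrow>
    tape_typed C P' Q' s' \<Longrightarrow> tape_typed C Q' R' t' \<Longrightarrow>
    tape_eq C (P @ P') (R @ R') ((s \<Zsemi> t) \<oplus> (s' \<Zsemi> t')) ((s \<oplus> s') \<Zsemi> (t \<oplus> t'))"
| par_id: "P \<in> words C \<Longrightarrow> Q \<in> words C \<Longrightarrow>
    tape_eq C (P @ Q) (P @ Q) (idw P \<oplus> idw Q) (idw (P @ Q))"
| swap_inverse: "P \<in> words C \<Longrightarrow> Q \<in> words C \<Longrightarrow>
    tape_eq C (P @ Q) (P @ Q) (swapw P Q \<Zsemi> swapw Q P) (idw (P @ Q))"
| swap_natural: "tape_typed C P Q s \<Longrightarrow> tape_typed C P' Q' t \<Longrightarrow>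
    tape_eq C (P @ P') (Q' @ Q) ((s \<oplus> t) \<Zsemi> swapw Q Q') (swapw P P' \<Zsemi> (t \<oplus> s))"
| hexagon: "P \<in> words C \<Longrightarrow> Q \<in> words C \<Longrightarrow> R \<in> words C \<Longrightarrow>
    tape_eq C (P @ Q @ R) (R @ P @ Q)
      (swapw (P @ Q) R) ((idw P \<oplus> swapw Q R) \<Zsemi> (swapw P R \<oplus> idw Q))"
| swap_gen: "U \<in> obj C \<Longrightarrow> V \<in> obj C \<Longrightarrow> tape_eq C [U, V] [V, U] (swapw [U] [V]) (Swap U V)"
  \<comment> \<open>boxes\<close>
| box_id: "U \<in> obj C \<Longrightarrow> tape_eq C [U] [U] (Box (idn C U)) (Idt U)"
| box_cmp: "U \<in> obj C \<Longrightarrow> V \<in> obj C \<Longrightarrow> W \<in> obj C \<Longrightarrow> c \<in> hom C U V \<Longrightarrow> d \<in> hom C V W \<Longrightarrow>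
    tape_eq C [U] [W] (Box (c ;;\<^bsub>C\<^esub> d)) (Box c \<Zsemi> Box d)"
  \<comment> \<open>natural commutative monoids\<close>
| merge_assoc: "P \<in> words C \<Longrightarrow>
    tape_eq C (P @ P @ P) P ((mergew P \<oplus> idw P) \<Zsemi> mergew P) ((idw P \<oplus> mergew P) \<Zsemi> mergew P)"
| merge_unit: "P \<in> words C \<Longrightarrow> tape_eq C P P ((initw P \<oplus> idw P) \<Zsemi> mergew P) (idw P)"
| merge_comm: "P \<in> words C \<Longrightarrow> tape_eq C (P @ P) P (swapw P P \<Zsemi> mergew P) (mergew P)"
| init_natural: "tape_typed C P Q f \<Longrightarrow> tape_eq C [] Q (initw P \<Zsemi> f) (initw Q)"
| merge_natural: "tape_typed C P Q f \<Longrightarrow>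
    tape_eq C (P @ P) Q (mergew P \<Zsemi> f) ((f \<oplus> f) \<Zsemi> mergew Q)"
  \<comment> \<open>natural co-pcas\<close>
| split_assoc: "P \<in> words C \<Longrightarrow> p \<in> {0<..<1} \<Longrightarrow> q \<in> {0<..<1} \<Longrightarrow>
    tape_eq C P (P @ P @ P)
      (splitw p P \<Zsemi> (splitw q P \<oplus> idw P))
      (splitw (p * q) P \<Zsemi> (idw P \<oplus> splitw (p * (1 - q) / (1 - p * q)) P))"
| split_merge: "P \<in> words C \<Longrightarrow> p \<in> {0<..<1} \<Longrightarrow>
    tape_eq C P P (splitw p P \<Zsemi> mergew P) (idw P)"
| split_swap: "P \<in> words C \<Longrightarrow> p \<in> {0<..<1} \<Longrightarrow>
    tape_eq C P (P @ P) (splitw p P \<Zsemi> swapw P P) (splitw (1 - p) P)"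
| discard_natural: "tape_typed C P Q f \<Longrightarrow> tape_eq C P [] (f \<Zsemi> discardw Q) (discardw P)"
| split_natural: "tape_typed C P Q f \<Longrightarrow> p \<in> {0<..<1} \<Longrightarrow>
    tape_eq C P (Q @ Q) (f \<Zsemi> splitw p Q) (splitw p P \<Zsemi> (f \<oplus> f))"

text \<open>An arrow of the tape category is an equivalence class of tapes together with its source
  and target word.\<close>

type_synonym ('o, 'a) tape_arr = "'o list \<times> ('o, 'a) tape set \<times> 'o list"

definition tape_class ::
  "('o, 'a, 'z) cat_scheme \<Rightarrow> 'o list \<Rightarrow> 'o list \<Rightarrow> ('o, 'a) tape \<Rightarrow> ('o, 'a) tape_arr" where
  "tape_class C P Q t = (P, {s. tape_eq C P Q t s}, Q)"

definition tape_seq ::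
  "('o, 'a, 'z) cat_scheme \<Rightarrow> ('o, 'a) tape_arr \<Rightarrow> ('o, 'a) tape_arr \<Rightarrow> ('o, 'a) tape_arr" where
  "tape_seq C = (\<lambda>(P, X, Q) (Q', Y, R).
    (P, \<Union>s\<in>X. \<Union>t\<in>Y. {u. tape_eq C P R (s \<Zsemi> t) u}, R))"

definition tape_par ::
  "('o, 'a, 'z) cat_scheme \<Rightarrow> ('o, 'a) tape_arr \<Rightarrow> ('o, 'a) tape_arr \<Rightarrow> ('o, 'a) tape_arr" where
  "tape_par C = (\<lambda>(P, X, Q) (P', Y, Q').
    (P @ P', \<Union>s\<in>X. \<Union>t\<in>Y. {u. tape_eq C (P @ P') (Q @ Q') (s \<oplus> t) u}, Q @ Q'))"

definition tape_plus ::
  "('o, 'a, 'z) cat_scheme \<Rightarrow> real \<Rightarrow> ('o, 'a) tape_arr \<Rightarrow> ('o, 'a) tape_arr \<Rightarrow> ('o, 'a) tape_arr"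
  where
  "tape_plus C p f g = (let P = fst f; Q = snd (snd f) in
    tape_seq C (tape_seq C (tape_class C P (P @ P) (splitw p P)) (tape_par C f g))
      (tape_class C (Q @ Q) Q (mergew Q)))"

definition tape_cat :: "('o, 'a, 'z) cat_scheme \<Rightarrow> ('o list, ('o, 'a) tape_arr) cbcat" where
  "tape_cat C =
    \<lparr>obj = words C,
     arr = {tape_class C P Q t | P Q t. tape_typed C P Q t},
     src = (\<lambda>f. fst f),
     tgt = (\<lambda>f. snd (snd f)),
     idn = (\<lambda>P. tape_class C P P (idw P)),
     cmp = tape_seq C,
     plus = tape_plus C,
     star = (\<lambda>P Q. tape_class C P Q (discardw P \<Zsemi> initw Q)),
     zob = [],
     osum = (\<lambda>P Q. P @ Q),
     inj1 = (\<lambda>P Q. tape_class C P (P @ Q) (idw P \<oplus> initw Q)),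
     inj2 = (\<lambda>P Q. tape_class C Q (P @ Q) (initw P \<oplus> idw Q)),
     prj1 = (\<lambda>P Q. tape_class C (P @ Q) P (idw P \<oplus> discardw Q)),
     prj2 = (\<lambda>P Q. tape_class C (P @ Q) Q (discardw P \<oplus> idw Q))\<rparr>"

text \<open>The action on a functor \<open>F : C \<rightarrow> D\<close>. The datatype map \<open>map_tape\<close> relabels the
  letters and the boxes of a tape and leaves its constructors unchanged.\<close>

definition tape_functor ::
  "('o, 'a, 'y) cat_scheme \<Rightarrow> ('p, 'b, 'z) cat_scheme \<Rightarrow> ('o, 'a, 'p, 'b) ftor \<Rightarrow>
    ('o list, ('o, 'a) tape_arr, 'p list, ('p, 'b) tape_arr) ftor" where
  "tape_functor C D F =
    \<lparr>fob = (\<lambda>P\<in>words C. map (fob F) P),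
     far = (\<lambda>(P, X, Q)\<in>arr (tape_cat C).
       (map (fob F) P,
        \<Union>t\<in>X. {u. tape_eq D (map (fob F) P) (map (fob F) Q) (map_tape (fob F) (far F) t) u},
        map (fob F) Q))\<rparr>"

definition tape_unit ::
  "('o, 'a, 'z) cat_scheme \<Rightarrow> ('o, 'a, 'o list, ('o, 'a) tape_arr) ftor" where
  "tape_unit C =
    \<lparr>fob = (\<lambda>A\<in>obj C. [A]),
     far = (\<lambda>c\<in>arr C. tape_class C [src C c] [tgt C c] (Box c))\<rparr>"

text \<open>The arrow \<open>C \<rightarrow> forget D\<close> corresponding to \<open>G : tape_cat C \<rightarrow> D\<close>.\<close>

definition adjunct ::
  "('o, 'a, 'z) cat_scheme \<Rightarrow> ('o list, ('o, 'a) tape_arr, 'p, 'b) ftor \<Rightarrow> ('o, 'a, 'p, 'b) ftor"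
  where
  "adjunct C G = comp_functor C (tape_unit C) G"

end

theory Submission
  imports Defs "HOL-Library.Indicator_Function"
begin

text \<open>Every arrow \<open>[U] \<rightarrow> Q\<close> of the tape category is a convex combination of boxes followed by
  injections, and every word is the coproduct of its letters; so a functor on the tape category
  that preserves this structure, and a transformation between two such functors, are determined by
  their values on boxes and letters. Conversely, tapes can be interpreted in any pca-enriched category with
  finite coproducts (a structural tape is determined by a function on positions of letters), which
  gives existence.

  The delicate point is that the projections of the tape category are jointly monic, since a pca need not be
  cancellative. Interpreting tapes by linear maps shows that the weights of a convex combination
  of boxes are invariants of the arrow; the projections restrict the weights, and by Stone's
  theorem the weights determine the arrow.\<close>

text \<open>Taken together, the two facts about weights say that the hom-set from a letter
  \<open>U\<close> to a word \<open>Q\<close> is the free pca on the pairs \<open>(j, c)\<close> of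
  a position of \<open>Q\<close> and an arrow of \<open>C\<close> into the letter at that position:
  by \<open>W_unique\<close> no two elements share their weights, by \<open>comb_weight\<close> no
  element has two families of weights. Freeness is what makes the projections jointly monic: they
  split the positions of the target into two disjoint blocks, and weights on a disjoint union are
  determined by their restrictions to the blocks.

  There is a circularity to avoid. The invariance of weights needs a sound interpretation of tapes
  at a point where the tape category is not yet known to be a convex biproduct category. The
  interpretation therefore asks its target only for pca-enrichment and for coproducts of the images
  of letters. One soundness proof then serves twice, for the linear model and for the universal
  property, where the target is an arbitrary convex biproduct category.\<close>

section \<open>Weights of convex combinations\<close>

text \<open>The function attached to an element is a formal subdistribution on generators; the mass
  missing from 1 sits on \<open>st\<close>. It is attached to derivations because a pca has only
  binary operations with open parameters, so a finite weighted sum of generators has no meaning of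
  its own before \<open>W_unique\<close>.\<close>

inductive wrep :: "(real \<Rightarrow> 'x \<Rightarrow> 'x \<Rightarrow> 'x) \<Rightarrow> 'x \<Rightarrow> 's set \<Rightarrow> ('s \<Rightarrow> 'x) \<Rightarrow> ('s \<Rightarrow> real) \<Rightarrow> 'x \<Rightarrow> bool"
  for pl st S g where
  wrep_star: "wrep pl st S g (\<lambda>_. 0) st"
| wrep_gen: "s \<in> S \<Longrightarrow> wrep pl st S g (indicator {s}) (g s)"
| wrep_plus: "0 < p \<Longrightarrow> p < 1 \<Longrightarrow> wrep pl st S g u x \<Longrightarrow> wrep pl st S g v y \<Longrightarrow>
    wrep pl st S g (\<lambda>s. p * u s + (1 - p) * v s) (pl p x y)"

locale pca_gens =
  fixes X :: "'x set" and pl :: "real \<Rightarrow> 'x \<Rightarrow> 'x \<Rightarrow> 'x" and st :: 'x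
    and S :: "'s set" and g :: "'s \<Rightarrow> 'x"
  assumes pca: "pca X pl st" and gens: "s \<in> S \<Longrightarrow> g s \<in> X"
begin

abbreviation "W \<equiv> wrep pl st S g"

lemma st_in: "st \<in> X"
  using pca unfolding pca_def by blast

lemma pl_in: "0 < p \<Longrightarrow> p < 1 \<Longrightarrow> x \<in> X \<Longrightarrow> y \<in> X \<Longrightarrow> pl p x y \<in> X"
  using pca[unfolded pca_def, THEN conjunct2, THEN conjunct1, rule_format, of p x y] by simp

lemma pl_assoc: "0 < p \<Longrightarrow> p < 1 \<Longrightarrow> 0 < q \<Longrightarrow> q < 1 \<Longrightarrow> x \<in> X \<Longrightarrow> y \<in> X \<Longrightarrow> z \<in> X \<Longrightarrow>
    pl p (pl q x y) z = pl (p * q) x (pl (p * (1 - q) / (1 - p * q)) y z)"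
  using pca[unfolded pca_def, THEN conjunct2, THEN conjunct2, THEN conjunct1, rule_format, of p q x y z]
  by simp

lemma pl_comm: "0 < p \<Longrightarrow> p < 1 \<Longrightarrow> x \<in> X \<Longrightarrow> y \<in> X \<Longrightarrow> pl p x y = pl (1 - p) y x"
  using pca[unfolded pca_def, THEN conjunct2, THEN conjunct2, THEN conjunct2, THEN conjunct1,
      rule_format, of p x y] unfolding greaterThanLessThan_iff by blast

lemma pl_idem: "0 < p \<Longrightarrow> p < 1 \<Longrightarrow> x \<in> X \<Longrightarrow> pl p x x = x"
  using pca[unfolded pca_def, THEN conjunct2, THEN conjunct2, THEN conjunct2, THEN conjunct2,
      rule_format, of p x] by simp

lemma W_in: "W w x \<Longrightarrow> x \<in> X"
  by (induction rule: wrep.induct) (auto simp: st_in gens pl_in)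

lemma W_nonneg: "W w x \<Longrightarrow> 0 \<le> w s"
  by (induction rule: wrep.induct) auto

lemma W_finite: "W w x \<Longrightarrow> finite {s. w s \<noteq> 0}"
proof (induction rule: wrep.induct)
  case (wrep_gen s)
  have "{t. indicator {s} t \<noteq> (0::real)} = {s}" by (auto simp: indicator_def)
  then show ?case by simp
next
  case (wrep_plus p u x v y)
  have "{s. p * u s + (1 - p) * v s \<noteq> 0} \<subseteq> {s. u s \<noteq> 0} \<union> {s. v s \<noteq> 0}" by auto
  then show ?case using wrep_plus by (meson finite_UnI finite_subset)
qed auto

lemma W_supp: "W w x \<Longrightarrow> s \<notin> S \<Longrightarrow> w s = 0"
  by (induction rule: wrep.induct) (auto simp: indicator_def)

text \<open>Weights are nonnegative, so a vanishing combination has two vanishing parts, and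
  idempotence collapses the sum of two stars.\<close>

lemma W_zero:
  assumes "W w x" and "\<And>s. w s = 0"
  shows "x = st"
  using assms
proof (induction rule: wrep.induct)
  case (wrep_gen s)
  from wrep_gen(2)[of s] show ?case by simp
next
  case (wrep_plus p u x v y)
  have "u s = 0 \<and> v s = 0" for s
  proof -
    have "0 \<le> u s" "0 \<le> v s" using wrep_plus W_nonneg by auto
    then have "0 \<le> p * u s" "0 \<le> (1 - p) * v s" using wrep_plus by auto
    then have "p * u s = 0" "(1 - p) * v s = 0" using wrep_plus.prems[of s] by linarith+
    then show ?thesis using wrep_plus by auto
  qed
  then show ?case using wrep_plus pl_idem st_in by auto
qed auto

text \<open>Normal form with all occurrences of \<open>g s\<close> gathered in front. The first
  disjunct is the limit case \<open>p = 1\<close>, which lies outside the range of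
  \<open>pl\<close>. The condition \<open>v s = 0\<close> says that the rest avoids
  \<open>s\<close>, and it makes \<open>p\<close> the weight of \<open>s\<close>.\<close>

definition pulled :: "'s \<Rightarrow> ('s \<Rightarrow> real) \<Rightarrow> 'x \<Rightarrow> bool" where
  "pulled s w x \<longleftrightarrow>
    (w = indicator {s} \<and> x = g s) \<or>
    (\<exists>p v y. 0 < p \<and> p < 1 \<and> W v y \<and> v s = 0 \<and> x = pl p (g s) y \<and>
      w = (\<lambda>t. p * indicator {s} t + (1 - p) * v t))"

lemma pulledI:
  assumes "0 < p" "p < 1" "W v y" "v s = 0" "x = pl p (g s) y"
    "\<And>t. w t = p * indicator {s} t + (1 - p) * v t"
  shows "pulled s w x"
  unfolding pulled_def using assms by blast

text \<open>Reassociation: \<open>(g s +_p z) +_r y = g s +_{rp} (z +_t y)\<close>, and the new rest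
  avoids \<open>s\<close> because \<open>z\<close> and \<open>y\<close> do.\<close>

lemma pulled_plus_left:
  assumes s: "s \<in> S" and x: "pulled s w x" and r: "0 < r" "r < 1" and y: "W u y" "u s = 0"
  shows "pulled s (\<lambda>t. r * w t + (1 - r) * u t) (pl r x y)"
  using x[unfolded pulled_def]
proof
  assume "w = indicator {s} \<and> x = g s"
  then show ?thesis using assms by (intro pulledI[of r u y]) auto
next
  assume "\<exists>p v z. 0 < p \<and> p < 1 \<and> W v z \<and> v s = 0 \<and> x = pl p (g s) z \<and>
      w = (\<lambda>t. p * indicator {s} t + (1 - p) * v t)"
  then obtain p v z where p: "0 < p" "p < 1" and z: "W v z" "v s = 0" "x = pl p (g s) z"
    and w: "w = (\<lambda>t. p * indicator {s} t + (1 - p) * v t)" by blast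
  define t where "t = r * (1 - p) / (1 - r * p)"
  have rp: "0 < r * p" "r * p < 1" using r p by (simp, metis mult_strict_mono' less_eq_real_def mult_1 zero_less_one)
  have t: "0 < t" "t < 1" using rp r p by (auto simp: t_def field_simps)
  have "pl r x y = pl (r * p) (g s) (pl t z y)"
    unfolding t_def z(3) using r p W_in[OF z(1)] W_in[OF y(1)] gens[OF s] by (intro pl_assoc)
  moreover have "W (\<lambda>a. t * v a + (1 - t) * u a) (pl t z y)"
    using t z y by (intro wrep_plus)
  moreover have "r * w a + (1 - r) * u a =
      r * p * indicator {s} a + (1 - r * p) * (t * v a + (1 - t) * u a)" for a
  proof -
    have "(1 - r * p) * t = r * (1 - p)" using rp by (simp add: t_def)
    then have "(1 - r * p) * (t * v a + (1 - t) * u a) = r * (1 - p) * v a + (1 - r) * u a"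
      by algebra
    then show ?thesis by (simp add: w algebra_simps)
  qed
  ultimately show ?thesis using rp z y
    by (intro pulledI[of "r * p" "\<lambda>a. t * v a + (1 - t) * u a" "pl t z y"]) auto
qed

text \<open>Two occurrences of \<open>g s\<close> are fused by idempotence read backwards: write
  \<open>g s\<close> as \<open>g s +_q g s\<close> and reassociate.\<close>

lemma pulled_gen_plus:
  assumes s: "s \<in> S" and x: "pulled s w x" and r: "0 < r" "r < 1"
  shows "pulled s (\<lambda>t. r * indicator {s} t + (1 - r) * w t) (pl r (g s) x)"
  using x[unfolded pulled_def]
proof
  assume *: "w = indicator {s} \<and> x = g s"
  have "pl r (g s) (g s) = g s" using r s gens pl_idem by auto
  then show ?thesis using * unfolding pulled_def by (auto simp: algebra_simps)
next
  assume "\<exists>p v z. 0 < p \<and> p < 1 \<and> W v z \<and> v s = 0 \<and> x = pl p (g s) z \<and>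
      w = (\<lambda>t. p * indicator {s} t + (1 - p) * v t)"
  then obtain p v z where p: "0 < p" "p < 1" and z: "W v z" "v s = 0" "x = pl p (g s) z"
    and w: "w = (\<lambda>t. p * indicator {s} t + (1 - p) * v t)" by blast
  \<comment> \<open>\<open>a\<close> is the total weight of \<open>s\<close>. With
    \<open>q = r / a\<close> one gets \<open>a * q = r\<close>, and the inner parameter
    \<open>a * (1 - q) / (1 - a * q)\<close> of the reassociated sum comes out as
    \<open>p\<close>.\<close>
  define a where "a = r + p * (1 - r)"
  define q where "q = r / a"
  have a: "r < a" using p r by (simp add: a_def)
  moreover have "a < 1" using mult_strict_right_mono[of p 1 "1 - r"] p r by (simp add: a_def algebra_simps)
  ultimately have a: "0 < a" "a < 1" "r < a" using r by auto
  have q: "0 < q" "q < 1" using a r by (auto simp: q_def)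
  have aq: "a * q = r" using a by (simp add: q_def)
  have "a * (1 - q) = p * (1 - r)" using aq by (simp add: right_diff_distrib) (simp add: a_def algebra_simps)
  then have "a * (1 - q) / (1 - a * q) = p" using aq r by simp
  then have "pl a (pl q (g s) (g s)) z = pl r (g s) (pl p (g s) z)"
    using pl_assoc[of a q "g s" "g s" z] a q W_in[OF z(1)] gens[OF s] aq by simp
  then have "pl r (g s) x = pl a (g s) z" using q s gens pl_idem z by simp
  then show ?thesis using z a
    by (intro pulledI[of a v z]) (auto simp: w a_def algebra_simps)
qed

text \<open>If only one summand of a sum mentions \<open>s\<close>, that summand is brought to the
  left. If both do, \<open>g s\<close> is pulled out of the left one, the remainder is added to the
  right one, which is in normal form already, and the two occurrences of \<open>g s\<close> are
  fused.\<close>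

lemma W_pulled:
  assumes "W w x" and "w s > 0"
  shows "pulled s w x"
proof -
  have s: "s \<in> S" using W_supp[OF assms(1), of s] assms(2) by auto
  show ?thesis using assms
  proof (induction rule: wrep.induct)
    case (wrep_gen t)
    then have "t = s" by (auto simp: indicator_def split: if_splits)
    then show ?case by (simp add: pulled_def)
  next
    case (wrep_plus r u x v y)
    note X = W_in[OF wrep_plus(3)] W_in[OF wrep_plus(4)]
    have swap: "(\<lambda>t. r * u t + (1 - r) * v t) = (\<lambda>t. (1 - r) * v t + (1 - (1 - r)) * u t)"
      by auto
    consider "u s = 0" | "v s = 0" "u s > 0" | "u s > 0" "v s > 0"
      using W_nonneg[OF wrep_plus(3), of s] W_nonneg[OF wrep_plus(4), of s] by linarith
    then show ?case
    proof cases
      case 1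
      then have "v s > 0" using wrep_plus by (simp add: zero_less_mult_iff)
      then have "pulled s (\<lambda>t. (1 - r) * v t + (1 - (1 - r)) * u t) (pl (1 - r) y x)"
        using pulled_plus_left[OF s, of v y "1 - r" u x] wrep_plus 1 by auto
      then show ?thesis using swap pl_comm[of r x y] wrep_plus X by simp
    next
      case 2
      then show ?thesis using pulled_plus_left[OF s, of u x r v y] wrep_plus by auto
    next
      case 3
      then have ux: "pulled s u x" and vy: "pulled s v y" using wrep_plus by auto
      from ux[unfolded pulled_def] show ?thesis
      proof
        assume "u = indicator {s} \<and> x = g s"
        then show ?thesis using pulled_gen_plus[OF s vy] wrep_plus by auto
      next
        assume "\<exists>p u' z. 0 < p \<and> p < 1 \<and> W u' z \<and> u' s = 0 \<and> x = pl p (g s) z \<and>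
            u = (\<lambda>t. p * indicator {s} t + (1 - p) * u' t)"
        then obtain p u' z where p: "0 < p" "p < 1" and z: "W u' z" "u' s = 0" "x = pl p (g s) z"
          and u: "u = (\<lambda>t. p * indicator {s} t + (1 - p) * u' t)" by blast
        define t where "t = r * (1 - p) / (1 - r * p)"
        have r: "0 < r" "r < 1" using wrep_plus by auto
        have rp: "0 < r * p" "r * p < 1" using r p by (simp, metis mult_strict_mono' less_eq_real_def mult_1 zero_less_one)
        have t: "0 < t" "t < 1" using rp r p by (auto simp: t_def field_simps)
        \<comment> \<open>The operands are exchanged so that the pulled summand \<open>y\<close>
          stands on the left, as \<open>pulled_plus_left\<close> requires; hence the parameter
          \<open>1 - t\<close>.\<close>
        have "pulled s (\<lambda>a. (1 - t) * v a + (1 - (1 - t)) * u' a) (pl (1 - t) y z)"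
          using pulled_plus_left[OF s vy, of "1 - t" u' z] t z by auto
        from pulled_gen_plus[OF s this rp]
        have "pulled s (\<lambda>a. r * p * indicator {s} a + (1 - r * p) * ((1 - t) * v a + (1 - (1 - t)) * u' a))
            (pl (r * p) (g s) (pl (1 - t) y z))" .
        moreover have "pl r x y = pl (r * p) (g s) (pl (1 - t) y z)"
        proof -
          have "pl r x y = pl (r * p) (g s) (pl t z y)"
            unfolding t_def z(3) using r p W_in[OF z(1)] X gens[OF s] by (intro pl_assoc)
          then show ?thesis using pl_comm[of t z y] t W_in[OF z(1)] X by simp
        qed
        moreover have "r * u a + (1 - r) * v a =
            r * p * indicator {s} a + (1 - r * p) * ((1 - t) * v a + (1 - (1 - t)) * u' a)" for a
        proof -
          have "(1 - r * p) * t = r * (1 - p)" using rp by (simp add: t_def)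
          then have "(1 - r * p) * ((1 - t) * v a + (1 - (1 - t)) * u' a) = r * (1 - p) * u' a + (1 - r) * v a"
            by algebra
          then show ?thesis by (simp add: u algebra_simps)
        qed
        ultimately show ?thesis by simp
      qed
    qed
  qed simp
qed

text \<open>Stone's theorem: pull one generator out of both representations and induct on the support.\<close>

theorem W_unique: "W w x \<Longrightarrow> W w y \<Longrightarrow> x = y"
proof (induction "card {s. w s \<noteq> 0}" arbitrary: w x y rule: less_induct)
  case less
  show ?case
  proof (cases "\<exists>s. w s \<noteq> 0")
    case False
    then show ?thesis using W_zero less.prems by metis
  next
    case True
    then obtain s where ws: "w s > 0" using W_nonneg[OF less.prems(1)] by (metis less_eq_real_def)
    note px = W_pulled[OF less.prems(1) ws] and py = W_pulled[OF less.prems(2) ws]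
    show ?thesis
    proof (cases "w s = 1")
      case True
      \<comment> \<open>Weight 1 excludes the second disjunct of \<open>pulled\<close>, in which the
        weight of \<open>s\<close> is a \<open>p\<close> below 1.\<close>
      then have "w = indicator {s} \<and> z = g s" if "pulled s w z" for z
        using that unfolding pulled_def by (auto simp: fun_eq_iff dest: spec[of _ s])
      from this[OF px] this[OF py] show ?thesis by simp
    next
      case False
      obtain p v z where p: "0 < p" "p < 1" and z: "W v z" "v s = 0" "x = pl p (g s) z"
        and w: "w = (\<lambda>t. p * indicator {s} t + (1 - p) * v t)"
        using px False unfolding pulled_def by auto
      obtain p' v' z' where p': "0 < p'" "p' < 1" and z': "W v' z'" "v' s = 0" "y = pl p' (g s) z'"
        and w': "w = (\<lambda>t. p' * indicator {s} t + (1 - p') * v' t)"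
        using py False unfolding pulled_def by auto
      \<comment> \<open>Both parameters are the weight of \<open>s\<close>, so they agree, and
        dividing by \<open>1 - p\<close> the rests have equal weights too.\<close>
      have pp: "p' = p" using fun_cong[OF w, of s] fun_cong[OF w', of s] z z' by simp
      have "v' = v"
      proof
        fix t
        have "(1 - p) * v' t = (1 - p) * v t"
          using fun_cong[OF w, of t] fun_cong[OF w', of t] pp by simp
        then show "v' t = v t" using p by simp
      qed
      moreover have "card {t. v t \<noteq> 0} < card {t. w t \<noteq> 0}"
      proof (rule psubset_card_mono)
        have "v t = 0" if "w t = 0" for t
        proof -
          have "0 \<le> (1 - p) * v t" using W_nonneg[OF z(1), of t] p by simp
          moreover have "0 \<le> p * indicator {s} t" using p by simp
          ultimately have "(1 - p) * v t = 0" using fun_cong[OF w, of t] that by linarith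
          then show ?thesis using p by simp
        qed
        then show "{t. v t \<noteq> 0} \<subset> {t. w t \<noteq> 0}" using z ws by force
      qed (rule W_finite[OF less.prems(1)])
      ultimately have "z = z'" using less.hyps z z' by blast
      then show ?thesis using z z' pp by simp
    qed
  qed
qed

end

section \<open>Coproducts in pca-enriched categories\<close>

lemma hom_iff: "f \<in> hom C A B \<longleftrightarrow> f \<in> arr C \<and> src C f = A \<and> tgt C f = B"
  by (simp add: hom_def)

context category
begin

lemma hom_objD: "f \<in> hom C A B \<Longrightarrow> A \<in> obj C \<and> B \<in> obj C"
  using src_obj tgt_obj by (auto simp: hom_iff)

lemma cmp_arr:
  assumes "f \<in> arr C" "g \<in> arr C" "tgt C f = src C g"
  shows "f ;; g \<in> arr C" "src C (f ;; g) = src C f" "tgt C (f ;; g) = tgt C g"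
  using cmp_hom[of f "src C f" "tgt C f" g "tgt C g"] assms by (simp_all add: hom_iff)

lemma idn_arr:
  assumes "A \<in> obj C"
  shows "idn C A \<in> arr C" "src C (idn C A) = A" "tgt C (idn C A) = A"
  using idn_hom[OF assms] by (simp_all add: hom_iff)

lemma coproduct_ext:
  assumes "is_coproduct C X1 X2 S i1 i2" "h \<in> hom C S A" "k \<in> hom C S A"
    "i1 ;; h = i1 ;; k" "i2 ;; h = i2 ;; k"
  shows "h = k"
proof -
  have A: "A \<in> obj C" using hom_objD assms by blast
  have "i1 ;; h \<in> hom C X1 A" "i2 ;; h \<in> hom C X2 A"
    using assms cmp_hom unfolding is_coproduct_def by blast+
  then have "\<exists>!l. l \<in> hom C S A \<and> i1 ;; l = i1 ;; h \<and> i2 ;; l = i2 ;; h"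
    using assms(1) A unfolding is_coproduct_def by blast
  then show ?thesis using assms by metis
qed

lemma coproduct_ex:
  assumes "is_coproduct C X1 X2 S i1 i2" "f1 \<in> hom C X1 A" "f2 \<in> hom C X2 A"
  obtains h where "h \<in> hom C S A" "i1 ;; h = f1" "i2 ;; h = f2"
  using assms hom_objD[OF assms(2)] unfolding is_coproduct_def by blast

lemma coproduct_iso:
  assumes c: "is_coproduct C X1 X2 S i1 i2" and d: "is_coproduct C X1 X2 T j1 j2"
  obtains u v where "u \<in> hom C S T" "v \<in> hom C T S" "i1 ;; u = j1" "i2 ;; u = j2"
    "j1 ;; v = i1" "j2 ;; v = i2" "u ;; v = idn C S" "v ;; u = idn C T"
proof -
  have i: "i1 \<in> hom C X1 S" "i2 \<in> hom C X2 S" and S: "S \<in> obj C"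
    using c unfolding is_coproduct_def by auto
  have j: "j1 \<in> hom C X1 T" "j2 \<in> hom C X2 T" and T: "T \<in> obj C"
    using d unfolding is_coproduct_def by auto
  obtain u where u: "u \<in> hom C S T" "i1 ;; u = j1" "i2 ;; u = j2"
    using coproduct_ex[OF c j] by blast
  obtain v where v: "v \<in> hom C T S" "j1 ;; v = i1" "j2 ;; v = i2"
    using coproduct_ex[OF d i] by blast
  have "i1 ;; (u ;; v) = i1" "i2 ;; (u ;; v) = i2" "j1 ;; (v ;; u) = j1" "j2 ;; (v ;; u) = j2"
    using u v i j by (simp_all flip: cmp_assoc)
  then have "u ;; v = idn C S" "v ;; u = idn C T"
    using coproduct_ext[OF c, of "u ;; v" S "idn C S"] coproduct_ext[OF d, of "v ;; u" T "idn C T"]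
      cmp_hom[OF u(1) v(1)] cmp_hom[OF v(1) u(1)] idn_hom S T cmp_idr i j by auto
  then show ?thesis using that u v by blast
qed

lemma initial_ext: "is_initial C Z \<Longrightarrow> f \<in> hom C Z A \<Longrightarrow> g \<in> hom C Z A \<Longrightarrow> f = g"
  using hom_objD unfolding is_initial_def by metis

end

section \<open>Coproducts of finite lists of objects\<close>

text \<open>Indexing by a list fixes no bracketing, so one notion covers a word, its image under a
  functor, and an initial object (the empty list, \<open>ncop_Nil\<close>).\<close>

definition is_ncop :: "('o, 'a, 'z) cat_scheme \<Rightarrow> 'o list \<Rightarrow> 'o \<Rightarrow> (nat \<Rightarrow> 'a) \<Rightarrow> bool" where
  "is_ncop C Xs S e \<longleftrightarrow>
    set Xs \<subseteq> obj C \<and> S \<in> obj C \<and> (\<forall>i<length Xs. e i \<in> hom C (Xs ! i) S) \<and>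
    (\<forall>A\<in>obj C. \<forall>g. (\<forall>i<length Xs. g i \<in> hom C (Xs ! i) A) \<longrightarrow>
      (\<exists>!h. h \<in> hom C S A \<and> (\<forall>i<length Xs. e i ;;\<^bsub>C\<^esub> h = g i)))"

lemma ncop_cong:
  assumes "is_ncop C Xs S e" "\<And>i. i < length Xs \<Longrightarrow> e i = e' i"
  shows "is_ncop C Xs S e'"
  using assms unfolding is_ncop_def by (simp cong: conj_cong all_cong)

lemma ncop_obj: "is_ncop C Xs S e \<Longrightarrow> S \<in> obj C"
  by (simp add: is_ncop_def)

lemma ncop_in: "is_ncop C Xs S e \<Longrightarrow> i < length Xs \<Longrightarrow> e i \<in> hom C (Xs ! i) S"
  by (simp add: is_ncop_def)

lemma ncop_Nil: "is_ncop C [] Z e \<longleftrightarrow> is_initial C Z"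
  by (auto simp: is_ncop_def is_initial_def)

context category
begin

lemma ncop_ext:
  assumes "is_ncop C Xs S e" "h \<in> hom C S A" "k \<in> hom C S A"
    "\<And>i. i < length Xs \<Longrightarrow> e i ;; h = e i ;; k"
  shows "h = k"
proof -
  have A: "A \<in> obj C" using hom_objD assms by blast
  have "\<forall>i<length Xs. e i ;; h \<in> hom C (Xs ! i) A"
    using assms cmp_hom unfolding is_ncop_def by blast
  then have "\<exists>!l. l \<in> hom C S A \<and> (\<forall>i<length Xs. e i ;; l = e i ;; h)"
    using assms(1) A unfolding is_ncop_def by simp
  moreover have "\<forall>i<length Xs. e i ;; k = e i ;; h" using assms(4) by simp
  ultimately show ?thesis using assms(2,3) by blast
qed

lemma ncop_ex:
  assumes "is_ncop C Xs S e" "A \<in> obj C" "\<And>i. i < length Xs \<Longrightarrow> g i \<in> hom C (Xs ! i) A"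
  obtains h where "h \<in> hom C S A" "\<And>i. i < length Xs \<Longrightarrow> e i ;; h = g i"
  using assms unfolding is_ncop_def by blast

lemma ncop_single: "X \<in> obj C \<Longrightarrow> is_ncop C [X] X (\<lambda>_. idn C X)"
  unfolding is_ncop_def by (auto simp: idn_hom cmp_idl intro: ex1I)

lemma ncop_Cons:
  assumes c: "is_coproduct C X S T i1 i2" and n: "is_ncop C Xs S e"
  shows "is_ncop C (X # Xs) T (\<lambda>i. case i of 0 \<Rightarrow> i1 | Suc k \<Rightarrow> e k ;; i2)"
  unfolding is_ncop_def
proof (intro conjI ballI allI impI)
  let ?e = "\<lambda>i. case i of 0 \<Rightarrow> i1 | Suc k \<Rightarrow> e k ;; i2"
  note C = c[unfolded is_coproduct_def] and N = n[unfolded is_ncop_def]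
  show "set (X # Xs) \<subseteq> obj C" "T \<in> obj C" using C N by auto
  show "?e i \<in> hom C ((X # Xs) ! i) T" if "i < length (X # Xs)" for i
    using that C N by (cases i) (auto intro: cmp_hom)
  fix A g assume A: "A \<in> obj C" and g: "\<forall>i<length (X # Xs). g i \<in> hom C ((X # Xs) ! i) A"
  have "g (Suc i) \<in> hom C (Xs ! i) A" if "i < length Xs" for i using g that by auto
  then obtain h2 where h2: "h2 \<in> hom C S A" "\<And>i. i < length Xs \<Longrightarrow> e i ;; h2 = g (Suc i)"
    using ncop_ex[OF n A, of "\<lambda>i. g (Suc i)"] by blast
  have "g 0 \<in> hom C X A" using g by force
  then obtain h where h: "h \<in> hom C T A" "i1 ;; h = g 0" "i2 ;; h = h2"
    using coproduct_ex[OF c _ h2(1)] by blast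
  have eh: "(e i ;; i2) ;; l = e i ;; (i2 ;; l)" if "i < length Xs" "l \<in> hom C T A" for i l
    using cmp_assoc[OF ncop_in[OF n that(1)] _ that(2)] C by blast
  show "\<exists>!h. h \<in> hom C T A \<and> (\<forall>i<length (X # Xs). ?e i ;; h = g i)"
  proof (intro ex1I[of _ h] conjI allI impI)
    show "?e i ;; h = g i" if "i < length (X # Xs)" for i
      using that h h2 eh by (cases i) auto
    fix l assume l: "l \<in> hom C T A \<and> (\<forall>i<length (X # Xs). ?e i ;; l = g i)"
    then have l0: "i1 ;; l = g 0" and l1: "\<And>i. i < length Xs \<Longrightarrow> e i ;; (i2 ;; l) = g (Suc i)"
      using eh by force+
    have "i2 ;; l = h2"
      using l l1 h2 C by (intro ncop_ext[OF n _ h2(1)]) (auto intro: cmp_hom)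
    then show "l = h" using coproduct_ext[OF c, of l A h] l l0 h by simp
  qed (rule h)
qed

text \<open>Grouping of summands: a cocone on \<open>S\<close> and \<open>T\<close> amounts to a
  cocone on all entries of the concatenated list. The binary coproducts of interpreted words come
  from here.\<close>

lemma coproduct_of_ncop:
  assumes n: "is_ncop C Xs S e" and m: "is_ncop C Ys T e'" and r: "is_ncop C (Xs @ Ys) R d"
    and X: "S \<in> obj C" "T \<in> obj C" and i: "i1 \<in> hom C S R" "i2 \<in> hom C T R"
    and e1: "\<And>i. i < length Xs \<Longrightarrow> e i ;; i1 = d i"
    and e2: "\<And>i. i < length Ys \<Longrightarrow> e' i ;; i2 = d (length Xs + i)"
  shows "is_coproduct C S T R i1 i2"
  unfolding is_coproduct_def
proof (intro conjI ballI)
  show "S \<in> obj C" "T \<in> obj C" "R \<in> obj C" "i1 \<in> hom C S R" "i2 \<in> hom C T R"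
    using X i hom_objD by auto
  fix A f1 f2 assume A: "A \<in> obj C" and f: "f1 \<in> hom C S A" "f2 \<in> hom C T A"
  define g where "g i = (if i < length Xs then e i ;; f1 else e' (i - length Xs) ;; f2)" for i
  have "g i \<in> hom C ((Xs @ Ys) ! i) A" if "i < length (Xs @ Ys)" for i
    using that f ncop_in[OF n] ncop_in[OF m]
    by (auto simp: g_def nth_append intro!: cmp_hom)
  then obtain h where h: "h \<in> hom C R A" "\<And>i. i < length (Xs @ Ys) \<Longrightarrow> d i ;; h = g i"
    using ncop_ex[OF r A, of g] by blast
  have a1: "e i ;; (i1 ;; l) = d i ;; l" if "i < length Xs" "l \<in> hom C R A" for i l
    using e1[OF that(1)] cmp_assoc[OF ncop_in[OF n that(1)] i(1) that(2)] by simp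
  have a2: "e' j ;; (i2 ;; l) = d (length Xs + j) ;; l" if "j < length Ys" "l \<in> hom C R A" for j l
    using e2[OF that(1)] cmp_assoc[OF ncop_in[OF m that(1)] i(2) that(2)] by simp
  show "\<exists>!h. h \<in> hom C R A \<and> i1 ;; h = f1 \<and> i2 ;; h = f2"
  proof (intro ex1I[of _ h] conjI)
    show "i1 ;; h = f1" using h f i a1
      by (intro ncop_ext[OF n _ f(1)]) (auto intro: cmp_hom simp: g_def)
    show "i2 ;; h = f2" using h f i a2
      by (intro ncop_ext[OF m _ f(2)]) (auto intro: cmp_hom simp: g_def)
    fix l assume l: "l \<in> hom C R A \<and> i1 ;; l = f1 \<and> i2 ;; l = f2"
    show "l = h"
    proof (rule ncop_ext[OF r _ h(1)])
      fix k assume k: "k < length (Xs @ Ys)"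
      show "d k ;; l = d k ;; h"
      proof (cases "k < length Xs")
        case True
        then show ?thesis using a1[of k l] l h(2)[OF k] by (simp add: g_def)
      next
        case False
        then show ?thesis using a2[of "k - length Xs" l] l h(2)[OF k] k by (simp add: g_def)
      qed
    qed (use l in blast)
  qed (rule h)
qed

end

text \<open>A singleton is not padded with \<open>zob D\<close>. In a target that is not strict,
  \<open>osum D X (zob D)\<close> is only isomorphic to \<open>X\<close>, while the functor induced
  by \<open>H\<close> must send the word \<open>[U]\<close> to \<open>fob H U\<close> itself for its
  adjunct to be \<open>H\<close> on the nose.\<close>

primrec nob :: "('o, 'a, 'z) cbcat_scheme \<Rightarrow> 'o list \<Rightarrow> 'o" where
  "nob D [] = zob D"
| "nob D (X # Xs) = (if Xs = [] then X else osum D X (nob D Xs))"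

primrec nin :: "('o, 'a, 'z) cbcat_scheme \<Rightarrow> 'o list \<Rightarrow> nat \<Rightarrow> 'a" where
  "nin D [] i = undefined"
| "nin D (X # Xs) i = (if Xs = [] then idn D X else
    (case i of 0 \<Rightarrow> inj1 D X (nob D Xs) | Suc k \<Rightarrow> nin D Xs k ;;\<^bsub>D\<^esub> inj2 D X (nob D Xs)))"

text \<open>This is what the tape category satisfies before its projections are known to be jointly
  monic, and it suffices for summing up the letters of a word.\<close>

locale pca_coproduct_category = pca_category C
  for C :: "('o, 'a, 'z) cbcat_scheme" (structure) +
  assumes zob_init: "is_initial C (zob C)"
    and osum_cop: "X1 \<in> obj C \<Longrightarrow> X2 \<in> obj C \<Longrightarrow>
      is_coproduct C X1 X2 (osum C X1 X2) (inj1 C X1 X2) (inj2 C X1 X2)"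
begin

lemma ncop_nob: "set Xs \<subseteq> obj C \<Longrightarrow> is_ncop C Xs (nob C Xs) (nin C Xs)"
proof (induction Xs)
  case Nil
  then show ?case by (simp add: ncop_Nil zob_init)
next
  case (Cons X Xs)
  show ?case
  proof (cases "Xs = []")
    case True
    then show ?thesis using Cons ncop_cong[OF ncop_single[of X]] by simp
  next
    case False
    have "is_ncop C (X # Xs) (osum C X (nob C Xs))
        (\<lambda>i. case i of 0 \<Rightarrow> inj1 C X (nob C Xs) | Suc k \<Rightarrow> nin C Xs k ;; inj2 C X (nob C Xs))"
      using Cons ncop_obj[of C Xs "nob C Xs" "nin C Xs"] by (intro ncop_Cons) (auto simp: osum_cop)
    then show ?thesis using False by (auto elim!: ncop_cong)
  qed
qed

end

sublocale convex_biproduct_category \<subseteq> pca_coproduct_category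
  by unfold_locales (simp_all add: zob_initial osum_coproduct)

section \<open>Scaling and the existence half of convex products\<close>

context pca_category
begin

lemma pca_gens_hom: "A \<in> obj C \<Longrightarrow> B \<in> obj C \<Longrightarrow> (\<And>s. s \<in> S \<Longrightarrow> g s \<in> hom C A B) \<Longrightarrow>
    pca_gens (hom C A B) (plus C) (star C A B) S g"
  by unfold_locales (simp_all add: hom_pca)

lemma pca_gens0: "A \<in> obj C \<Longrightarrow> B \<in> obj C \<Longrightarrow>
    pca_gens (hom C A B) (plus C) (star C A B) {} undefined"
  by (rule pca_gens_hom) auto

lemma star_hom: "A \<in> obj C \<Longrightarrow> B \<in> obj C \<Longrightarrow> star C A B \<in> hom C A B"
  by (rule pca_gens.st_in[OF pca_gens0])

lemma plus_hom: "0 < p \<Longrightarrow> p < 1 \<Longrightarrow> f \<in> hom C A B \<Longrightarrow> g \<in> hom C A B \<Longrightarrow> plus C p f g \<in> hom C A B"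
  using pca_gens.pl_in[OF pca_gens0] hom_objD by metis

lemma scale_hom: "0 \<le> p \<Longrightarrow> p \<le> 1 \<Longrightarrow> f \<in> hom C A B \<Longrightarrow> scale C p f \<in> hom C A B"
  using hom_objD[of f A B] star_hom[of A B] plus_hom[of p f A B "star C A B"]
  by (auto simp: scale_def hom_iff)

lemma scale_cmp: "0 \<le> p \<Longrightarrow> p \<le> 1 \<Longrightarrow> f \<in> hom C A B \<Longrightarrow> g \<in> hom C B D \<Longrightarrow>
    scale C p f ;; g = scale C p (f ;; g)"
  using hom_objD[of f A B] cmp_hom[of f A B g D]
  by (auto simp: scale_def hom_iff cmp_star_left[of A g B D] cmp_plus_left[of p f A B "star C A B" g D] star_hom[unfolded hom_iff])

lemma scale_star: "0 \<le> p \<Longrightarrow> p \<le> 1 \<Longrightarrow> A \<in> obj C \<Longrightarrow> B \<in> obj C \<Longrightarrow>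
    scale C p (star C A B) = star C A B"
  using star_hom[of A B] pca_gens.pl_idem[OF pca_gens0[of A B], of p "star C A B"]
  by (auto simp: scale_def hom_iff)

text \<open>The end points \<open>q = 0\<close> and \<open>q = 1\<close> are separate clauses of
  \<open>scale\<close>. In between, reassociation brings the two stars together and idempotence
  collapses them.\<close>

lemma plus_star_scale:
  assumes "0 < p" "p < 1" "0 \<le> q" "q \<le> 1" "f \<in> hom C A B"
  shows "plus C p (star C A B) (scale C q f) = scale C ((1 - p) * q) f"
proof -
  note AB = hom_objD[OF assms(5)]
  interpret g: pca_gens "hom C A B" "plus C" "star C A B" "{}" undefined
    using AB by (intro pca_gens0) auto
  have q: "scale C q f \<in> hom C A B" using assms by (intro scale_hom)
  have sc: "scale C q f = (if q = 0 then star C A B else if q = 1 then f else plus C q f (star C A B))" for q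
    using assms(5) by (simp add: scale_def hom_iff)
  have "plus C p (star C A B) (scale C q f) = plus C (1 - p) (scale C q f) (star C A B)"
    using assms q g.st_in by (intro g.pl_comm)
  also have "\<dots> = scale C ((1 - p) * q) f"
  proof -
    consider "q = 0" | "q = 1" | "0 < q" "q < 1" using assms by linarith
    then show ?thesis
    proof cases
      case 1
      then show ?thesis using assms g.pl_idem[OF _ _ g.st_in, of "1 - p"] by (simp add: sc)
    next
      case 2
      then show ?thesis using assms by (simp add: sc)
    next
      case 3
      have pq: "0 < (1 - p) * q" "(1 - p) * q < 1 - p" using assms 3 by auto
      have "plus C (1 - p) (plus C q f (star C A B)) (star C A B) =
        plus C ((1 - p) * q) f (plus C ((1 - p) * (1 - q) / (1 - (1 - p) * q)) (star C A B) (star C A B))"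
        using assms 3 g.st_in by (intro g.pl_assoc) auto
      moreover have "0 < (1 - p) * (1 - q) / (1 - (1 - p) * q)" using assms 3 pq by auto
      moreover have "(1 - p) * (1 - q) < 1 - (1 - p) * q"
        using assms by (simp add: algebra_simps)
      then have "(1 - p) * (1 - q) / (1 - (1 - p) * q) < 1"
        using pq assms by (subst divide_less_eq_1_pos) linarith+
      ultimately show ?thesis using assms 3 pq g.st_in by (simp add: sc g.pl_idem)
    qed
  qed
  finally show ?thesis .
qed

text \<open>Existence of mediating arrows follows from the matrix equations between injections and
  projections; uniqueness is the half that depends on the category. The witness is a convex
  combination of \<open>f1 ;; i1\<close> and \<open>f2 ;; i2\<close> with masses \<open>p1\<close>
  and \<open>p2\<close>.\<close>

lemma convex_product_ex:
  assumes i: "i1 \<in> hom C X1 S" "i2 \<in> hom C X2 S" and q: "q1 \<in> hom C S X1" "q2 \<in> hom C S X2"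
    and e: "i1 ;; q1 = idn C X1" "i2 ;; q2 = idn C X2" "i1 ;; q2 = star C X1 X2" "i2 ;; q1 = star C X2 X1"
    and f: "f1 \<in> hom C A X1" "f2 \<in> hom C A X2" and p: "0 \<le> p1" "0 \<le> p2" "p1 + p2 \<le> 1"
  obtains h where "h \<in> hom C A S" "h ;; q1 = scale C p1 f1" "h ;; q2 = scale C p2 f2"
proof -
  have X: "A \<in> obj C" "X1 \<in> obj C" "X2 \<in> obj C" "S \<in> obj C" using hom_objD i f by auto
  have f1q: "f1 ;; i1 \<in> hom C A S" "(f1 ;; i1) ;; q1 = f1" "(f1 ;; i1) ;; q2 = star C A X2"
    using i q e f X by (auto simp: cmp_assoc cmp_idr cmp_star_right intro: cmp_hom)
  have f2q: "f2 ;; i2 \<in> hom C A S" "(f2 ;; i2) ;; q2 = f2" "(f2 ;; i2) ;; q1 = star C A X1"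
    using i q e f X by (auto simp: cmp_assoc cmp_idr cmp_star_right intro: cmp_hom)
  consider "p1 = 0" | "p1 = 1" "p2 = 0" | "0 < p1" "p1 < 1" using p by linarith
  then show ?thesis
  proof cases
    case 1
    have "scale C p2 (f2 ;; i2) ;; q1 = scale C p1 f1"
      using 1 p f f2q q X by (simp add: scale_cmp scale_star) (simp add: scale_def hom_iff)
    moreover have "scale C p2 (f2 ;; i2) ;; q2 = scale C p2 f2"
      using 1 p f2q q by (simp add: scale_cmp)
    ultimately show ?thesis using that scale_hom f2q p by (metis add_0 1)
  next
    case 2
    show ?thesis using that[of "f1 ;; i1"] 2 f1q f by (simp add: scale_def hom_iff)
  next
    case 3
    \<comment> \<open>In \<open>f1 ;; i1 +_{p1} (t . (f2 ;; i2))\<close> the second mass is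
      \<open>(1 - p1) * t\<close>, which has to be \<open>p2\<close>; \<open>t\<close> is at most 1
      precisely because \<open>p1 + p2\<close> is.\<close>
    define t where "t = p2 / (1 - p1)"
    have t: "0 \<le> t" "t \<le> 1" "(1 - p1) * t = p2" using 3 p by (auto simp: t_def field_simps)
    let ?g = "scale C t (f2 ;; i2)"
    have g: "?g \<in> hom C A S" using t f2q by (intro scale_hom)
    have "plus C p1 (f1 ;; i1) ?g ;; q1 = scale C p1 f1"
      using 3 f f1q f2q t g q X
      by (subst cmp_plus_left[OF _ _ _ q(1)]) (auto simp: scale_cmp scale_star, simp add: scale_def hom_iff)
    moreover have "plus C p1 (f1 ;; i1) ?g ;; q2 = scale C p2 f2"
      using 3 f f1q f2q t g q X
      by (subst cmp_plus_left[OF _ _ _ q(2)]) (auto simp: scale_cmp plus_star_scale)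
    ultimately show ?thesis using that plus_hom f1q g 3 by blast
  qed
qed

end

section \<open>Functors preserving coproducts\<close>

context cat_functor
begin

text \<open>Whether a coproduct of \<open>X1\<close> and \<open>X2\<close> is preserved does not
  depend on the cocone, as any two differ by an isomorphism. Hence \<open>cb_functorI\<close> may
  test the chosen sums only, although \<open>cb_functor\<close> speaks of all coproduct
  cocones.\<close>

lemma far_coproduct_iso:
  assumes c: "is_coproduct C X1 X2 S i1 i2" and d: "is_coproduct C X1 X2 S' j1 j2"
    and Fc: "is_coproduct D (fob F X1) (fob F X2) (fob F S) (far F i1) (far F i2)"
  shows "is_coproduct D (fob F X1) (fob F X2) (fob F S') (far F j1) (far F j2)"
proof -
  obtain u v where u: "u \<in> hom C S S'" "v \<in> hom C S' S" "i1 ;;\<^bsub>C\<^esub> u = j1" "i2 ;;\<^bsub>C\<^esub> u = j2"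
    "j1 ;;\<^bsub>C\<^esub> v = i1" "j2 ;;\<^bsub>C\<^esub> v = i2" "u ;;\<^bsub>C\<^esub> v = idn C S" "v ;;\<^bsub>C\<^esub> u = idn C S'"
    using S.coproduct_iso[OF c d] by metis
  note C = c[unfolded is_coproduct_def] d[unfolded is_coproduct_def] Fc[unfolded is_coproduct_def]
  have ob: "fob F A \<in> obj D" if "A \<in> obj C" for A using fob_ext that by auto
  have i: "i1 \<in> hom C X1 S" "i2 \<in> hom C X2 S" "j1 \<in> hom C X1 S'" "j2 \<in> hom C X2 S'" using C by auto
  note h = far_hom[OF i(1)] far_hom[OF i(2)] far_hom[OF i(3)] far_hom[OF i(4)]
    far_hom[OF u(1)] far_hom[OF u(2)]
  have e: "far F i1 ;;\<^bsub>D\<^esub> far F u = far F j1" "far F i2 ;;\<^bsub>D\<^esub> far F u = far F j2"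
    "far F j1 ;;\<^bsub>D\<^esub> far F v = far F i1" "far F j2 ;;\<^bsub>D\<^esub> far F v = far F i2"
    using i u by (simp_all flip: far_cmp)
  have vu: "far F v ;;\<^bsub>D\<^esub> far F u = idn D (fob F S')"
    using u C by (simp flip: far_cmp add: far_idn)
  show ?thesis unfolding is_coproduct_def
  proof (intro conjI ballI)
    show "fob F X1 \<in> obj D" "fob F X2 \<in> obj D" "fob F S' \<in> obj D" using C ob by auto
    show "far F j1 \<in> hom D (fob F X1) (fob F S')" "far F j2 \<in> hom D (fob F X2) (fob F S')"
      using h by auto
    fix A f1 f2 assume f: "A \<in> obj D" "f1 \<in> hom D (fob F X1) A" "f2 \<in> hom D (fob F X2) A"
    obtain k where k: "k \<in> hom D (fob F S) A" "far F i1 ;;\<^bsub>D\<^esub> k = f1" "far F i2 ;;\<^bsub>D\<^esub> k = f2"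
      using T.coproduct_ex[OF Fc f(2,3)] by metis
    show "\<exists>!h. h \<in> hom D (fob F S') A \<and> far F j1 ;;\<^bsub>D\<^esub> h = f1 \<and> far F j2 ;;\<^bsub>D\<^esub> h = f2"
    proof (intro ex1I[of _ "far F v ;;\<^bsub>D\<^esub> k"] conjI)
      show "far F v ;;\<^bsub>D\<^esub> k \<in> hom D (fob F S') A" using h k T.cmp_hom by blast
      show "far F j1 ;;\<^bsub>D\<^esub> (far F v ;;\<^bsub>D\<^esub> k) = f1"
        using T.cmp_assoc[OF h(3) h(6) k(1)] e k by simp
      show "far F j2 ;;\<^bsub>D\<^esub> (far F v ;;\<^bsub>D\<^esub> k) = f2"
        using T.cmp_assoc[OF h(4) h(6) k(1)] e k by simp
      fix l assume l: "l \<in> hom D (fob F S') A \<and> far F j1 ;;\<^bsub>D\<^esub> l = f1 \<and> far F j2 ;;\<^bsub>D\<^esub> l = f2"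
      then have l1: "l \<in> hom D (fob F S') A" by simp
      have "far F u ;;\<^bsub>D\<^esub> l = k"
        using l k e T.cmp_assoc[OF h(1) h(5) l1] T.cmp_assoc[OF h(2) h(5) l1] T.cmp_hom[OF h(5) l1]
        by (intro T.coproduct_ext[OF Fc _ k(1)]) auto
      then show "l = far F v ;;\<^bsub>D\<^esub> k"
        using T.cmp_assoc[OF h(6) h(5) l1] vu T.cmp_idl[OF l1] by simp
    qed
  qed
qed

lemma fob_initial_iso:
  assumes z: "is_initial C Z" and z': "is_initial C Z'" and F: "is_initial D (fob F Z)"
  shows "is_initial D (fob F Z')"
proof -
  have Z: "Z \<in> obj C" "Z' \<in> obj C" using z z' unfolding is_initial_def by auto
  obtain u v where u: "u \<in> hom C Z Z'" "v \<in> hom C Z' Z"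
    using z z' Z unfolding is_initial_def by metis
  have "v ;;\<^bsub>C\<^esub> u = idn C Z'"
    using S.initial_ext[OF z', of "v ;;\<^bsub>C\<^esub> u" Z' "idn C Z'"] u Z S.cmp_hom S.idn_hom by blast
  then have vu: "far F v ;;\<^bsub>D\<^esub> far F u = idn D (fob F Z')"
    using u Z by (simp flip: far_cmp add: far_idn)
  note h = far_hom[OF u(1)] far_hom[OF u(2)]
  show ?thesis unfolding is_initial_def
  proof (intro conjI ballI)
    show "fob F Z' \<in> obj D" using fob_ext Z by auto
    fix A assume A: "A \<in> obj D"
    obtain k where k: "k \<in> hom D (fob F Z) A" using F A unfolding is_initial_def by blast
    show "\<exists>!f. f \<in> hom D (fob F Z') A"
    proof (intro ex1I[of _ "far F v ;;\<^bsub>D\<^esub> k"])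
      show "far F v ;;\<^bsub>D\<^esub> k \<in> hom D (fob F Z') A" using h k T.cmp_hom by blast
      fix l assume l: "l \<in> hom D (fob F Z') A"
      have "far F u ;;\<^bsub>D\<^esub> l = k" using T.initial_ext[OF F _ k] T.cmp_hom[OF h(1) l] by blast
      then show "l = far F v ;;\<^bsub>D\<^esub> k"
        using T.cmp_assoc[OF h(2,1) l] vu T.cmp_idl[OF l] by simp
    qed
  qed
qed

end

lemma cb_functorI:
  assumes "cat_functor C D F" "convex_biproduct_category C" "convex_biproduct_category D"
    and "\<And>p f g A B. p \<in> {0<..<1} \<Longrightarrow> f \<in> hom C A B \<Longrightarrow> g \<in> hom C A B \<Longrightarrow>
      far F (plus C p f g) = plus D p (far F f) (far F g)"
    and "\<And>A B. A \<in> obj C \<Longrightarrow> B \<in> obj C \<Longrightarrow> far F (star C A B) = star D (fob F A) (fob F B)"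
    and z: "is_initial D (fob F (zob C))"
    and c: "\<And>X1 X2. X1 \<in> obj C \<Longrightarrow> X2 \<in> obj C \<Longrightarrow> is_coproduct D (fob F X1) (fob F X2)
      (fob F (osum C X1 X2)) (far F (inj1 C X1 X2)) (far F (inj2 C X1 X2))"
  shows "cb_functor C D F"
proof -
  interpret cat_functor C D F by fact
  interpret C: convex_biproduct_category C by fact
  interpret D: convex_biproduct_category D by fact
  show ?thesis
  proof
    show "is_initial D (fob F Z)" if "is_initial C Z" for Z
      using fob_initial_iso[OF C.zob_initial that z] .
    show "is_coproduct D (fob F X1) (fob F X2) (fob F S) (far F i1) (far F i2)"
      if h: "is_coproduct C X1 X2 S i1 i2" for X1 X2 S i1 i2
    proof -
      have X: "X1 \<in> obj C" "X2 \<in> obj C" using h unfolding is_coproduct_def by auto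
      show ?thesis using far_coproduct_iso[OF C.osum_coproduct[OF X] h c[OF X]] .
    qed
  qed (use assms in auto)
qed

lemma (in cb_functor) far_ncop:
  "set Xs \<subseteq> obj C \<Longrightarrow> is_ncop D (map (fob F) Xs) (fob F (nob C Xs)) (\<lambda>i. far F (nin C Xs i))"
proof (induction Xs)
  case Nil
  then show ?case by (simp add: ncop_Nil fob_initial S.zob_initial)
next
  case (Cons X Xs)
  have ob: "fob F A \<in> obj D" if "A \<in> obj C" for A using fob_ext that by auto
  show ?case
  proof (cases "Xs = []")
    case True
    then show ?thesis using Cons ncop_cong[OF T.ncop_single[of "fob F X"]] ob by (simp add: far_idn)
  next
    case False
    have n: "is_ncop C Xs (nob C Xs) (nin C Xs)" using Cons S.ncop_nob by simp
    have c: "is_coproduct C X (nob C Xs) (osum C X (nob C Xs)) (inj1 C X (nob C Xs)) (inj2 C X (nob C Xs))"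
      using Cons ncop_obj[OF n] by (intro S.osum_coproduct) auto
    have "is_ncop D (map (fob F) (X # Xs)) (fob F (osum C X (nob C Xs)))
        (\<lambda>i. case i of 0 \<Rightarrow> far F (inj1 C X (nob C Xs))
          | Suc k \<Rightarrow> far F (nin C Xs k) ;;\<^bsub>D\<^esub> far F (inj2 C X (nob C Xs)))"
      using T.ncop_Cons[OF far_coproduct[OF c]] Cons by simp
    moreover have "far F (nin C Xs k ;;\<^bsub>C\<^esub> inj2 C X (nob C Xs)) =
        far F (nin C Xs k) ;;\<^bsub>D\<^esub> far F (inj2 C X (nob C Xs))" if "k < length Xs" for k
      using ncop_in[OF n that] c unfolding is_coproduct_def by (blast intro: far_cmp)
    ultimately show ?thesis using False by (auto elim!: ncop_cong split: nat.split)
  qed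
qed

section \<open>The tape category\<close>

text \<open>The typing rule for \<open>Par\<close> speaks of words that are literally appends; with
  equations as premises a word such as \<open>U # P\<close> can be split where needed.\<close>

lemma typed_par:
  "tape_typed C P Q s \<Longrightarrow> tape_typed C P' Q' t \<Longrightarrow> R = P @ P' \<Longrightarrow> R' = Q @ Q' \<Longrightarrow>
    tape_typed C R R' (s \<oplus> t)"
  using tape_typed.intros(10) by metis

lemma typed_words:
  "tape_typed C P Q t \<Longrightarrow> P \<in> words C \<and> Q \<in> words C"
  by (induction rule: tape_typed.induct) auto

lemma typed_idw: "P \<in> words C \<Longrightarrow> tape_typed C P P (idw P)"
  by (induction P) (auto intro!: tape_typed.intros(7) typed_par[OF tape_typed.intros(6)])

lemma typed_swap1: "U \<in> obj C \<Longrightarrow> Q \<in> words C \<Longrightarrow> tape_typed C (U # Q) (Q @ [U]) (swap1 U Q)"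
  by (induction Q)
    (auto intro!: tape_typed.intros(6) tape_typed.intros(9) typed_idw
      typed_par[OF tape_typed.intros(5)] typed_par[OF tape_typed.intros(6)])

lemma typed_swapw: "P \<in> words C \<Longrightarrow> Q \<in> words C \<Longrightarrow> tape_typed C (P @ Q) (Q @ P) (swapw P Q)"
proof (induction P)
  case (Cons U P)
  then have "tape_typed C (U # P @ Q) (U # Q @ P) (Idt U \<oplus> swapw P Q)"
    by (intro typed_par[OF tape_typed.intros(6)]) auto
  moreover have "tape_typed C (U # Q @ P) (Q @ U # P) (swap1 U Q \<oplus> idw P)"
    using Cons by (intro typed_par[OF typed_swap1 typed_idw]) auto
  ultimately show ?case by (auto intro: tape_typed.intros(9))
qed (auto intro: typed_idw)

lemma typed_discardw: "P \<in> words C \<Longrightarrow> tape_typed C P [] (discardw P)"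
  by (induction P) (auto intro!: tape_typed.intros(7) typed_par[OF tape_typed.intros(2)])

lemma typed_initw: "P \<in> words C \<Longrightarrow> tape_typed C [] P (initw P)"
  by (induction P) (auto intro!: tape_typed.intros(7) typed_par[OF tape_typed.intros(4)])

lemma typed_splitw: "P \<in> words C \<Longrightarrow> p \<in> {0<..<1} \<Longrightarrow> tape_typed C P (P @ P) (splitw p P)"
proof (induction P)
  case (Cons U P)
  then have U: "U \<in> obj C" and P: "P \<in> words C" and IH: "tape_typed C P (P @ P) (splitw p P)" by auto
  have 1: "tape_typed C (U # P) ([U, U] @ P @ P) (Split p U \<oplus> splitw p P)"
    using U IH Cons by (intro typed_par[OF tape_typed.intros(1)]) auto
  have "tape_typed C ([U, U] @ P @ P) (U # P @ U # P) (Idt U \<oplus> (swapw [U] P \<oplus> idw P))"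
    using U P typed_swapw[of "[U]" C P] typed_idw[of P C]
    by (intro typed_par[OF tape_typed.intros(6)] typed_par[of C "[U] @ P" "P @ [U]" _ P P]) auto
  then show ?case using tape_typed.intros(9)[OF 1] by simp
qed (auto intro: tape_typed.intros)

lemma typed_mergew: "P \<in> words C \<Longrightarrow> tape_typed C (P @ P) P (mergew P)"
proof (induction P)
  case (Cons U P)
  then have U: "U \<in> obj C" and P: "P \<in> words C" and IH: "tape_typed C (P @ P) P (mergew P)" by auto
  have 1: "tape_typed C ([U, U] @ P @ P) (U # P) (Merge U \<oplus> mergew P)"
    using U IH Cons by (intro typed_par[OF tape_typed.intros(3)]) auto
  have "tape_typed C (U # P @ U # P) ([U, U] @ P @ P) (Idt U \<oplus> (swapw P [U] \<oplus> idw P))"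
    using U P typed_swapw[of P C "[U]"] typed_idw[of P C]
    by (intro typed_par[OF tape_typed.intros(6)] typed_par[of C "P @ [U]" "[U] @ P" _ P P]) auto
  then show ?case using tape_typed.intros(9)[OF _ 1] by simp
qed (auto intro: tape_typed.intros)

lemmas typed_words_intros = typed_idw typed_swapw typed_discardw typed_initw typed_splitw typed_mergew

lemma assoc_params:
  fixes p q :: real
  assumes "p \<in> {0<..<1}" "q \<in> {0<..<1}"
  shows "p * q \<in> {0<..<1}" "p * (1 - q) / (1 - p * q) \<in> {0<..<1}"
proof -
  have pq: "p * q < 1 * 1" using assms by (intro mult_strict_mono) auto
  then have "0 < p * q" "p * q < 1" "0 < p * (1 - q) / (1 - p * q)" using assms by auto
  moreover have "p * (1 - q) / (1 - p * q) < 1" using pq assms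
    by (subst divide_less_eq_1_pos) (auto simp: algebra_simps)
  ultimately show "p * q \<in> {0<..<1}" "p * (1 - q) / (1 - p * q) \<in> {0<..<1}" by auto
qed

lemma (in category) tape_eq_typed:
  "tape_eq C P Q s t \<Longrightarrow> tape_typed C P Q s \<and> tape_typed C P Q t"
proof (induction rule: tape_eq.induct)
  case (swap_natural P Q s P' Q' t)
  then show ?case using typed_words[of C P Q s] typed_words[of C P' Q' t]
    by (auto intro!: tape_typed.intros(9,10) typed_words_intros)
next
  case (hexagon P Q R)
  have 1: "tape_typed C ((P @ Q) @ R) (R @ P @ Q) (swapw (P @ Q) R)"
    using hexagon typed_swapw[of "P @ Q" C R] by simp
  have 2: "tape_typed C (P @ Q @ R) (P @ R @ Q) (idw P \<oplus> swapw Q R)"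
    using hexagon by (intro tape_typed.intros(10) typed_words_intros)
  have 3: "tape_typed C (P @ R @ Q) (R @ P @ Q) (swapw P R \<oplus> idw Q)"
    using hexagon typed_par[OF typed_swapw[of P C R] typed_idw[of Q C]] by simp
  show ?case using 1 tape_typed.intros(9)[OF 2 3] by simp
next
  case (merge_assoc P)
  note P = merge_assoc
  have "tape_typed C (P @ P @ P) (P @ P) (mergew P \<oplus> idw P)"
    using P by (intro typed_par[OF typed_mergew typed_idw]) auto
  moreover have "tape_typed C (P @ P @ P) (P @ P) (idw P \<oplus> mergew P)"
    using P by (intro typed_par[OF typed_idw typed_mergew]) auto
  ultimately show ?case using P typed_mergew tape_typed.intros(9) by metis
next
  case (merge_unit P)
  then show ?case using typed_par[OF typed_initw[of P C] typed_idw[of P C]]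
      typed_mergew typed_idw tape_typed.intros(9) by (metis append_Nil)
next
  case (split_assoc P p q)
  note P = split_assoc(1)
  define t where "t = p * (1 - q) / (1 - p * q)"
  have t: "p * q \<in> {0<..<1}" "t \<in> {0<..<1}"
    using assoc_params[OF split_assoc(2,3)] by (simp_all add: t_def)
  have "tape_typed C (P @ P) (P @ P @ P) (splitw q P \<oplus> idw P)"
    using split_assoc by (intro typed_par[OF typed_splitw typed_idw]) auto
  moreover have "tape_typed C (P @ P) (P @ P @ P) (idw P \<oplus> splitw t P)"
    using P t by (intro typed_par[OF typed_idw typed_splitw]) auto
  ultimately show ?case using split_assoc typed_splitw t tape_typed.intros(9)
    unfolding t_def by metis
next
  case (swap_gen U V)
  then show ?case using typed_swapw[of "[U]" C "[V]"] by (auto intro: tape_typed.intros)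
next
  case (par_idl P Q t)
  then show ?case using typed_par[OF tape_typed.intros(7)] by fastforce
next
  case (par_idr P Q t)
  then show ?case using typed_par[OF _ tape_typed.intros(7)] by fastforce
next
  case (par_assoc P Q s P' Q' t P'' Q'' u)
  then have "tape_typed C ((P @ P') @ P'') ((Q @ Q') @ Q'') ((s \<oplus> t) \<oplus> u)"
    by (intro tape_typed.intros)
  then show ?case using par_assoc by (auto intro!: tape_typed.intros(10))
next
  case (init_natural P Q f)
  then show ?case using typed_words typed_initw tape_typed.intros(9) by metis
next
  case (discard_natural P Q f)
  then show ?case using typed_words typed_discardw tape_typed.intros(9) by metis
next
  case (merge_natural P Q f)
  then show ?case using typed_words typed_mergew tape_typed.intros(9,10) by metis
next
  case (split_natural P Q f p)
  then show ?case using typed_words typed_splitw tape_typed.intros(9,10) by metis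
next
  case (merge_comm P)
  then show ?case using typed_swapw typed_mergew tape_typed.intros(9) by metis
next
  case (split_swap P p)
  moreover from this have "1 - p \<in> {0<..<1}" by auto
  ultimately show ?case using typed_swapw typed_splitw tape_typed.intros(9) by metis
next
  case (split_merge P p)
  then show ?case using typed_mergew typed_splitw typed_idw tape_typed.intros(9) by metis
next
  case (swap_inverse P Q)
  then show ?case using typed_swapw typed_idw[of "P @ Q" C] tape_typed.intros(9)
    by (metis append_in_lists_conv)
next
  case (par_id P Q)
  then show ?case using typed_idw[of "P @ Q" C] typed_idw[of P C] typed_idw[of Q C]
      tape_typed.intros(10) by (metis append_in_lists_conv)
next
  case (seq_idl P Q t)
  then show ?case using typed_words typed_idw tape_typed.intros(9) by metis
next
  case (seq_idr P Q t)
  then show ?case using typed_words typed_idw tape_typed.intros(9) by metis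
qed (auto intro: tape_typed.intros idn_hom cmp_hom)

section \<open>Arrows of the tape category\<close>

lemma tape_class_eq: "tape_eq C P Q s t \<Longrightarrow> tape_class C P Q s = tape_class C P Q t"
  unfolding tape_class_def using tape_eq.sym tape_eq.trans by fast

locale tape_theory = category C for C :: "('o, 'a, 'z) cat_scheme"
begin

abbreviation "T \<equiv> tape_cat C"
abbreviation "cls \<equiv> tape_class C"
abbreviation aseq (infixr "\<odot>" 65) where "f \<odot> g \<equiv> tape_seq C f g"
abbreviation apar (infixr "\<otimes>" 70) where "f \<otimes> g \<equiv> tape_par C f g"

text \<open>\<open>tape_seq\<close> unites the classes of all composites of representatives. By
  congruence these are one class, so any pair of representatives computes it.\<close>

lemma seq_cls:
  assumes "tape_typed C P Q s" "tape_typed C Q R t"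
  shows "cls P Q s \<odot> cls Q R t = cls P R (s \<Zsemi> t)"
proof -
  have "(\<Union>s'\<in>{s'. tape_eq C P Q s s'}. \<Union>t'\<in>{t'. tape_eq C Q R t t'}. {u. tape_eq C P R (s' \<Zsemi> t') u}) =
      {u. tape_eq C P R (s \<Zsemi> t) u}"
  proof (intro equalityI subsetI)
    fix u assume "u \<in> {u. tape_eq C P R (s \<Zsemi> t) u}"
    then show "u \<in> (\<Union>s'\<in>{s'. tape_eq C P Q s s'}. \<Union>t'\<in>{t'. tape_eq C Q R t t'}. {u. tape_eq C P R (s' \<Zsemi> t') u})"
      by (intro UN_I[of s] UN_I[of t] CollectI tape_eq.refl assms) simp
  next
    fix u assume "u \<in> (\<Union>s'\<in>{s'. tape_eq C P Q s s'}. \<Union>t'\<in>{t'. tape_eq C Q R t t'}. {u. tape_eq C P R (s' \<Zsemi> t') u})"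
    then show "u \<in> {u. tape_eq C P R (s \<Zsemi> t) u}"
      by (elim UN_E CollectE) (rule CollectI, rule tape_eq.trans[OF tape_eq.cong_seq])
  qed
  then show ?thesis by (simp add: tape_seq_def tape_class_def)
qed

lemma par_cls:
  assumes "tape_typed C P Q s" "tape_typed C P' Q' t"
  shows "cls P Q s \<otimes> cls P' Q' t = cls (P @ P') (Q @ Q') (s \<oplus> t)"
proof -
  have "(\<Union>s'\<in>{s'. tape_eq C P Q s s'}. \<Union>t'\<in>{t'. tape_eq C P' Q' t t'}.
        {u. tape_eq C (P @ P') (Q @ Q') (s' \<oplus> t') u}) = {u. tape_eq C (P @ P') (Q @ Q') (s \<oplus> t) u}"
  proof (intro equalityI subsetI)
    fix u assume "u \<in> {u. tape_eq C (P @ P') (Q @ Q') (s \<oplus> t) u}"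
    then show "u \<in> (\<Union>s'\<in>{s'. tape_eq C P Q s s'}. \<Union>t'\<in>{t'. tape_eq C P' Q' t t'}.
        {u. tape_eq C (P @ P') (Q @ Q') (s' \<oplus> t') u})"
      by (intro UN_I[of s] UN_I[of t] CollectI tape_eq.refl assms) simp
  next
    fix u assume "u \<in> (\<Union>s'\<in>{s'. tape_eq C P Q s s'}. \<Union>t'\<in>{t'. tape_eq C P' Q' t t'}.
        {u. tape_eq C (P @ P') (Q @ Q') (s' \<oplus> t') u})"
    then show "u \<in> {u. tape_eq C (P @ P') (Q @ Q') (s \<oplus> t) u}"
      by (elim UN_E CollectE) (rule CollectI, rule tape_eq.trans[OF tape_eq.cong_par])
  qed
  then show ?thesis by (simp add: tape_par_def tape_class_def)
qed

section \<open>Equational calculus of tape arrows\<close>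

text \<open>With separate names for source, target and arrow set, typing conditions become
  membership in \<open>A\<close> and equations between words, which rewriting can discharge.\<close>

definition dm :: "('o, 'a) tape_arr \<Rightarrow> 'o list" where "dm f = fst f"
definition cd :: "('o, 'a) tape_arr \<Rightarrow> 'o list" where "cd f = snd (snd f)"
definition A :: "('o, 'a) tape_arr set" where "A = {cls P Q t | P Q t. tape_typed C P Q t}"
definition aI where "aI P = cls P P (idw P)"
definition aS where "aS P Q = cls (P @ Q) (Q @ P) (swapw P Q)"
definition aD where "aD p P = cls P (P @ P) (splitw p P)"
definition aM where "aM P = cls (P @ P) P (mergew P)"
definition aE where "aE P = cls P [] (discardw P)"
definition aN where "aN P = cls [] P (initw P)"

lemma hom_T: "f \<in> hom T P Q \<longleftrightarrow> f \<in> A \<and> dm f = P \<and> cd f = Q"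
  by (simp add: hom_def tape_cat_def dm_def cd_def A_def)

lemma T_simps [simp]:
  "obj T = words C" "cmp T = tape_seq C" "idn T = aI" "zob T = []" "osum T P Q = P @ Q"
  "plus T = tape_plus C"
  by (simp_all add: tape_cat_def aI_def fun_eq_iff)

lemma dmcd_cls [simp]: "dm (cls P Q t) = P" "cd (cls P Q t) = Q"
  by (simp_all add: dm_def cd_def tape_class_def)

lemma cls_A [intro]: "tape_typed C P Q t \<Longrightarrow> cls P Q t \<in> A"
  unfolding A_def by blast

lemma A_cls: "f \<in> A \<Longrightarrow> \<exists>t. tape_typed C (dm f) (cd f) t \<and> f = cls (dm f) (cd f) t"
  unfolding A_def by auto

lemma hom_cls: "f \<in> hom T P Q \<longleftrightarrow> (\<exists>t. tape_typed C P Q t \<and> f = cls P Q t)"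
  unfolding hom_T using A_cls[of f] by auto

lemma A_words [simp]: "f \<in> A \<Longrightarrow> dm f \<in> words C" "f \<in> A \<Longrightarrow> cd f \<in> words C"
  using A_cls typed_words by blast+

lemma dmcd_ops [simp]: "dm (f \<odot> g) = dm f" "cd (f \<odot> g) = cd g"
  "dm (f \<otimes> g) = dm f @ dm g" "cd (f \<otimes> g) = cd f @ cd g"
  by (auto simp: dm_def cd_def tape_seq_def tape_par_def split: prod.splits)

lemma seq_A [simp]: "f \<in> A \<Longrightarrow> g \<in> A \<Longrightarrow> cd f = dm g \<Longrightarrow> f \<odot> g \<in> A"
  using A_cls[of f] A_cls[of g] by (metis cls_A seq_cls tape_typed.intros(9))

lemma par_A [simp]: "f \<in> A \<Longrightarrow> g \<in> A \<Longrightarrow> f \<otimes> g \<in> A"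
  using A_cls[of f] A_cls[of g] by (metis cls_A par_cls tape_typed.intros(10))

lemma dmcd_gens [simp]: "dm (aI P) = P" "cd (aI P) = P" "dm (aS P Q) = P @ Q" "cd (aS P Q) = Q @ P"
  "dm (aD p P) = P" "cd (aD p P) = P @ P" "dm (aM P) = P @ P" "cd (aM P) = P"
  "dm (aE P) = P" "cd (aE P) = []" "dm (aN P) = []" "cd (aN P) = P"
  by (simp_all add: aI_def aS_def aD_def aM_def aE_def aN_def)

lemma gens_A [simp]: "P \<in> words C \<Longrightarrow> aI P \<in> A" "P \<in> words C \<Longrightarrow> Q \<in> words C \<Longrightarrow> aS P Q \<in> A"
  "P \<in> words C \<Longrightarrow> p \<in> {0<..<1} \<Longrightarrow> aD p P \<in> A" "P \<in> words C \<Longrightarrow> aM P \<in> A"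
  "P \<in> words C \<Longrightarrow> aE P \<in> A" "P \<in> words C \<Longrightarrow> aN P \<in> A"
  by (auto simp: aI_def aS_def aD_def aM_def aE_def aN_def intro!: cls_A typed_words_intros)

lemma assoc: "f \<in> A \<Longrightarrow> g \<in> A \<Longrightarrow> h \<in> A \<Longrightarrow> cd f = dm g \<Longrightarrow> cd g = dm h \<Longrightarrow>
    (f \<odot> g) \<odot> h = f \<odot> (g \<odot> h)"
proof -
  assume "f \<in> A" "g \<in> A" "h \<in> A" "cd f = dm g" "cd g = dm h"
  then obtain P Q R S s t u where
    "tape_typed C P Q s" "f = cls P Q s" "tape_typed C Q R t" "g = cls Q R t"
    "tape_typed C R S u" "h = cls R S u"
    using A_cls[of f] A_cls[of g] A_cls[of h] by metis
  then show ?thesis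
    using tape_class_eq[OF tape_eq.seq_assoc[of C P Q s R t S u]]
    by (simp add: seq_cls tape_typed.intros(9)[of C P Q s R t] tape_typed.intros(9)[of C Q R t S u])
qed

lemma idl: "f \<in> A \<Longrightarrow> dm f = P \<Longrightarrow> aI P \<odot> f = f"
  using A_cls[of f] unfolding aI_def
  by (metis seq_cls tape_class_eq tape_eq.seq_idl typed_idw typed_words)

lemma idr: "f \<in> A \<Longrightarrow> cd f = P \<Longrightarrow> f \<odot> aI P = f"
  using A_cls[of f] unfolding aI_def
  by (metis seq_cls tape_class_eq tape_eq.seq_idr typed_idw typed_words)

lemma passoc: "f \<in> A \<Longrightarrow> g \<in> A \<Longrightarrow> h \<in> A \<Longrightarrow> (f \<otimes> g) \<otimes> h = f \<otimes> (g \<otimes> h)"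
proof -
  assume "f \<in> A" "g \<in> A" "h \<in> A"
  then obtain P Q s P' Q' t P'' Q'' u where
    "tape_typed C P Q s" "f = cls P Q s" "tape_typed C P' Q' t" "g = cls P' Q' t"
    "tape_typed C P'' Q'' u" "h = cls P'' Q'' u"
    unfolding A_def by blast
  then show ?thesis
    using tape_class_eq[OF tape_eq.par_assoc[of C P Q s P' Q' t P'' Q'' u]]
    by (simp add: par_cls tape_typed.intros(10))
qed

lemma aI_Nil: "aI [] = cls [] [] Idt0"
  by (simp add: aI_def)

lemma pidl: "f \<in> A \<Longrightarrow> aI [] \<otimes> f = f"
  using A_cls[of f] unfolding aI_Nil
  by (metis append_Nil par_cls tape_class_eq tape_eq.par_idl tape_typed.intros(7))

lemma pidr: "f \<in> A \<Longrightarrow> f \<otimes> aI [] = f"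
  using A_cls[of f] unfolding aI_Nil
  by (metis append_Nil2 par_cls tape_class_eq tape_eq.par_idr tape_typed.intros(7))

lemma ichg: "f \<in> A \<Longrightarrow> g \<in> A \<Longrightarrow> f' \<in> A \<Longrightarrow> g' \<in> A \<Longrightarrow> cd f = dm f' \<Longrightarrow> cd g = dm g' \<Longrightarrow>
    (f \<otimes> g) \<odot> (f' \<otimes> g') = (f \<odot> f') \<otimes> (g \<odot> g')"
proof -
  assume a: "f \<in> A" "g \<in> A" "f' \<in> A" "g' \<in> A" "cd f = dm f'" "cd g = dm g'"
  obtain P Q R s s' where f: "tape_typed C P Q s" "f = cls P Q s" "tape_typed C Q R s'" "f' = cls Q R s'"
    using a A_cls[of f] A_cls[of f'] by metis
  obtain P' Q' R' t t' where g: "tape_typed C P' Q' t" "g = cls P' Q' t" "tape_typed C Q' R' t'"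
    "g' = cls Q' R' t'"
    using a A_cls[of g] A_cls[of g'] by metis
  show ?thesis
    using tape_class_eq[OF tape_eq.interchange[OF f(1,3) g(1,3)]] f g
    by (simp add: par_cls seq_cls tape_typed.intros(9)[OF f(1,3)] tape_typed.intros(9)[OF g(1,3)]
      seq_cls[OF tape_typed.intros(10)[OF f(1) g(1)] tape_typed.intros(10)[OF f(3) g(3)]])
qed

lemma ichg_assoc: "f \<in> A \<Longrightarrow> g \<in> A \<Longrightarrow> f' \<in> A \<Longrightarrow> g' \<in> A \<Longrightarrow> cd f = dm f' \<Longrightarrow> cd g = dm g' \<Longrightarrow>
    k \<in> A \<Longrightarrow> dm k = cd f' @ cd g' \<Longrightarrow>
    (f \<otimes> g) \<odot> ((f' \<otimes> g') \<odot> k) = ((f \<odot> f') \<otimes> (g \<odot> g')) \<odot> k"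
  by (subst assoc[symmetric]) (simp_all add: ichg)

lemma par_id: "P \<in> words C \<Longrightarrow> Q \<in> words C \<Longrightarrow> aI P \<otimes> aI Q = aI (P @ Q)"
  unfolding aI_def
  by (rule HOL.trans[OF par_cls[OF typed_idw typed_idw] tape_class_eq[OF tape_eq.par_id]])

lemma S_inverse: "P \<in> words C \<Longrightarrow> Q \<in> words C \<Longrightarrow> aS P Q \<odot> aS Q P = aI (P @ Q)"
  unfolding aI_def aS_def by (metis seq_cls tape_class_eq tape_eq.swap_inverse typed_swapw)

lemma S_natural: "f \<in> A \<Longrightarrow> g \<in> A \<Longrightarrow> cd f = Q \<Longrightarrow> cd g = Q' \<Longrightarrow>
    (f \<otimes> g) \<odot> aS Q Q' = aS (dm f) (dm g) \<odot> (g \<otimes> f)"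
proof -
  assume a: "f \<in> A" "g \<in> A" "cd f = Q" "cd g = Q'"
  obtain s t where st: "tape_typed C (dm f) Q s" "f = cls (dm f) Q s"
    "tape_typed C (dm g) Q' t" "g = cls (dm g) Q' t"
    using a A_cls by metis
  then have w: "dm f \<in> words C" "dm g \<in> words C" "Q \<in> words C" "Q' \<in> words C"
    using typed_words[OF st(1)] typed_words[OF st(3)] by auto
  show ?thesis
    using tape_class_eq[OF tape_eq.swap_natural[OF st(1,3)]] w
      seq_cls[OF tape_typed.intros(10)[OF st(1,3)] typed_swapw[of Q C Q']]
      seq_cls[OF typed_swapw[of "dm f" C "dm g"] tape_typed.intros(10)[OF st(3,1)]]
      par_cls[OF st(1,3)] par_cls[OF st(3,1)] st(2,4)
    by (simp add: aS_def)
qed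

lemma S_Nil_left: "aS [] Q = aI Q"
  by (simp add: aS_def aI_def)

text \<open>By definition only \<open>swapw [] Q\<close> is an identity; with the empty word on the
  other side the inverse law is needed.\<close>

lemma S_Nil_right: "P \<in> words C \<Longrightarrow> aS P [] = aI P"
  using S_inverse[of P "[]"] idr[of "aS P []" P] by (simp add: S_Nil_left)

lemma M_assoc: "P \<in> words C \<Longrightarrow> (aM P \<otimes> aI P) \<odot> aM P = (aI P \<otimes> aM P) \<odot> aM P"
  unfolding aI_def aM_def using tape_class_eq[OF tape_eq.merge_assoc[of P C]]
    typed_par[OF typed_mergew[of P C] typed_idw[of P C] HOL.refl HOL.refl]
    typed_par[OF typed_idw[of P C] typed_mergew[of P C] HOL.refl HOL.refl]
  by (simp add: par_cls seq_cls typed_mergew typed_idw)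

lemma M_unit_left: "P \<in> words C \<Longrightarrow> (aN P \<otimes> aI P) \<odot> aM P = aI P"
  unfolding aI_def aM_def aN_def using tape_class_eq[OF tape_eq.merge_unit[of P C]]
    typed_par[OF typed_initw[of P C] typed_idw[of P C] HOL.refl HOL.refl]
  by (simp add: par_cls seq_cls typed_words_intros)

lemma M_comm: "P \<in> words C \<Longrightarrow> aS P P \<odot> aM P = aM P"
  unfolding aS_def aM_def using tape_class_eq[OF tape_eq.merge_comm[of P C]]
  by (simp add: seq_cls typed_words_intros)

lemma A_obtain:
  assumes "f \<in> A"
  obtains P Q t where "tape_typed C P Q t" "f = cls P Q t" "P \<in> words C" "Q \<in> words C"
  using assms typed_words unfolding A_def by blast

lemma N_natural:
  assumes "f \<in> A" "dm f = P"
  shows "aN P \<odot> f = aN (cd f)"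
proof -
  obtain P' Q' t where t: "tape_typed C P' Q' t" and f: "f = cls P' Q' t" and w: "P' \<in> words C" "Q' \<in> words C"
    using A_obtain[OF assms(1)] by blast
  have P: "P = P'" using assms(2) f by simp
  show ?thesis unfolding P using tape_class_eq[OF tape_eq.init_natural[OF t]] t f w
    by (simp add: aN_def seq_cls par_cls tape_typed.intros(10)[OF t t] typed_words_intros)
qed

lemma E_natural:
  assumes "f \<in> A" "cd f = Q"
  shows "f \<odot> aE Q = aE (dm f)"
proof -
  obtain P' Q' t where t: "tape_typed C P' Q' t" and f: "f = cls P' Q' t" and w: "P' \<in> words C" "Q' \<in> words C"
    using A_obtain[OF assms(1)] by blast
  have Q: "Q = Q'" using assms(2) f by simp
  show ?thesis unfolding Q using tape_class_eq[OF tape_eq.discard_natural[OF t]] t f w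
    by (simp add: aE_def seq_cls par_cls tape_typed.intros(10)[OF t t] typed_words_intros)
qed

lemma M_natural:
  assumes "f \<in> A" "dm f = P"
  shows "aM P \<odot> f = (f \<otimes> f) \<odot> aM (cd f)"
proof -
  obtain P' Q' t where t: "tape_typed C P' Q' t" and f: "f = cls P' Q' t" and w: "P' \<in> words C" "Q' \<in> words C"
    using A_obtain[OF assms(1)] by blast
  have P: "P = P'" using assms(2) f by simp
  show ?thesis unfolding P using tape_class_eq[OF tape_eq.merge_natural[OF t]] t f w
    by (simp add: aM_def seq_cls par_cls tape_typed.intros(10)[OF t t] typed_words_intros)
qed

lemma D_natural:
  assumes "f \<in> A" "cd f = Q" and p: "p \<in> {0<..<1}"
  shows "f \<odot> aD p Q = aD p (dm f) \<odot> (f \<otimes> f)"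
proof -
  obtain P' Q' t where t: "tape_typed C P' Q' t" and f: "f = cls P' Q' t" and w: "P' \<in> words C" "Q' \<in> words C"
    using A_obtain[OF assms(1)] by blast
  have Q: "Q = Q'" using assms(2) f by simp
  show ?thesis unfolding Q using tape_class_eq[OF tape_eq.split_natural[OF t p]] t f w p
    by (simp add: aD_def seq_cls par_cls tape_typed.intros(10)[OF t t] typed_words_intros del: greaterThanLessThan_iff)
qed

lemma D_merge: "P \<in> words C \<Longrightarrow> p \<in> {0<..<1} \<Longrightarrow> aD p P \<odot> aM P = aI P"
  unfolding aD_def aM_def aI_def using tape_class_eq[OF tape_eq.split_merge[of P C p]]
  by (simp add: seq_cls typed_words_intros)

lemma D_swap: "P \<in> words C \<Longrightarrow> p \<in> {0<..<1} \<Longrightarrow> aD p P \<odot> aS P P = aD (1 - p) P"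
  unfolding aD_def aS_def using tape_class_eq[OF tape_eq.split_swap[of P C p]]
  by (simp add: seq_cls typed_words_intros)

lemma D_assoc: 
  assumes "P \<in> words C" "p \<in> {0<..<1}" "q \<in> {0<..<1}"
  shows "aD p P \<odot> (aD q P \<otimes> aI P) = aD (p * q) P \<odot> (aI P \<otimes> aD (p * (1 - q) / (1 - p * q)) P)"
proof -
  define t where "t = p * (1 - q) / (1 - p * q)"
  have t: "p * q \<in> {0<..<1}" "t \<in> {0<..<1}"
    using assoc_params[OF assms(2,3)] by (simp_all add: t_def)
  have 1: "tape_typed C (P @ P) (P @ P @ P) (splitw q P \<oplus> idw P)"
    using assms by (intro typed_par[OF typed_splitw typed_idw]) auto
  have 2: "tape_typed C (P @ P) (P @ P @ P) (idw P \<oplus> splitw t P)"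
    using assms t by (intro typed_par[OF typed_idw typed_splitw]) auto
  show ?thesis
    using tape_class_eq[OF tape_eq.split_assoc[OF assms]] assms t 1 2
      seq_cls[OF typed_splitw[OF assms(1,2)] 1] seq_cls[OF typed_splitw[OF assms(1) t(1)] 2]
    unfolding t_def[symmetric] by (simp add: aD_def aI_def par_cls typed_words_intros)
qed

section \<open>The pca structure on hom-sets\<close>

lemma plus_eq: "f \<in> A \<Longrightarrow> g \<in> A \<Longrightarrow> dm f = dm g \<Longrightarrow> cd f = cd g \<Longrightarrow> p \<in> {0<..<1} \<Longrightarrow>
    tape_plus C p f g = aD p (dm f) \<odot> ((f \<otimes> g) \<odot> aM (cd f))"
  using assoc[of "aD p (dm f)" "f \<otimes> g" "aM (cd f)"]
  by (simp add: tape_plus_def Let_def flip: dm_def cd_def aD_def aM_def)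

lemma dmcd_plus [simp]: "dm (tape_plus C p f g) = dm f" "cd (tape_plus C p f g) = cd f"
  by (simp_all add: tape_plus_def Let_def) (simp_all add: dm_def cd_def tape_class_def)

lemma plus_A [simp]: "f \<in> A \<Longrightarrow> g \<in> A \<Longrightarrow> dm f = dm g \<Longrightarrow> cd f = cd g \<Longrightarrow> p \<in> {0<..<1} \<Longrightarrow>
    tape_plus C p f g \<in> A"
  by (subst plus_eq) simp_all

lemma star_eq: "P \<in> words C \<Longrightarrow> Q \<in> words C \<Longrightarrow> star T P Q = aE P \<odot> aN Q"
  by (simp add: tape_cat_def aE_def aN_def seq_cls typed_words_intros)

text \<open>By interchange each side is a threefold split, then \<open>f\<close>, \<open>g\<close>,
  \<open>h\<close> in parallel, then a threefold merge. The splits agree by the co-pca law and the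
  merges by associativity.\<close>

lemma plus_assoc:
  assumes f: "f \<in> A" "dm f = P" "cd f = Q" and g: "g \<in> A" "dm g = P" "cd g = Q"
    and h: "h \<in> A" "dm h = P" "cd h = Q" and p: "p \<in> {0<..<1}" and q: "q \<in> {0<..<1}"
  shows "tape_plus C p (tape_plus C q f g) h =
    tape_plus C (p * q) f (tape_plus C (p * (1 - q) / (1 - p * q)) g h)"
proof -
  define t where "t = p * (1 - q) / (1 - p * q)"
  have pq: "p * q \<in> {0<..<1}" "t \<in> {0<..<1}" using assoc_params[OF p q] by (simp_all add: t_def)
  have w: "P \<in> words C" "Q \<in> words C" using A_words[of f] f by simp_all
  note [simp del] = greaterThanLessThan_iff
  note [simp] = f g h p q pq w
  let ?K = "f \<otimes> (g \<otimes> h)"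
  have K: "?K = (f \<otimes> g) \<otimes> h" by (simp add: passoc)
  have 1: "(aD q P \<odot> ((f \<otimes> g) \<odot> aM Q)) \<otimes> h = (aD q P \<otimes> aI P) \<odot> (?K \<odot> (aM Q \<otimes> aI Q))"
    unfolding K by (simp add: ichg idl idr)
  have 2: "f \<otimes> (aD t P \<odot> ((g \<otimes> h) \<odot> aM Q)) = (aI P \<otimes> aD t P) \<odot> (?K \<odot> (aI Q \<otimes> aM Q))"
    by (simp add: ichg idl idr)
  have "tape_plus C p (tape_plus C q f g) h =
      (aD p P \<odot> (aD q P \<otimes> aI P)) \<odot> (?K \<odot> ((aM Q \<otimes> aI Q) \<odot> aM Q))"
    by (simp add: plus_eq 1 assoc)
  also have "\<dots> = (aD (p * q) P \<odot> (aI P \<otimes> aD t P)) \<odot> (?K \<odot> ((aI Q \<otimes> aM Q) \<odot> aM Q))"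
    by (simp add: D_assoc M_assoc t_def)
  also have "\<dots> = tape_plus C (p * q) f (tape_plus C t g h)"
    by (simp add: plus_eq 2 assoc)
  finally show ?thesis by (simp add: t_def)
qed

text \<open>A swap emitted by the split passes the two arrows by naturality and is absorbed by the
  merge.\<close>

lemma plus_comm:
  assumes f: "f \<in> A" "dm f = P" "cd f = Q" and g: "g \<in> A" "dm g = P" "cd g = Q" and p: "p \<in> {0<..<1}"
  shows "tape_plus C p f g = tape_plus C (1 - p) g f"
proof -
  have w: "P \<in> words C" "Q \<in> words C" using A_words[of f] f by simp_all
  have q: "1 - p \<in> {0<..<1}" using p by auto
  note [simp del] = greaterThanLessThan_iff
  note [simp] = f g p q w
  have "tape_plus C (1 - p) g f = (aD p P \<odot> aS P P) \<odot> ((g \<otimes> f) \<odot> aM Q)"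
    by (simp add: plus_eq D_swap)
  also have "\<dots> = aD p P \<odot> ((aS P P \<odot> (g \<otimes> f)) \<odot> aM Q)"
    by (simp add: assoc)
  also have "aS P P \<odot> (g \<otimes> f) = (f \<otimes> g) \<odot> aS Q Q"
    by (simp add: S_natural)
  also have "aD p P \<odot> (((f \<otimes> g) \<odot> aS Q Q) \<odot> aM Q) = tape_plus C p f g"
    by (simp add: plus_eq assoc M_comm)
  finally show ?thesis by simp
qed

text \<open>Naturality of the merge moves \<open>f\<close> behind it, and a split followed by a
  merge is the identity.\<close>

lemma plus_idem:
  assumes "f \<in> A" "p \<in> {0<..<1}"
  shows "tape_plus C p f f = f"
proof -
  note [simp del] = greaterThanLessThan_iff
  have "tape_plus C p f f = aD p (dm f) \<odot> (aM (dm f) \<odot> f)"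
    using assms by (simp add: plus_eq M_natural)
  also have "\<dots> = (aD p (dm f) \<odot> aM (dm f)) \<odot> f" using assms by (simp add: assoc)
  finally show ?thesis using assms by (simp add: D_merge idl)
qed

lemma pca_category_T: "pca_category T"
proof
  note [simp del] = greaterThanLessThan_iff
  show "src T f \<in> obj T" if "f \<in> arr T" for f
    using that hom_T[of f "src T f" "tgt T f"] A_words[of f] by (simp add: hom_iff)
  show "tgt T f \<in> obj T" if "f \<in> arr T" for f
    using that hom_T[of f "src T f" "tgt T f"] A_words[of f] by (simp add: hom_iff)
  show "pca (hom T P Q) (plus T) (star T P Q)" if "P \<in> obj T" "Q \<in> obj T" for P Q
    unfolding pca_def using that
    by (auto simp: hom_T star_eq plus_assoc intro: plus_comm plus_idem)
  fix P Q R S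
  show "idn T P \<in> hom T P P" if "P \<in> obj T" using that by (simp add: hom_T)
  show "cmp T f g \<in> hom T P R" if "f \<in> hom T P Q" "g \<in> hom T Q R" for f g
    using that by (simp add: hom_T)
  show "cmp T (idn T P) f = f" if "f \<in> hom T P Q" for f using that by (simp add: hom_T idl)
  show "cmp T f (idn T Q) = f" if "f \<in> hom T P Q" for f using that by (simp add: hom_T idr)
  show "cmp T (cmp T f g) h = cmp T f (cmp T g h)"
    if "f \<in> hom T P Q" "g \<in> hom T Q R" "h \<in> hom T R S" for f g h
    using that by (simp add: hom_T assoc)
  show "cmp T (plus T p f g) h = plus T p (cmp T f h) (cmp T g h)"
    if "p \<in> {0<..<1}" "f \<in> hom T P Q" "g \<in> hom T P Q" "h \<in> hom T Q R" for p f g h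
  proof -
    note [simp] = that[unfolded hom_T]
    \<comment> \<open>Naturality of the merge distributes composition over the sum on this side;
      naturality of the split does so on the other.\<close>
    have "aM Q \<odot> h = (h \<otimes> h) \<odot> aM R" by (simp add: M_natural)
    moreover have "(f \<odot> h) \<otimes> (g \<odot> h) = (f \<otimes> g) \<odot> (h \<otimes> h)" by (simp add: ichg)
    ultimately show ?thesis using A_words(2)[of f] A_words(2)[of h] A_words(1)[of f]
      by (simp add: plus_eq assoc del: A_words)
  qed
  show "cmp T h (plus T p f g) = plus T p (cmp T h f) (cmp T h g)"
    if "p \<in> {0<..<1}" "h \<in> hom T P Q" "f \<in> hom T Q R" "g \<in> hom T Q R" for p f g h
  proof -
    note [simp] = that[unfolded hom_T]
    have w: "P \<in> words C" "Q \<in> words C" "R \<in> words C"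
      using A_words[of h] A_words(2)[of f] by simp_all
    have "h \<odot> aD p Q = aD p P \<odot> (h \<otimes> h)" by (simp add: D_natural)
    moreover have "(h \<odot> f) \<otimes> (h \<odot> g) = (h \<otimes> h) \<odot> (f \<otimes> g)" by (simp add: ichg)
    moreover have "h \<odot> (aD p Q \<odot> ((f \<otimes> g) \<odot> aM R)) = (h \<odot> aD p Q) \<odot> ((f \<otimes> g) \<odot> aM R)"
      using w by (simp add: assoc)
    ultimately show ?thesis using w by (simp add: plus_eq assoc)
  qed
  show "cmp T (star T P Q) h = star T P R" if "P \<in> obj T" "h \<in> hom T Q R" for h
  proof -
    have "Q \<in> words C" "R \<in> words C" using A_words[of h] that by (metis hom_T)+
    then show ?thesis using that by (simp add: hom_T star_eq assoc N_natural)
  qed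
  show "cmp T h (star T Q R) = star T P R" if "R \<in> obj T" "h \<in> hom T P Q" for h
  proof -
    have w: "P \<in> words C" "Q \<in> words C" using A_words[of h] that by (metis hom_T)+
    have "h \<odot> aE Q = aE P" using that by (simp add: hom_T E_natural)
    then show ?thesis using that w by (simp add: hom_T star_eq flip: assoc)
  qed
qed

section \<open>Injections, projections and coproducts of words\<close>

lemma inj_eq: "P \<in> words C \<Longrightarrow> Q \<in> words C \<Longrightarrow> inj1 T P Q = aI P \<otimes> aN Q"
  "P \<in> words C \<Longrightarrow> Q \<in> words C \<Longrightarrow> inj2 T P Q = aN P \<otimes> aI Q"
  "P \<in> words C \<Longrightarrow> Q \<in> words C \<Longrightarrow> prj1 T P Q = aI P \<otimes> aE Q"
  "P \<in> words C \<Longrightarrow> Q \<in> words C \<Longrightarrow> prj2 T P Q = aE P \<otimes> aI Q"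
  by (simp_all add: tape_cat_def aE_def aN_def aI_def par_cls typed_words_intros)

lemma EN_Nil: "aE [] = aI []" "aN [] = aI []"
  by (simp_all add: aE_def aN_def aI_def)

text \<open>Since \<open>aN []\<close> is the identity, naturality makes every arrow out of the
  empty word equal to \<open>aN\<close> of its target.\<close>

lemma N_append: "P \<in> words C \<Longrightarrow> Q \<in> words C \<Longrightarrow> aN (P @ Q) = aN P \<otimes> aN Q"
  using N_natural[of "aN P \<otimes> aN Q" "[]"] idl[of "aN P \<otimes> aN Q" "[]"] by (simp add: EN_Nil)

text \<open>Only the left unit law is among the axioms; commutativity transports it.\<close>

lemma M_unit_right:
  assumes "P \<in> words C" shows "(aI P \<otimes> aN P) \<odot> aM P = aI P"
proof -
  have "(aI P \<otimes> aN P) \<odot> aM P = ((aI P \<otimes> aN P) \<odot> aS P P) \<odot> aM P"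
    using assms by (simp add: assoc M_comm)
  also have "(aI P \<otimes> aN P) \<odot> aS P P = aN P \<otimes> aI P"
    using assms by (simp add: S_natural S_Nil_right idl)
  finally show ?thesis using assms by (simp add: M_unit_left)
qed

text \<open>The identity on the word \<open>[U]\<close> is the tape
  \<open>Idt U \<oplus> Idt0\<close>, so the generator agrees with it only up to a unit law. The
  same gap between a generator and its version on one-letter words is closed in
  \<open>cls_Merge\<close>, \<open>cls_Split\<close> and \<open>cls_Swap\<close>.\<close>

lemma cls_Idt: "U \<in> obj C \<Longrightarrow> cls [U] [U] (Idt U) = aI [U]"
  unfolding aI_def using tape_class_eq[OF tape_eq.par_idr[of C "[U]" "[U]" "Idt U"]]
  by (simp add: tape_typed.intros)

lemma cls_Merge:
  assumes "U \<in> obj C" shows "cls [U, U] [U] (Merge U) = aM [U]"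
proof -
  have t: "tape_typed C [U, U] [U] (Merge U)" using assms by (rule tape_typed.intros)
  have i: "tape_typed C [U] [U] (Idt U)" using assms by (rule tape_typed.intros)
  have w: "[U] \<in> words C" using assms by simp
  have j: "tape_typed C [U] [U] (idw [U])" using typed_idw[OF w] .
  have "aM [U] = cls [U, U] [U, U] (Idt U \<oplus> (idw [U] \<oplus> Idt0)) \<odot> cls [U, U] [U] (Merge U \<oplus> Idt0)"
    unfolding aM_def using t i j
    by (subst seq_cls) (auto intro!: typed_par[OF i] typed_par[OF _ tape_typed.intros(7)] simp del: idw.simps,
      simp)
  also have "cls [U, U] [U] (Merge U \<oplus> Idt0) = cls [U, U] [U] (Merge U) \<otimes> aI []"
    using par_cls[OF t tape_typed.intros(7)] by (simp add: aI_Nil)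
  also have "cls [U, U] [U, U] (Idt U \<oplus> (idw [U] \<oplus> Idt0)) = aI [U] \<otimes> (aI [U] \<otimes> aI [])"
    using par_cls[OF i typed_par[OF j tape_typed.intros(7)]] par_cls[OF j tape_typed.intros(7)]
    by (simp add: cls_Idt[OF assms, symmetric] aI_Nil) (simp add: cls_Idt[OF assms] aI_def)
  finally show ?thesis using t w cls_A[OF t] by (simp add: pidr par_id idl)
qed

lemma M_Cons:
  assumes U: "U \<in> obj C" and P: "P \<in> words C"
  shows "aM (U # P) = (aI [U] \<otimes> (aS P [U] \<otimes> aI P)) \<odot> (aM [U] \<otimes> aM P)"
proof -
  have w: "[U] \<in> words C" using U by simp
  have i: "tape_typed C [U] [U] (Idt U)" using U by (rule tape_typed.intros)
  note s = typed_swapw[OF P w] and d = typed_idw[OF P]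
  have a: "tape_typed C (P @ [U] @ P) ([U] @ P @ P) (swapw P [U] \<oplus> idw P)"
    by (rule typed_par[OF s d]) simp_all
  have b: "tape_typed C (U # P @ U # P) ([U, U] @ P @ P) (Idt U \<oplus> (swapw P [U] \<oplus> idw P))"
    by (rule typed_par[OF i a]) simp_all
  have m: "tape_typed C [U, U] [U] (Merge U)" using U by (rule tape_typed.intros)
  have c: "tape_typed C ([U, U] @ P @ P) (U # P) (Merge U \<oplus> mergew P)"
    by (rule typed_par[OF m typed_mergew[OF P]]) simp_all
  have "aM (U # P) = cls (U # P @ U # P) ([U, U] @ P @ P) (Idt U \<oplus> (swapw P [U] \<oplus> idw P)) \<odot>
      cls ([U, U] @ P @ P) (U # P) (Merge U \<oplus> mergew P)"
    using seq_cls[OF b c] by (simp add: aM_def)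
  also have "cls ([U, U] @ P @ P) (U # P) (Merge U \<oplus> mergew P) = aM [U] \<otimes> aM P"
    using par_cls[OF m typed_mergew[OF P]] by (simp add: cls_Merge[OF U, symmetric]) (simp add: aM_def)
  also have "cls (U # P @ U # P) ([U, U] @ P @ P) (Idt U \<oplus> (swapw P [U] \<oplus> idw P)) =
      aI [U] \<otimes> (aS P [U] \<otimes> aI P)"
    using par_cls[OF i a] par_cls[OF s d]
    by (simp add: cls_Idt[OF U, symmetric]) (simp add: aS_def aI_def)
  finally show ?thesis .
qed

text \<open>The swap inside the merge of \<open>U # P\<close> acts here on two freshly created
  strands, after which the unit laws apply to \<open>[U]\<close> and \<open>P\<close> separately. A
  one-letter first block is the case that the recursion of \<open>mergew\<close> offers; the general
  case \<open>M_inj\<close> is recovered later from \<open>inj_ext\<close>.\<close>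

lemma M_inj_Cons:
  assumes U: "U \<in> obj C" and P: "P \<in> words C"
  shows "(inj1 T [U] P \<otimes> inj2 T [U] P) \<odot> aM (U # P) = aI (U # P)"
proof -
  have w: "[U] \<in> words C" using U by simp
  note [simp] = w P U
  have "inj1 T [U] P \<otimes> inj2 T [U] P = aI [U] \<otimes> ((aN P \<otimes> aN [U]) \<otimes> aI P)"
    by (simp add: inj_eq passoc)
  moreover have "(aN P \<otimes> aN [U]) \<odot> aS P [U] = aN [U] \<otimes> aN P"
    by (simp add: S_natural S_Nil_left) (simp add: idl)
  ultimately have "(inj1 T [U] P \<otimes> inj2 T [U] P) \<odot> (aI [U] \<otimes> (aS P [U] \<otimes> aI P)) =
      (aI [U] \<otimes> aN [U]) \<otimes> (aN P \<otimes> aI P)"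
    by (simp add: ichg idl) (simp add: passoc)
  then have "(inj1 T [U] P \<otimes> inj2 T [U] P) \<odot> aM (U # P) =
      ((aI [U] \<otimes> aN [U]) \<otimes> (aN P \<otimes> aI P)) \<odot> (aM [U] \<otimes> aM P)"
    unfolding M_Cons[OF U P] by (subst assoc[symmetric]) (simp_all add: inj_eq)
  also have "\<dots> = ((aI [U] \<otimes> aN [U]) \<odot> aM [U]) \<otimes> ((aN P \<otimes> aI P) \<odot> aM P)"
    by (rule ichg) simp_all
  finally show ?thesis by (simp add: M_unit_right M_unit_left par_id)
qed

lemma inj_hom:
  assumes "P \<in> words C" "Q \<in> words C"
  shows "inj1 T P Q \<in> hom T P (P @ Q)" "inj2 T P Q \<in> hom T Q (P @ Q)"
    "prj1 T P Q \<in> hom T (P @ Q) P" "prj2 T P Q \<in> hom T (P @ Q) Q"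
  using assms by (simp_all add: hom_T inj_eq)

lemma inj_copair:
  assumes f: "f \<in> A" "dm f = P" "cd f = R" and g: "g \<in> A" "dm g = Q" "cd g = R"
  shows "inj1 T P Q \<odot> ((f \<otimes> g) \<odot> aM R) = f" "inj2 T P Q \<odot> ((f \<otimes> g) \<odot> aM R) = g"
proof -
  have w: "P \<in> words C" "Q \<in> words C" "R \<in> words C" using A_words[of f] A_words[of g] f g by simp_all
  note [simp] = f g w
  have "inj1 T P Q \<odot> ((f \<otimes> g) \<odot> aM R) = (f \<otimes> aN R) \<odot> aM R"
    by (simp add: inj_eq ichg_assoc idl N_natural)
  also have "\<dots> = ((aI P \<otimes> aN P) \<odot> (f \<otimes> f)) \<odot> aM R" by (simp add: ichg idl N_natural)
  also have "\<dots> = (aI P \<otimes> aN P) \<odot> (aM P \<odot> f)" by (simp add: assoc M_natural)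
  also have "\<dots> = ((aI P \<otimes> aN P) \<odot> aM P) \<odot> f" by (simp add: assoc)
  finally show "inj1 T P Q \<odot> ((f \<otimes> g) \<odot> aM R) = f" by (simp add: M_unit_right idl)
  have "inj2 T P Q \<odot> ((f \<otimes> g) \<odot> aM R) = (aN R \<otimes> g) \<odot> aM R"
    by (simp add: inj_eq ichg_assoc idl N_natural)
  also have "\<dots> = ((aN Q \<otimes> aI Q) \<odot> (g \<otimes> g)) \<odot> aM R" by (simp add: ichg idl N_natural)
  also have "\<dots> = (aN Q \<otimes> aI Q) \<odot> (aM Q \<odot> g)" by (simp add: assoc M_natural)
  also have "\<dots> = ((aN Q \<otimes> aI Q) \<odot> aM Q) \<odot> g" by (simp add: assoc)
  finally show "inj2 T P Q \<odot> ((f \<otimes> g) \<odot> aM R) = g" by (simp add: M_unit_left idl)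
qed

text \<open>Insert the identity in the form of \<open>M_inj_Cons\<close> and move \<open>h\<close>
  through the merge by naturality.\<close>

lemma inj_ext_letter:
  assumes U: "U \<in> obj C" and P: "P \<in> words C" and h: "h \<in> A" "dm h = U # P"
  shows "h = ((inj1 T [U] P \<odot> h) \<otimes> (inj2 T [U] P \<odot> h)) \<odot> aM (cd h)"
proof -
  note [simp] = U P h and [simp] = inj_hom[of "[U]" P, unfolded hom_T, simplified]
  have "h = ((inj1 T [U] P \<otimes> inj2 T [U] P) \<odot> aM (U # P)) \<odot> h"
    by (simp add: M_inj_Cons idl)
  also have "\<dots> = (inj1 T [U] P \<otimes> inj2 T [U] P) \<odot> ((h \<otimes> h) \<odot> aM (cd h))"
    by (simp add: assoc M_natural)
  also have "\<dots> = ((inj1 T [U] P \<odot> h) \<otimes> (inj2 T [U] P \<odot> h)) \<odot> aM (cd h)"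
    by (simp add: ichg flip: assoc)
  finally show ?thesis .
qed

lemma inj_assoc:
  assumes "P \<in> words C" "Q \<in> words C" "R \<in> words C"
  shows "inj1 T P Q \<odot> inj1 T (P @ Q) R = inj1 T P (Q @ R)"
    and "inj2 T P Q \<odot> inj1 T (P @ Q) R = inj1 T Q R \<odot> inj2 T P (Q @ R)"
    and "inj2 T (P @ Q) R = inj2 T Q R \<odot> inj2 T P (Q @ R)"
proof -
  note [simp] = assms
  have a: "(f \<odot> (aI (P @ Q) \<otimes> aN R)) = f \<otimes> aN R" if "f \<in> A" "cd f = P @ Q" for f
    using that ichg[of f "aI []" "aI (P @ Q)" "aN R"] by (simp add: pidr idl idr)
  have b: "(f \<odot> (aN P \<otimes> aI (Q @ R))) = aN P \<otimes> f" if "f \<in> A" "cd f = Q @ R" for f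
    using that ichg[of "aI []" f "aN P" "aI (Q @ R)"] by (simp add: pidl idl idr)
  show "inj1 T P Q \<odot> inj1 T (P @ Q) R = inj1 T P (Q @ R)"
    by (simp add: inj_eq a passoc N_append)
  show "inj2 T P Q \<odot> inj1 T (P @ Q) R = inj1 T Q R \<odot> inj2 T P (Q @ R)"
    by (simp add: inj_eq a b passoc)
  show "inj2 T (P @ Q) R = inj2 T Q R \<odot> inj2 T P (Q @ R)"
    by (simp add: inj_eq b passoc N_append)
qed

lemma inj_Nil:
  assumes "P \<in> words C"
  shows "inj1 T P [] = aI P" "inj2 T [] P = aI P"
  using assms by (simp_all add: inj_eq EN_Nil pidl pidr)

text \<open>The first block is peeled letter by letter, because \<open>inj_ext_letter\<close>
  handles one letter on the left. Rebracketing of injections carries the hypotheses over to the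
  smaller block.\<close>

lemma inj_ext:
  assumes "P \<in> words C" "Q \<in> words C" and "h \<in> A" "dm h = P @ Q" "k \<in> A" "dm k = P @ Q" "cd h = cd k"
    and "inj1 T P Q \<odot> h = inj1 T P Q \<odot> k" "inj2 T P Q \<odot> h = inj2 T P Q \<odot> k"
  shows "h = k"
  using assms
proof (induction P arbitrary: h k)
  case Nil
  then show ?case by (simp add: inj_Nil idl)
next
  case (Cons U P)
  then have w: "U \<in> obj C" "P \<in> words C" "[U] \<in> words C" "U # P \<in> words C" by auto
  note [simp] = w assms(2) Cons.prems(2-6)
  note [simp] = inj_hom[of "[U]" P, unfolded hom_T, simplified] inj_hom[of "U # P" Q, unfolded hom_T, simplified]
    inj_hom[of P Q, unfolded hom_T, simplified] inj_hom[of "[U]" "P @ Q", unfolded hom_T, simplified]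
  have e: "inj1 T [U] (P @ Q) = inj1 T [U] P \<odot> inj1 T (U # P) Q"
    "inj1 T P Q \<odot> inj2 T [U] (P @ Q) = inj2 T [U] P \<odot> inj1 T (U # P) Q"
    "inj2 T P Q \<odot> inj2 T [U] (P @ Q) = inj2 T (U # P) Q"
    using inj_assoc[OF w(3,2) assms(2)] by simp_all
  have 1: "inj1 T [U] (P @ Q) \<odot> h = inj1 T [U] (P @ Q) \<odot> k"
    using Cons.prems(7) by (simp add: e(1) assoc)
  have 2: "inj2 T [U] (P @ Q) \<odot> h = inj2 T [U] (P @ Q) \<odot> k"
  proof (rule Cons.IH)
    have a: "inj1 T P Q \<odot> (inj2 T [U] (P @ Q) \<odot> l) = inj2 T [U] P \<odot> (inj1 T (U # P) Q \<odot> l)"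
      "inj2 T P Q \<odot> (inj2 T [U] (P @ Q) \<odot> l) = inj2 T (U # P) Q \<odot> l"
      if "l \<in> A" "dm l = (U # P) @ Q" for l
      using that e(2,3) by (simp_all flip: assoc)
    show "inj1 T P Q \<odot> (inj2 T [U] (P @ Q) \<odot> h) = inj1 T P Q \<odot> (inj2 T [U] (P @ Q) \<odot> k)"
      "inj2 T P Q \<odot> (inj2 T [U] (P @ Q) \<odot> h) = inj2 T P Q \<odot> (inj2 T [U] (P @ Q) \<odot> k)"
      using Cons.prems(7,8) by (simp_all add: a)
  qed simp_all
  show ?case
    using inj_ext_letter[of U "P @ Q" h] inj_ext_letter[of U "P @ Q" k] 1 2 by simp
qed

lemma coproduct_T:
  assumes "P \<in> words C" "Q \<in> words C"
  shows "is_coproduct T P Q (P @ Q) (inj1 T P Q) (inj2 T P Q)"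
  unfolding is_coproduct_def
proof (intro conjI ballI)
  note [simp] = assms inj_hom[OF assms]
  show "P \<in> obj T" "Q \<in> obj T" "P @ Q \<in> obj T"
    "inj1 T P Q \<in> hom T P (P @ Q)" "inj2 T P Q \<in> hom T Q (P @ Q)" by simp_all
  fix R f g assume R: "R \<in> obj T" and f: "f \<in> hom T P R" and g: "g \<in> hom T Q R"
  note f' = f[unfolded hom_T] and g' = g[unfolded hom_T]
  show "\<exists>!h. h \<in> hom T (P @ Q) R \<and> cmp T (inj1 T P Q) h = f \<and> cmp T (inj2 T P Q) h = g"
  proof (intro ex1I[of _ "(f \<otimes> g) \<odot> aM R"] conjI)
    show "(f \<otimes> g) \<odot> aM R \<in> hom T (P @ Q) R" using f' g' R by (simp add: hom_T)
    have e: "inj1 T P Q \<odot> ((f \<otimes> g) \<odot> aM R) = f" "inj2 T P Q \<odot> ((f \<otimes> g) \<odot> aM R) = g"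
      using inj_copair[of f P R g Q] f' g' by simp_all
    then show "cmp T (inj1 T P Q) ((f \<otimes> g) \<odot> aM R) = f" "cmp T (inj2 T P Q) ((f \<otimes> g) \<odot> aM R) = g"
      by simp_all
    show "h = (f \<otimes> g) \<odot> aM R"
      if h: "h \<in> hom T (P @ Q) R \<and> cmp T (inj1 T P Q) h = f \<and> cmp T (inj2 T P Q) h = g" for h
    proof (rule inj_ext[OF assms])
      show "h \<in> A" "dm h = P @ Q" "cd h = cd ((f \<otimes> g) \<odot> aM R)" using h by (simp_all add: hom_T)
      show "(f \<otimes> g) \<odot> aM R \<in> A" "dm ((f \<otimes> g) \<odot> aM R) = P @ Q" using f' g' R by simp_all
      show "inj1 T P Q \<odot> h = inj1 T P Q \<odot> ((f \<otimes> g) \<odot> aM R)"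
        "inj2 T P Q \<odot> h = inj2 T P Q \<odot> ((f \<otimes> g) \<odot> aM R)" using h unfolding e by simp_all
    qed
  qed
qed

lemma initial_T: "is_initial T []"
  unfolding is_initial_def
proof (intro conjI ballI)
  fix P assume P: "P \<in> obj T"
  show "\<exists>!f. f \<in> hom T [] P"
  proof (rule ex1I[of _ "aN P"])
    show "f = aN P" if "f \<in> hom T [] P" for f
      using that N_natural[of f "[]"] by (simp add: hom_T EN_Nil idl)
  qed (use P in \<open>simp add: hom_T\<close>)
qed simp

lemma terminal_T: "is_terminal T []"
  unfolding is_terminal_def
proof (intro conjI ballI)
  fix P assume P: "P \<in> obj T"
  show "\<exists>!f. f \<in> hom T P []"
  proof (rule ex1I[of _ "aE P"])
    show "f = aE P" if "f \<in> hom T P []" for f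
      using that E_natural[of f "[]"] by (simp add: hom_T EN_Nil idr)
  qed (use P in \<open>simp add: hom_T\<close>)
qed simp

sublocale TC: pca_coproduct_category T
proof -
  interpret pca_category T by (rule pca_category_T)
  show "pca_coproduct_category T"
    by unfold_locales (simp_all add: coproduct_T initial_T)
qed

lemma inj_prj:
  assumes "P \<in> words C" "Q \<in> words C"
  shows "inj1 T P Q \<odot> prj1 T P Q = aI P" "inj2 T P Q \<odot> prj2 T P Q = aI Q"
    "inj1 T P Q \<odot> prj2 T P Q = star T P Q" "inj2 T P Q \<odot> prj1 T P Q = star T Q P"
proof -
  note [simp] = assms
  have ne: "aN R \<odot> aE R = aI []" if "R \<in> words C" for R
    using that N_natural[of "aE R" R] by (simp add: EN_Nil)
  show "inj1 T P Q \<odot> prj1 T P Q = aI P" "inj2 T P Q \<odot> prj2 T P Q = aI Q"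
    by (simp_all add: inj_eq ichg ne idl pidl pidr)
  \<comment> \<open>The parallel and the sequential composite of \<open>aE P\<close> and
    \<open>aN Q\<close> coincide because the word between them is empty.\<close>
  have "(aE P \<otimes> aI []) \<odot> (aI [] \<otimes> aN Q) = aE P \<otimes> aN Q"
    by (subst ichg) (simp_all add: idl idr)
  then have "aE P \<otimes> aN Q = aE P \<odot> aN Q" by (simp add: pidl pidr)
  then show "inj1 T P Q \<odot> prj2 T P Q = star T P Q"
    by (simp add: inj_eq ichg star_eq idl idr)
  have "(aI [] \<otimes> aE Q) \<odot> (aN P \<otimes> aI []) = aN P \<otimes> aE Q"
    by (subst ichg) (simp_all add: idl idr)
  then have "aN P \<otimes> aE Q = aE Q \<odot> aN P" by (simp add: pidl pidr)
  then show "inj2 T P Q \<odot> prj1 T P Q = star T Q P"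
    by (simp add: inj_eq ichg star_eq idl idr)
qed

end

section \<open>Arrows out of a letter\<close>

text \<open>Strictness without projections, so that it applies to the tape category before its
  convex products are established as well as to a strict target.\<close>

locale strict_pca_coproduct_category = pca_coproduct_category C
  for C :: "('o, 'a, 'z) cbcat_scheme" (structure) +
  assumes zob_left: "A \<in> obj C \<Longrightarrow> osum C (zob C) A = A"
    and inj2_zob_left: "A \<in> obj C \<Longrightarrow> inj2 C (zob C) A = idn C A"
    and zob_right: "A \<in> obj C \<Longrightarrow> osum C A (zob C) = A"
    and inj1_zob_right: "A \<in> obj C \<Longrightarrow> inj1 C A (zob C) = idn C A"
    and osum_osum: "A \<in> obj C \<Longrightarrow> B \<in> obj C \<Longrightarrow> E \<in> obj C \<Longrightarrow>
      osum C (osum C A B) E = osum C A (osum C B E)"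
    and inj_osum1: "A \<in> obj C \<Longrightarrow> B \<in> obj C \<Longrightarrow> E \<in> obj C \<Longrightarrow>
      inj1 C A B ;; inj1 C (osum C A B) E = inj1 C A (osum C B E)"
    and inj_osum2: "A \<in> obj C \<Longrightarrow> B \<in> obj C \<Longrightarrow> E \<in> obj C \<Longrightarrow>
      inj2 C A B ;; inj1 C (osum C A B) E = inj1 C B E ;; inj2 C A (osum C B E)"
    and inj_osum3: "A \<in> obj C \<Longrightarrow> B \<in> obj C \<Longrightarrow> E \<in> obj C \<Longrightarrow>
      inj2 C (osum C A B) E = inj2 C B E ;; inj2 C A (osum C B E)"
begin

lemma nob_obj: "set Xs \<subseteq> obj C \<Longrightarrow> nob C Xs \<in> obj C"
  using ncop_obj[OF ncop_nob] .

lemma inj_hom':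
  assumes "A \<in> obj C" "B \<in> obj C"
  shows "inj1 C A B \<in> hom C A (osum C A B)" "inj2 C A B \<in> hom C B (osum C A B)" "osum C A B \<in> obj C"
  using osum_cop[OF assms] unfolding is_coproduct_def by auto

text \<open>With strict units a singleton is no exception, so \<open>nob\<close> and
  \<open>nin\<close> satisfy uniform recursion equations; these replace the defining ones with their
  case distinction.\<close>

lemma nob_Cons: "X \<in> obj C \<Longrightarrow> set Xs \<subseteq> obj C \<Longrightarrow> nob C (X # Xs) = osum C X (nob C Xs)"
  by (simp add: zob_right)

lemma nin_0: "X \<in> obj C \<Longrightarrow> set Xs \<subseteq> obj C \<Longrightarrow> nin C (X # Xs) 0 = inj1 C X (nob C Xs)"
  by (simp add: inj1_zob_right)

lemma nin_Suc: "k < length Xs \<Longrightarrow> nin C (X # Xs) (Suc k) = nin C Xs k ;; inj2 C X (nob C Xs)"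
  by auto

declare nob.simps(2) [simp del] nin.simps(2) [simp del]

lemma nob_append: "set Xs \<subseteq> obj C \<Longrightarrow> set Ys \<subseteq> obj C \<Longrightarrow>
    nob C (Xs @ Ys) = osum C (nob C Xs) (nob C Ys)"
  by (induction Xs) (simp_all add: zob_left nob_obj nob_Cons osum_osum)

lemma nin_hom: "set Xs \<subseteq> obj C \<Longrightarrow> i < length Xs \<Longrightarrow> nin C Xs i \<in> hom C (Xs ! i) (nob C Xs)"
  using ncop_in[OF ncop_nob] .

lemma nin_inj1:
  "set Xs \<subseteq> obj C \<Longrightarrow> set Ys \<subseteq> obj C \<Longrightarrow> i < length Xs \<Longrightarrow>
    nin C Xs i ;; inj1 C (nob C Xs) (nob C Ys) = nin C (Xs @ Ys) i"
proof (induction Xs arbitrary: i)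
  case (Cons X Xs)
  then have o: "X \<in> obj C" "nob C Xs \<in> obj C" "nob C Ys \<in> obj C" by (auto simp: nob_obj)
  show ?case
  proof (cases i)
    case 0
    then show ?thesis using Cons o by (simp add: nin_0 nob_Cons nob_append inj_osum1)
  next
    case (Suc k)
    then have k: "k < length Xs" using Cons by simp
    have n: "nin C Xs k \<in> hom C (Xs ! k) (nob C Xs)" using Cons k by (intro nin_hom) auto
    note h = inj_hom'[OF o(1,2)] inj_hom'[OF o(2,3)] 
    note h2 = inj_hom'[OF h(3) o(3)] inj_hom'[OF o(1) h(6)]
    have "nin C (X # Xs) i ;; inj1 C (nob C (X # Xs)) (nob C Ys) =
        nin C Xs k ;; (inj2 C X (nob C Xs) ;; inj1 C (osum C X (nob C Xs)) (nob C Ys))"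
      using Suc k Cons cmp_assoc[OF n h(2) h2(1)] by (simp add: nin_Suc nob_Cons)
    also have "\<dots> = (nin C Xs k ;; inj1 C (nob C Xs) (nob C Ys)) ;; inj2 C X (osum C (nob C Xs) (nob C Ys))"
      using cmp_assoc[OF n h(4) h2(5)] o by (simp add: inj_osum2)
    finally show ?thesis using Suc k Cons by (simp add: nin_Suc nob_append)
  qed
qed simp

lemma nin_inj2:
  "set Xs \<subseteq> obj C \<Longrightarrow> set Ys \<subseteq> obj C \<Longrightarrow> j < length Ys \<Longrightarrow>
    nin C Ys j ;; inj2 C (nob C Xs) (nob C Ys) = nin C (Xs @ Ys) (length Xs + j)"
proof (induction Xs)
  case Nil
  then show ?case using cmp_idr[OF nin_hom[of Ys j]] by (simp add: inj2_zob_left nob_obj)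
next
  case (Cons X Xs)
  then have o: "X \<in> obj C" "nob C Xs \<in> obj C" "nob C Ys \<in> obj C" by (auto simp: nob_obj)
  note h = inj_hom'[OF o(2,3)] 
  note h2 = inj_hom'[OF o(1) h(3)]
  have "nin C Ys j ;; inj2 C (nob C (X # Xs)) (nob C Ys) =
      (nin C Ys j ;; inj2 C (nob C Xs) (nob C Ys)) ;; inj2 C X (osum C (nob C Xs) (nob C Ys))"
    using cmp_assoc[OF nin_hom[of Ys j] h(2) h2(2)] Cons o by (simp add: nob_Cons inj_osum3)
  then show ?case using Cons by (simp add: nin_Suc nob_append)
qed

end

section \<open>Words as coproducts of their letters\<close>

context tape_theory
begin

sublocale TS: strict_pca_coproduct_category T
  by unfold_locales (simp_all add: inj_Nil inj_assoc)

abbreviation lt :: "'o list \<Rightarrow> 'o list list" where "lt \<equiv> map (\<lambda>U. [U])"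
definition tinj :: "'o list \<Rightarrow> nat \<Rightarrow> ('o, 'a) tape_arr" where "tinj P i = nin T (lt P) i"
definition box :: "'a \<Rightarrow> ('o, 'a) tape_arr" where "box c = cls [src C c] [tgt C c] (Box c)"

lemma lt_obj: "P \<in> words C \<Longrightarrow> set (lt P) \<subseteq> obj T"
  by (auto simp: in_lists_conv_set)

lemma nob_lt: "P \<in> words C \<Longrightarrow> nob T (lt P) = P"
proof (induction P)
  case (Cons U P)
  then show ?case using TS.nob_Cons[of "[U]" "lt P"] lt_obj[of P] by simp
qed simp

lemma ncop_T: "P \<in> words C \<Longrightarrow> is_ncop T (lt P) P (tinj P)"
  using TC.ncop_nob[OF lt_obj[of P]] by (simp add: nob_lt tinj_def[abs_def])

lemma tinj_hom: "P \<in> words C \<Longrightarrow> i < length P \<Longrightarrow> tinj P i \<in> hom T [P ! i] P"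
  using ncop_in[OF ncop_T, of P i] by simp

lemma tinj_A [simp]: "P \<in> words C \<Longrightarrow> i < length P \<Longrightarrow> tinj P i \<in> A"
  "P \<in> words C \<Longrightarrow> i < length P \<Longrightarrow> dm (tinj P i) = [P ! i]"
  "P \<in> words C \<Longrightarrow> i < length P \<Longrightarrow> cd (tinj P i) = P"
  using tinj_hom[of P i] by (simp_all add: hom_T)

lemma tinj_inj1: "P \<in> words C \<Longrightarrow> Q \<in> words C \<Longrightarrow> i < length P \<Longrightarrow>
    tinj P i \<odot> inj1 T P Q = tinj (P @ Q) i"
  using TS.nin_inj1[OF lt_obj[of P] lt_obj[of Q], of i] by (simp add: tinj_def nob_lt)

lemma tinj_inj2: "P \<in> words C \<Longrightarrow> Q \<in> words C \<Longrightarrow> j < length Q \<Longrightarrow>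
    tinj Q j \<odot> inj2 T P Q = tinj (P @ Q) (length P + j)"
  using TS.nin_inj2[OF lt_obj[of P] lt_obj[of Q], of j] by (simp add: tinj_def nob_lt)

lemma tinj_single: "tinj [U] i = aI [U]"
  by (simp add: tinj_def nin.simps)

lemma inj_A [simp]:
  assumes "P \<in> words C" "Q \<in> words C"
  shows "inj1 T P Q \<in> A" "inj2 T P Q \<in> A" "prj1 T P Q \<in> A" "prj2 T P Q \<in> A"
    "dm (inj1 T P Q) = P" "cd (inj1 T P Q) = P @ Q" "dm (inj2 T P Q) = Q" "cd (inj2 T P Q) = P @ Q"
    "dm (prj1 T P Q) = P @ Q" "cd (prj1 T P Q) = P" "dm (prj2 T P Q) = P @ Q" "cd (prj2 T P Q) = Q"
  using inj_hom[OF assms] by (simp_all add: hom_T)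

lemma star_A [simp]:
  assumes "P \<in> words C" "Q \<in> words C"
  shows "star T P Q \<in> A" "dm (star T P Q) = P" "cd (star T P Q) = Q"
  using assms by (simp_all add: star_eq)

lemma tinj_split:
  assumes "P \<in> words C" "Q \<in> words C" "k < length (P @ Q)"
  obtains (left) "k < length P" "tinj (P @ Q) k = tinj P k \<odot> inj1 T P Q"
  | (right) j where "k = length P + j" "j < length Q" "tinj (P @ Q) k = tinj Q j \<odot> inj2 T P Q"
proof (cases "k < length P")
  case True
  then show ?thesis using left assms tinj_inj1 by simp
next
  case False
  then show ?thesis using right[of "k - length P"] assms tinj_inj2[of P Q "k - length P"] by simp
qed

lemma tinj_prj:
  assumes "P \<in> words C" "Q \<in> words C" "k < length (P @ Q)"
  shows "tinj (P @ Q) k \<odot> prj1 T P Q = (if k < length P then tinj P k else star T [(P @ Q) ! k] P)"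
    and "tinj (P @ Q) k \<odot> prj2 T P Q = (if k < length P then star T [(P @ Q) ! k] Q else tinj Q (k - length P))"
proof -
  have s: "f \<odot> star T P' Q' = star T (dm f) Q'" if "f \<in> A" "cd f = P'" "Q' \<in> words C" for f P' Q'
    using TC.cmp_star_right[of Q' f "dm f" P'] that by (simp add: hom_T)
  show "tinj (P @ Q) k \<odot> prj1 T P Q = (if k < length P then tinj P k else star T [(P @ Q) ! k] P)"
    "tinj (P @ Q) k \<odot> prj2 T P Q = (if k < length P then star T [(P @ Q) ! k] Q else tinj Q (k - length P))"
    using assms(3)
    by (rule_tac tinj_split[OF assms]; simp add: assms assoc inj_prj idr s nth_append)+
qed

lemma inj_par:
  assumes f: "f \<in> A" "dm f = P" "cd f = P'" and g: "g \<in> A" "dm g = Q" "cd g = Q'"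
  shows "inj1 T P Q \<odot> (f \<otimes> g) = f \<odot> inj1 T P' Q'" "inj2 T P Q \<odot> (f \<otimes> g) = g \<odot> inj2 T P' Q'"
proof -
  have w: "P \<in> words C" "Q \<in> words C" "P' \<in> words C" "Q' \<in> words C"
    using A_words[of f] A_words[of g] f g by simp_all
  note [simp] = f g w
  have "f \<odot> (aI P' \<otimes> aN Q') = (f \<otimes> aI []) \<odot> (aI P' \<otimes> aN Q')" by (simp add: pidr)
  also have "\<dots> = f \<otimes> aN Q'" by (subst ichg) (simp_all add: idl idr)
  finally show "inj1 T P Q \<odot> (f \<otimes> g) = f \<odot> inj1 T P' Q'"
    by (simp add: inj_eq ichg idl N_natural)
  have "g \<odot> (aN P' \<otimes> aI Q') = (aI [] \<otimes> g) \<odot> (aN P' \<otimes> aI Q')" by (simp add: pidl)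
  also have "\<dots> = aN P' \<otimes> g" by (subst ichg) (simp_all add: idl idr)
  finally show "inj2 T P Q \<odot> (f \<otimes> g) = g \<odot> inj2 T P' Q'"
    by (simp add: inj_eq ichg idl N_natural)
qed

lemma inj_S:
  assumes "P \<in> words C" "Q \<in> words C"
  shows "inj1 T P Q \<odot> aS P Q = inj2 T Q P" "inj2 T P Q \<odot> aS P Q = inj1 T Q P"
  using assms by (simp_all add: inj_eq S_natural S_Nil_left S_Nil_right idl)

lemma inj_M:
  assumes "P \<in> words C"
  shows "inj1 T P P \<odot> aM P = aI P" "inj2 T P P \<odot> aM P = aI P"
  using assms by (simp_all add: inj_eq M_unit_left M_unit_right)

lemma M_inj:
  assumes "P \<in> words C" "Q \<in> words C"
  shows "(inj1 T P Q \<otimes> inj2 T P Q) \<odot> aM (P @ Q) = aI (P @ Q)"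
  using assms by (rule_tac inj_ext[OF assms]) (simp_all add: inj_copair idr)

text \<open>Unfolding the sum leaves the split followed by \<open>M_inj\<close>. A split is thus
  expressed by sum and injections, which is how it becomes a convex combination.\<close>

lemma D_eq: "P \<in> words C \<Longrightarrow> p \<in> {0<..<1} \<Longrightarrow> aD p P = plus T p (inj1 T P P) (inj2 T P P)"
  by (simp add: plus_eq M_inj idr)

lemma cls_Split:
  assumes U: "U \<in> obj C" and p: "p \<in> {0<..<1}"
  shows "cls [U] [U, U] (Split p U) = aD p [U]"
proof -
  have w: "[U] \<in> words C" "[] \<in> words C" using U by simp_all
  note [simp del] = swapw.simps
  have i: "tape_typed C [U] [U] (Idt U)" using U by (rule tape_typed.intros)
  have t: "tape_typed C [U] [U, U] (Split p U)" using p U by (rule tape_typed.intros)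
  have z: "tape_typed C [] [] Idt0" by (rule tape_typed.intros)
  have s: "tape_typed C [U] [U] (swapw [U] [])" using typed_swapw[OF w] by simp
  note s0 = typed_par[OF s z HOL.refl HOL.refl, simplified]
  note t0 = typed_par[OF t z HOL.refl HOL.refl, simplified]
  have a: "cls [U] [U] (swapw [U] [] \<oplus> Idt0) = aI [U]"
    using par_cls[OF s z] S_Nil_right[of "[U]"] w by (simp add: aS_def pidr flip: aI_Nil)
  have "aD p [U] = cls [U] [U, U] (Split p U \<oplus> Idt0) \<odot> cls [U, U] [U, U] (Idt U \<oplus> (swapw [U] [] \<oplus> Idt0))"
    using seq_cls[OF t0 typed_par[OF i s0 HOL.refl HOL.refl, simplified]] by (simp add: aD_def)
  also have "cls [U, U] [U, U] (Idt U \<oplus> (swapw [U] [] \<oplus> Idt0)) = aI [U, U]"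
    using par_cls[OF i s0] w par_id[of "[U]" "[U]"] by (simp add: a cls_Idt[OF U])
  also have "cls [U] [U, U] (Split p U \<oplus> Idt0) = cls [U] [U, U] (Split p U)"
    using par_cls[OF t z] pidr[OF cls_A[OF t]] by (simp flip: aI_Nil)
  finally show ?thesis using w idr[OF cls_A[OF t]] by simp
qed

lemma cls_Discard: "U \<in> obj C \<Longrightarrow> cls [U] [] (Discard U) = star T [U] []"
  using E_natural[of "cls [U] [] (Discard U)" "[]"] idr[of "cls [U] [] (Discard U)" "[]"]
    idr[of "aE [U]" "[]"]
  by (auto simp: star_eq EN_Nil tape_typed.intros cls_A)

lemma cls_Swap: "U \<in> obj C \<Longrightarrow> V \<in> obj C \<Longrightarrow> cls [U, V] [V, U] (Swap U V) = aS [U] [V]"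
  using tape_class_eq[OF tape_eq.swap_gen[of U C V]] by (simp add: aS_def)

lemma box_hom: "c \<in> hom C U V \<Longrightarrow> box c \<in> hom T [U] [V]"
  using hom_objD[of c U V] by (auto simp: hom_T box_def hom_iff[of c] intro!: cls_A tape_typed.intros)

lemma box_A [simp]: "c \<in> hom C U V \<Longrightarrow> box c \<in> A" "c \<in> hom C U V \<Longrightarrow> dm (box c) = [U]"
  "c \<in> hom C U V \<Longrightarrow> cd (box c) = [V]"
  using box_hom[of c U V] by (simp_all add: hom_T)

lemma box_idn: "U \<in> obj C \<Longrightarrow> box (idn C U) = aI [U]"
  using tape_class_eq[OF tape_eq.box_id[of U C]] by (simp add: box_def idn_arr cls_Idt)

lemma box_cmp: "c \<in> hom C U V \<Longrightarrow> d \<in> hom C V W \<Longrightarrow> box (c ;;\<^bsub>C\<^esub> d) = box c \<odot> box d"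
  using tape_class_eq[OF tape_eq.box_cmp[of U C V W c d]] hom_objD[of c U V] hom_objD[of d V W]
    seq_cls[OF tape_typed.intros(8)[of c C U V] tape_typed.intros(8)[of d C V W]] cmp_hom[of c U V d W]
  by (simp add: box_def hom_iff)

section \<open>Convex combinations of boxes\<close>

text \<open>A generator carries its position: a letter may recur in \<open>Q\<close>, and the same
  arrow into two occurrences must count twice.\<close>

definition gens :: "'o \<Rightarrow> 'o list \<Rightarrow> (nat \<times> 'a) set" where
  "gens U Q = {(j, c). j < length Q \<and> c \<in> hom C U (Q ! j)}"

definition gen :: "'o list \<Rightarrow> nat \<times> 'a \<Rightarrow> ('o, 'a) tape_arr" where
  "gen Q = (\<lambda>(j, c). box c \<odot> tinj Q j)"

abbreviation comb :: "'o \<Rightarrow> 'o list \<Rightarrow> (nat \<times> 'a \<Rightarrow> real) \<Rightarrow> ('o, 'a) tape_arr \<Rightarrow> bool" where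
  "comb U Q \<equiv> wrep (plus T) (star T [U] Q) (gens U Q) (gen Q)"

definition conv :: "'o \<Rightarrow> 'o list \<Rightarrow> ('o, 'a) tape_arr \<Rightarrow> bool" where
  "conv U Q x \<longleftrightarrow> (\<exists>w. comb U Q w x)"

lemma gen_hom: "Q \<in> words C \<Longrightarrow> s \<in> gens U Q \<Longrightarrow> gen Q s \<in> hom T [U] Q"
  using TC.cmp_hom[OF box_hom tinj_hom] by (auto simp: gens_def gen_def)

lemma pca_gens_T: "U \<in> obj C \<Longrightarrow> Q \<in> words C \<Longrightarrow>
    pca_gens (hom T [U] Q) (plus T) (star T [U] Q) (gens U Q) (gen Q)"
  using gen_hom by (intro TC.pca_gens_hom) auto

lemma conv_hom: "U \<in> obj C \<Longrightarrow> Q \<in> words C \<Longrightarrow> conv U Q x \<Longrightarrow> x \<in> hom T [U] Q"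
  using pca_gens.W_in[OF pca_gens_T] unfolding conv_def by blast

lemma conv_star: "conv U Q (star T [U] Q)"
  unfolding conv_def by (blast intro: wrep_star)

lemma conv_gen: "j < length Q \<Longrightarrow> c \<in> hom C U (Q ! j) \<Longrightarrow> conv U Q (box c \<odot> tinj Q j)"
  using wrep_gen[of "(j, c)" "gens U Q" "plus T" "star T [U] Q" "gen Q"]
  unfolding conv_def gens_def gen_def by auto

lemma conv_plus: "p \<in> {0<..<1} \<Longrightarrow> conv U Q x \<Longrightarrow> conv U Q y \<Longrightarrow> conv U Q (plus T p x y)"
  unfolding conv_def greaterThanLessThan_iff by (elim exE conjE) (rule exI, rule wrep_plus)

lemma conv_induct [consumes 1, case_names star gen plus]:
  assumes "conv U Q x" "Z (star T [U] Q)"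
    and "\<And>j c. j < length Q \<Longrightarrow> c \<in> hom C U (Q ! j) \<Longrightarrow> Z (box c \<odot> tinj Q j)"
    and "\<And>p x y. p \<in> {0<..<1} \<Longrightarrow> conv U Q x \<Longrightarrow> conv U Q y \<Longrightarrow> Z x \<Longrightarrow> Z y \<Longrightarrow> Z (plus T p x y)"
  shows "Z x"
proof -
  obtain w where "comb U Q w x" using assms(1) unfolding conv_def by blast
  then show ?thesis
  proof (induction rule: wrep.induct)
    case (wrep_gen s)
    then show ?case using assms(3) by (auto simp: gens_def gen_def)
  next
    case (wrep_plus p u x v y)
    then show ?case using assms(4)[of p x y] by (auto simp: conv_def)
  qed (rule assms(2))
qed

lemma conv_tinj: "P \<in> words C \<Longrightarrow> i < length P \<Longrightarrow> conv (P ! i) P (tinj P i)"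
  using conv_gen[of i P "idn C (P ! i)" "P ! i"] idl[of "tinj P i" "[P ! i]"]
  by (auto simp: box_idn idn_hom in_lists_conv_set)

text \<open>Each generator absorbs the box in front of it, because consecutive boxes compose in
  \<open>C\<close>; stars and sums are respected by composition.\<close>

lemma conv_pre:
  assumes "conv V Q x" and c: "c \<in> hom C U V" and Q: "Q \<in> words C"
  shows "conv U Q (box c \<odot> x)"
  using assms(1)
proof (induction rule: conv_induct)
  case star
  have "box c \<odot> star T [V] Q = star T [U] Q"
    using TC.cmp_star_right[OF _ box_hom[OF c], of Q] Q by simp
  then show ?case by (simp add: conv_star)
next
  case (gen j d)
  have "box c \<odot> (box d \<odot> tinj Q j) = box (c ;;\<^bsub>C\<^esub> d) \<odot> tinj Q j"
    using gen c Q by (simp add: box_cmp assoc)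
  then show ?case using conv_gen[of j Q "c ;;\<^bsub>C\<^esub> d" U] gen c cmp_hom by simp
next
  case (plus p x y)
  have V: "V \<in> obj C" using hom_objD c by blast
  have "box c \<odot> plus T p x y = plus T p (box c \<odot> x) (box c \<odot> y)"
    using TC.cmp_plus_right[OF plus(1) box_hom[OF c] conv_hom[OF V Q plus(2)] conv_hom[OF V Q plus(3)]]
    by simp
  then show ?case using plus conv_plus by simp
qed

text \<open>Substitution of combinations into a combination: it suffices to know \<open>f\<close> on
  the letters of \<open>Q\<close>.\<close>

lemma conv_post:
  assumes "conv U Q x" and U: "U \<in> obj C" and f: "f \<in> hom T Q R"
    and e: "\<And>j. j < length Q \<Longrightarrow> conv (Q ! j) R (tinj Q j \<odot> f)"
  shows "conv U R (x \<odot> f)"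
proof -
  have w: "Q \<in> words C" "R \<in> words C" using TC.hom_objD[OF f] by auto
  show ?thesis using assms(1)
  proof (induction rule: conv_induct)
    case star
    then show ?case using TC.cmp_star_left[OF _ f, of "[U]"] U by (simp add: conv_star)
  next
    case (gen j c)
    have "(box c \<odot> tinj Q j) \<odot> f = box c \<odot> (tinj Q j \<odot> f)"
      using gen f w by (simp add: assoc hom_T)
    then show ?case using conv_pre[OF e[OF gen(1)] gen(2) w(2)] by simp
  next
    case (plus p x y)
    have "plus T p x y \<odot> f = plus T p (x \<odot> f) (y \<odot> f)"
      using TC.cmp_plus_left[OF plus(1) conv_hom[OF U w(1) plus(2)] conv_hom[OF U w(1) plus(3)] f] by simp
    then show ?case using plus conv_plus by simp
  qed
qed

text \<open>The induction has to speak of the restrictions to all letters, since sequential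
  composition passes through an arbitrary middle word; \<open>conv_post\<close> then uses the second
  tape letter by letter.\<close>

lemma conv_cls: "tape_typed C P Q t \<Longrightarrow> i < length P \<Longrightarrow> conv (P ! i) Q (tinj P i \<odot> cls P Q t)"
proof (induction arbitrary: i rule: tape_typed.induct)
  case (1 p U)
  have "inj1 T [U] [U] = tinj [U, U] 0" "inj2 T [U] [U] = tinj [U, U] 1"
    using tinj_inj1[of "[U]" "[U]" 0] tinj_inj2[of "[U]" "[U]" 0] 1 by (simp_all add: tinj_single idl)
  then have "cls [U] [U, U] (Split p U) = plus T p (tinj [U, U] 0) (tinj [U, U] 1)"
    using 1 by (simp add: cls_Split D_eq del: greaterThanLessThan_iff)
  moreover have "conv U [U, U] (plus T p (tinj [U, U] 0) (tinj [U, U] 1))"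
    using 1 conv_tinj[of "[U, U]" 0] conv_tinj[of "[U, U]" 1] by (intro conv_plus) auto
  ultimately show ?case using 1 by (simp add: tinj_single idl)
next
  case (2 U)
  then show ?case using conv_star[of U "[]"] by (simp add: tinj_single cls_Discard idl)
next
  case (3 U)
  have "tinj [U, U] i \<odot> aM [U] = aI [U]"
    by (rule tinj_split[of "[U]" "[U]" i]) (use 3 in \<open>simp_all add: tinj_single idl inj_M\<close>)
  then show ?case using conv_tinj[of "[U]" 0] 3 by (auto simp: tinj_single cls_Merge less_Suc_eq)
next
  case (5 U V)
  have w: "[U] \<in> words C" "[V] \<in> words C" using 5 by auto
  have e: "inj2 T [V] [U] = tinj [V, U] 1" "inj1 T [V] [U] = tinj [V, U] 0"
    using tinj_inj1[OF w(2,1), of 0] tinj_inj2[OF w(2,1), of 0] w by (simp_all add: tinj_single idl)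
  have i: "i < length ([U] @ [V])" using 5 by simp
  show ?case
  proof (rule tinj_split[OF w i])
    assume "i < length [U]" "tinj ([U] @ [V]) i = tinj [U] i \<odot> inj1 T [U] [V]"
    then show ?case using 5 w conv_tinj[of "[V, U]" 1] by (simp add: tinj_single idl cls_Swap inj_S e)
  next
    fix j assume "i = length [U] + j" "j < length [V]" "tinj ([U] @ [V]) i = tinj [V] j \<odot> inj2 T [U] [V]"
    then show ?case using 5 w conv_tinj[of "[V, U]" 0] by (simp add: tinj_single idl cls_Swap inj_S e)
  qed
next
  case (6 U)
  then show ?case using conv_tinj[of "[U]" 0] by (simp add: cls_Idt tinj_single idl)
next
  case (8 c U V)
  have "cls [U] [V] (Box c) = box c" using 8 by (simp add: box_def hom_iff)
  then show ?case using conv_gen[of 0 "[V]" c U] 8 by (simp add: tinj_single idl[of "box c"] idr[of "box c"])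
next
  case (9 P Q s R t)
  have w: "P \<in> words C" "Q \<in> words C" "R \<in> words C" using typed_words 9 by blast+
  have s: "cls P Q s \<in> A" "cls Q R t \<in> A" using 9 by auto
  have "conv (P ! i) R ((tinj P i \<odot> cls P Q s) \<odot> cls Q R t)"
  proof (rule conv_post)
    show "conv (P ! i) Q (tinj P i \<odot> cls P Q s)" using 9 by simp
    show "P ! i \<in> obj C" using 9 w by (simp add: in_lists_conv_set)
    show "cls Q R t \<in> hom T Q R" using s by (simp add: hom_T)
  qed (use 9 in simp)
  then show ?case using 9 w s seq_cls[OF 9(1,2)] by (simp add: assoc)
next
  case (10 P Q s P' Q' t)
  have w: "P \<in> words C" "Q \<in> words C" "P' \<in> words C" "Q' \<in> words C" using typed_words 10 by blast+
  have s: "cls P Q s \<in> A" "cls P' Q' t \<in> A" using 10 by auto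
  note [simp] = w s par_cls[OF 10(1,2), symmetric]
  note p = inj_par[of "cls P Q s" P Q "cls P' Q' t" P' Q', simplified]
  show ?case
  proof (rule tinj_split[OF w(1,3), of i])
    assume i: "i < length P" and e: "tinj (P @ P') i = tinj P i \<odot> inj1 T P P'"
    have "conv (P ! i) (Q @ Q') ((tinj P i \<odot> cls P Q s) \<odot> inj1 T Q Q')"
    proof (rule conv_post)
      show "conv (P ! i) Q (tinj P i \<odot> cls P Q s)" by (rule 10(3)[OF i])
      show "P ! i \<in> obj C" using i w(1) by (simp add: in_lists_conv_set)
      show "inj1 T Q Q' \<in> hom T Q (Q @ Q')" by (simp add: hom_T)
      show "conv (Q ! j) (Q @ Q') (tinj Q j \<odot> inj1 T Q Q')" if "j < length Q" for j
        using conv_tinj[of "Q @ Q'" j] that by (simp add: tinj_inj1 nth_append)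
    qed
    then show ?case using i by (simp add: e assoc p nth_append)
  next
    fix j assume j: "i = length P + j" "j < length P'" and e: "tinj (P @ P') i = tinj P' j \<odot> inj2 T P P'"
    have "conv (P' ! j) (Q @ Q') ((tinj P' j \<odot> cls P' Q' t) \<odot> inj2 T Q Q')"
    proof (rule conv_post)
      show "conv (P' ! j) Q' (tinj P' j \<odot> cls P' Q' t)" by (rule 10(4)[OF j(2)])
      show "P' ! j \<in> obj C" using j w(3) by (simp add: in_lists_conv_set)
      show "inj2 T Q Q' \<in> hom T Q' (Q @ Q')" by (simp add: hom_T)
      show "conv (Q' ! k) (Q @ Q') (tinj Q' k \<odot> inj2 T Q Q')" if "k < length Q'" for k
        using conv_tinj[of "Q @ Q'" "length Q + k"] that by (simp add: tinj_inj2)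
    qed
    then show ?case using j(1,2) e[unfolded j(1)] by (simp add: assoc p)
  qed (rule 10(5))
\<comment> \<open>\<open>Init\<close> and \<open>Idt0\<close> start at the empty word, which has no
  letter to restrict to.\<close>
qed auto

lemma conv_all:
  assumes "f \<in> hom T [U] Q"
  shows "conv U Q f"
proof -
  obtain t where "tape_typed C [U] Q t" "f = cls [U] Q t" using assms hom_cls by auto
  then show ?thesis using conv_cls[of "[U]" Q t 0] by (simp add: tinj_single idl cls_A)
qed

section \<open>Action of the projections on weights\<close>

text \<open>Generators at positions of \<open>Q\<close> become the star, so their mass joins the
  missing mass and the other weights stay as they are.\<close>

lemma comb_prj1:
  assumes U: "U \<in> obj C" and w: "P \<in> words C" "Q \<in> words C"
  shows "comb U (P @ Q) u x \<Longrightarrow> comb U P (\<lambda>(j, c). if j < length P then u (j, c) else 0) (x \<odot> prj1 T P Q)"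
proof (induction rule: wrep.induct)
  case wrep_star
  have "star T [U] (P @ Q) \<odot> prj1 T P Q = star T [U] P"
    using TC.cmp_star_left[of "[U]" "prj1 T P Q"] inj_hom(3)[OF w] U by simp
  then show ?case using wrep.wrep_star[of "plus T" "star T [U] P" "gens U P" "gen P"]
    by (simp add: case_prod_unfold)
next
  case (wrep_gen s)
  obtain j c where s: "s = (j, c)" "j < length (P @ Q)" and c: "c \<in> hom C U ((P @ Q) ! j)"
    using wrep_gen by (auto simp: gens_def)
  have e: "gen (P @ Q) s \<odot> prj1 T P Q = box c \<odot> (tinj (P @ Q) j \<odot> prj1 T P Q)"
    using s c w by (simp add: gen_def assoc)
  show ?case
  proof (cases "j < length P")
    case True
    then have "(\<lambda>(j, c). if j < length P then indicat_real {s} (j, c) else 0) = indicator {s}"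
      using s by (auto simp: indicator_def fun_eq_iff)
    moreover have "gen (P @ Q) s \<odot> prj1 T P Q = gen P s"
      using e True w s tinj_prj(1)[OF w s(2)] by (simp add: gen_def)
    moreover have "s \<in> gens U P" using c s True by (auto simp: gens_def nth_append)
    ultimately show ?thesis by (simp only: wrep.wrep_gen)
  next
    case False
    then have "(\<lambda>(j, c). if j < length P then indicat_real {s} (j, c) else 0) = (\<lambda>_. 0)"
      using s by (auto simp: indicator_def fun_eq_iff)
    moreover have "gen (P @ Q) s \<odot> prj1 T P Q = star T [U] P"
      using e False w s tinj_prj(1)[OF w s(2)] TC.cmp_star_right[OF _ box_hom[OF c], of P] by simp
    ultimately show ?thesis by (simp only: wrep.wrep_star)
  qed
next
  case (wrep_plus p u x v y)
  have "plus T p x y \<odot> prj1 T P Q = plus T p (x \<odot> prj1 T P Q) (y \<odot> prj1 T P Q)"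
    using TC.cmp_plus_left[OF _ conv_hom conv_hom inj_hom(3)[OF w], of p U x y] wrep_plus U w
    by (auto simp: conv_def)
  moreover have "(\<lambda>(j, c). if j < length P then p * u (j, c) + (1 - p) * v (j, c) else 0) =
    (\<lambda>s. p * (case s of (j, c) \<Rightarrow> if j < length P then u (j, c) else 0) +
      (1 - p) * (case s of (j, c) \<Rightarrow> if j < length P then v (j, c) else 0))"
    by (auto simp: fun_eq_iff)
  ultimately show ?case using wrep.wrep_plus[OF wrep_plus(1,2,5,6)] by simp
qed

lemma comb_prj2:
  assumes U: "U \<in> obj C" and w: "P \<in> words C" "Q \<in> words C"
  shows "comb U (P @ Q) u x \<Longrightarrow> comb U Q (\<lambda>(j, c). u (length P + j, c)) (x \<odot> prj2 T P Q)"
proof (induction rule: wrep.induct)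
  case wrep_star
  have "star T [U] (P @ Q) \<odot> prj2 T P Q = star T [U] Q"
    using TC.cmp_star_left[of "[U]" "prj2 T P Q"] inj_hom(4)[OF w] U by simp
  then show ?case using wrep.wrep_star[of "plus T" "star T [U] Q" "gens U Q" "gen Q"]
    by (simp add: case_prod_unfold)
next
  case (wrep_gen s)
  obtain j c where s: "s = (j, c)" "j < length (P @ Q)" and c: "c \<in> hom C U ((P @ Q) ! j)"
    using wrep_gen by (auto simp: gens_def)
  have e: "gen (P @ Q) s \<odot> prj2 T P Q = box c \<odot> (tinj (P @ Q) j \<odot> prj2 T P Q)"
    using s c w by (simp add: gen_def assoc)
  show ?case
  proof (cases "j < length P")
    case True
    then have "(\<lambda>(j, c). indicat_real {s} (length P + j, c)) = (\<lambda>_. 0)"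
      using s by (auto simp: indicator_def fun_eq_iff)
    moreover have "gen (P @ Q) s \<odot> prj2 T P Q = star T [U] Q"
      using e True w s tinj_prj(2)[OF w s(2)] TC.cmp_star_right[OF _ box_hom[OF c], of Q] by simp
    ultimately show ?thesis by (simp only: wrep.wrep_star)
  next
    case False
    let ?s = "(j - length P, c)"
    have "(\<lambda>(j, c). indicat_real {s} (length P + j, c)) = indicator {?s}"
      using s False by (auto simp: indicator_def fun_eq_iff)
    moreover have "gen (P @ Q) s \<odot> prj2 T P Q = gen Q ?s"
      using e False w s tinj_prj(2)[OF w s(2)] by (simp add: gen_def)
    moreover have "?s \<in> gens U Q" using c s False by (auto simp: gens_def nth_append)
    ultimately show ?thesis by (simp only: wrep.wrep_gen)
  qed
next
  case (wrep_plus p u x v y)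
  have "plus T p x y \<odot> prj2 T P Q = plus T p (x \<odot> prj2 T P Q) (y \<odot> prj2 T P Q)"
    using TC.cmp_plus_left[OF _ conv_hom conv_hom inj_hom(4)[OF w], of p U x y] wrep_plus U w
    by (auto simp: conv_def)
  moreover have "(\<lambda>(j, c). p * u (length P + j, c) + (1 - p) * v (length P + j, c)) =
    (\<lambda>s. p * (case s of (j, c) \<Rightarrow> u (length P + j, c)) + (1 - p) * (case s of (j, c) \<Rightarrow> v (length P + j, c)))"
    by (auto simp: fun_eq_iff)
  ultimately show ?case using wrep.wrep_plus[OF wrep_plus(1,2,5,6)] by simp
qed

end

section \<open>Interpreting tapes\<close>

text \<open>Here the typing conditions are equations on \<open>src\<close> and \<open>tgt\<close>;
  in the axioms they contain objects that rewriting cannot instantiate.\<close>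

lemma (in category) assoc_arr:
  "f \<in> arr C \<Longrightarrow> g \<in> arr C \<Longrightarrow> h \<in> arr C \<Longrightarrow> tgt C f = src C g \<Longrightarrow> tgt C g = src C h \<Longrightarrow>
    (f ;; g) ;; h = f ;; (g ;; h)"
  by (rule cmp_assoc) (simp_all add: hom_iff)

lemma (in category) idl_arr: "f \<in> arr C \<Longrightarrow> src C f = A \<Longrightarrow> idn C A ;; f = f"
  by (rule cmp_idl) (simp add: hom_iff)

lemma (in category) idr_arr: "f \<in> arr C \<Longrightarrow> tgt C f = A \<Longrightarrow> f ;; idn C A = f"
  by (rule cmp_idr) (simp add: hom_iff)

text \<open>The sum of each word is a parameter: the linear model takes the word itself, a general
  target takes the iterated sum \<open>nob\<close>. On a one-letter word it has to be the object of
  the letter with the identity as injection, so that boxes act between the right objects.\<close>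

locale tape_interp = C: category C + D: pca_category D
  for C :: "('o, 'a, 'y) cat_scheme" and D :: "('p, 'b, 'z) pcacat_scheme" +
  fixes ob :: "'o \<Rightarrow> 'p" and wob :: "'o list \<Rightarrow> 'p" and win :: "'o list \<Rightarrow> nat \<Rightarrow> 'b" and bx :: "'a \<Rightarrow> 'b"
  assumes ncop: "P \<in> words C \<Longrightarrow> is_ncop D (map ob P) (wob P) (win P)"
    and wob_single: "U \<in> obj C \<Longrightarrow> wob [U] = ob U"
    and win_single: "U \<in> obj C \<Longrightarrow> win [U] 0 = idn D (ob U)"
    and bx_hom: "c \<in> hom C U V \<Longrightarrow> bx c \<in> hom D (ob U) (ob V)"
    and bx_idn: "U \<in> obj C \<Longrightarrow> bx (idn C U) = idn D (ob U)"
    and bx_cmp: "c \<in> hom C U V \<Longrightarrow> d \<in> hom C V W \<Longrightarrow> bx (c ;;\<^bsub>C\<^esub> d) = bx c ;;\<^bsub>D\<^esub> bx d"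
begin

abbreviation dcmp (infixl "\<bullet>" 70) where "f \<bullet> g \<equiv> f ;;\<^bsub>D\<^esub> g"

lemma wob_obj [simp]: "P \<in> words C \<Longrightarrow> wob P \<in> obj D"
  using ncop ncop_obj by metis

lemma ob_obj [simp]: "U \<in> obj C \<Longrightarrow> ob U \<in> obj D"
  using wob_obj[of "[U]"] wob_single by simp

lemma win_hom: "P \<in> words C \<Longrightarrow> i < length P \<Longrightarrow> win P i \<in> hom D (ob (P ! i)) (wob P)"
  using ncop_in[OF ncop, of P i] by simp

lemma win_arr [simp]:
  "P \<in> words C \<Longrightarrow> i < length P \<Longrightarrow> win P i \<in> arr D"
  "P \<in> words C \<Longrightarrow> i < length P \<Longrightarrow> src D (win P i) = ob (P ! i)"
  "P \<in> words C \<Longrightarrow> i < length P \<Longrightarrow> tgt D (win P i) = wob P"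
  using win_hom[of P i] by (simp_all add: hom_iff)

lemma win_ext:
  assumes "P \<in> words C" "h \<in> hom D (wob P) Z" "k \<in> hom D (wob P) Z"
    "\<And>i. i < length P \<Longrightarrow> win P i \<bullet> h = win P i \<bullet> k"
  shows "h = k"
  using D.ncop_ext[OF ncop[OF assms(1)] assms(2,3)] assms(4) by simp

definition cop :: "'o list \<Rightarrow> 'p \<Rightarrow> (nat \<Rightarrow> 'b) \<Rightarrow> 'b" where
  "cop P Z g = (THE h. h \<in> hom D (wob P) Z \<and> (\<forall>i<length P. win P i \<bullet> h = g i))"

lemma cop_ex1:
  assumes "P \<in> words C" "Z \<in> obj D" "\<And>i. i < length P \<Longrightarrow> g i \<in> hom D (ob (P ! i)) Z"
  shows "\<exists>!h. h \<in> hom D (wob P) Z \<and> (\<forall>i<length P. win P i \<bullet> h = g i)"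
proof -
  obtain h where "h \<in> hom D (wob P) Z" "\<And>i. i < length P \<Longrightarrow> win P i \<bullet> h = g i"
    using D.ncop_ex[OF ncop[OF assms(1)] assms(2), of g] assms(3) by auto
  then show ?thesis using win_ext[OF assms(1)] by (intro ex1I[of _ h]) auto
qed

lemma cop_hom:
  assumes "P \<in> words C" "Z \<in> obj D" "\<And>i. i < length P \<Longrightarrow> g i \<in> hom D (ob (P ! i)) Z"
  shows "cop P Z g \<in> hom D (wob P) Z"
  using theI'[OF cop_ex1[OF assms]] unfolding cop_def by blast

lemma win_cop:
  assumes "P \<in> words C" "Z \<in> obj D" "\<And>i. i < length P \<Longrightarrow> g i \<in> hom D (ob (P ! i)) Z" "i < length P"
  shows "win P i \<bullet> cop P Z g = g i"
  using theI'[OF cop_ex1[OF assms(1-3)]] assms(4) unfolding cop_def by blast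

text \<open>\<open>D\<close> comes without chosen binary sums, so the injections into a
  concatenation are induced from the letter injections.\<close>

definition lft :: "'o list \<Rightarrow> 'o list \<Rightarrow> 'b" where
  "lft P Q = cop P (wob (P @ Q)) (win (P @ Q))"
definition rgt :: "'o list \<Rightarrow> 'o list \<Rightarrow> 'b" where
  "rgt P Q = cop Q (wob (P @ Q)) (\<lambda>i. win (P @ Q) (length P + i))"

lemma win_append_hom:
  assumes "P \<in> words C" "Q \<in> words C"
  shows "i < length P \<Longrightarrow> win (P @ Q) i \<in> hom D (ob (P ! i)) (wob (P @ Q))"
    and "j < length Q \<Longrightarrow> win (P @ Q) (length P + j) \<in> hom D (ob (Q ! j)) (wob (P @ Q))"
  using win_hom[of "P @ Q" i] win_hom[of "P @ Q" "length P + j"] assms by (simp_all add: nth_append)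

lemma lft_hom: "P \<in> words C \<Longrightarrow> Q \<in> words C \<Longrightarrow> lft P Q \<in> hom D (wob P) (wob (P @ Q))"
  unfolding lft_def using win_append_hom(1) by (intro cop_hom) auto

lemma rgt_hom: "P \<in> words C \<Longrightarrow> Q \<in> words C \<Longrightarrow> rgt P Q \<in> hom D (wob Q) (wob (P @ Q))"
  unfolding rgt_def using win_append_hom(2) by (intro cop_hom) auto

lemma lr_arr [simp]:
  assumes "P \<in> words C" "Q \<in> words C"
  shows "lft P Q \<in> arr D" "src D (lft P Q) = wob P" "tgt D (lft P Q) = wob (P @ Q)"
    "rgt P Q \<in> arr D" "src D (rgt P Q) = wob Q" "tgt D (rgt P Q) = wob (P @ Q)"
  using lft_hom[OF assms] rgt_hom[OF assms] by (simp_all add: hom_iff)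

lemma win_lft: "P \<in> words C \<Longrightarrow> Q \<in> words C \<Longrightarrow> i < length P \<Longrightarrow> win P i \<bullet> lft P Q = win (P @ Q) i"
  unfolding lft_def using win_append_hom(1) by (intro win_cop) auto

lemma win_rgt: "P \<in> words C \<Longrightarrow> Q \<in> words C \<Longrightarrow> i < length Q \<Longrightarrow>
    win Q i \<bullet> rgt P Q = win (P @ Q) (length P + i)"
  unfolding rgt_def using win_append_hom(2) by (intro win_cop) auto

lemma lr_coproduct:
  assumes "P \<in> words C" "Q \<in> words C"
  shows "is_coproduct D (wob P) (wob Q) (wob (P @ Q)) (lft P Q) (rgt P Q)"
proof (rule D.coproduct_of_ncop[OF ncop ncop])
  show "is_ncop D (map ob P @ map ob Q) (wob (P @ Q)) (win (P @ Q))"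
    using ncop[of "P @ Q"] assms by simp
qed (use assms in \<open>simp_all add: lft_hom rgt_hom win_lft win_rgt\<close>)

lemmas lr_ext = D.coproduct_ext[OF lr_coproduct]

text \<open>Concatenation of lists is strictly associative, so the equations typecheck whether or
  not \<open>D\<close> is strict; each is verified on letters.\<close>

lemma lr_assoc:
  assumes w: "P \<in> words C" "Q \<in> words C" "R \<in> words C"
  shows "lft P Q \<bullet> lft (P @ Q) R = lft P (Q @ R)"
    and "rgt P Q \<bullet> lft (P @ Q) R = lft Q R \<bullet> rgt P (Q @ R)"
    and "rgt (P @ Q) R = rgt Q R \<bullet> rgt P (Q @ R)"
proof -
  note [simp] = w D.cmp_arr hom_iff
  have 1: "lft P (Q @ R) \<in> hom D (wob P) (wob ((P @ Q) @ R))"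
    "rgt P (Q @ R) \<in> hom D (wob (Q @ R)) (wob ((P @ Q) @ R))" by simp_all
  show "lft P Q \<bullet> lft (P @ Q) R = lft P (Q @ R)"
    by (rule win_ext[OF w(1) _ 1(1)])
      (simp_all add: win_lft D.assoc_arr[symmetric])
  show "rgt P Q \<bullet> lft (P @ Q) R = lft Q R \<bullet> rgt P (Q @ R)"
  proof (rule win_ext[OF w(2), of _ "wob (P @ Q @ R)"])
    fix i assume i: "i < length Q"
    have "win Q i \<bullet> (rgt P Q \<bullet> lft (P @ Q) R) = (win Q i \<bullet> rgt P Q) \<bullet> lft (P @ Q) R"
      using i by (simp add: D.assoc_arr)
    also have "\<dots> = (win Q i \<bullet> lft Q R) \<bullet> rgt P (Q @ R)"
      using i win_lft[of "P @ Q" R "length P + i"] by (simp add: win_lft win_rgt)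
    finally show "win Q i \<bullet> (rgt P Q \<bullet> lft (P @ Q) R) = win Q i \<bullet> (lft Q R \<bullet> rgt P (Q @ R))"
      using i by (simp add: D.assoc_arr)
  qed simp_all
  show "rgt (P @ Q) R = rgt Q R \<bullet> rgt P (Q @ R)"
  proof (rule win_ext[OF w(3), of _ "wob (P @ Q @ R)"])
    fix i assume i: "i < length R"
    have "win R i \<bullet> (rgt Q R \<bullet> rgt P (Q @ R)) = (win R i \<bullet> rgt Q R) \<bullet> rgt P (Q @ R)"
      using i by (simp add: D.assoc_arr)
    then show "win R i \<bullet> rgt (P @ Q) R = win R i \<bullet> (rgt Q R \<bullet> rgt P (Q @ R))"
      using i win_rgt[of "P @ Q" R i] by (simp add: win_rgt add.assoc)
  qed simp_all
qed

lemma lft_Nil: "P \<in> words C \<Longrightarrow> lft P [] = idn D (wob P)"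
  using win_lft[of P "[]"] lft_hom[of P "[]"]
  by (rule_tac win_ext[of P _ "wob P"]) (simp_all add: D.idn_hom D.idr_arr)

lemma rgt_Nil: "P \<in> words C \<Longrightarrow> rgt [] P = idn D (wob P)"
  using win_rgt[of "[]" P] rgt_hom[of "[]" P]
  by (rule_tac win_ext[of P _ "wob P"]) (simp_all add: D.idn_hom D.idr_arr)

text \<open>The value of \<open>\<oplus>\<close> depends on the words of its components, which a
  tape does not store. For a typed tape they can be read off the syntax
  (\<open>typed_tdom\<close>).\<close>

primrec tdom :: "('o, 'a) tape \<Rightarrow> 'o list" where
  "tdom (Split p U) = [U]" | "tdom (Discard U) = [U]" | "tdom (Merge U) = [U, U]"
| "tdom (Init U) = []" | "tdom (Swap U V) = [U, V]" | "tdom (Idt U) = [U]" | "tdom Idt0 = []"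
| "tdom (Box c) = [src C c]" | "tdom (s \<Zsemi> t) = tdom s" | "tdom (s \<oplus> t) = tdom s @ tdom t"

primrec tcod :: "('o, 'a) tape \<Rightarrow> 'o list" where
  "tcod (Split p U) = [U, U]" | "tcod (Discard U) = []" | "tcod (Merge U) = [U]"
| "tcod (Init U) = [U]" | "tcod (Swap U V) = [V, U]" | "tcod (Idt U) = [U]" | "tcod Idt0 = []"
| "tcod (Box c) = [tgt C c]" | "tcod (s \<Zsemi> t) = tcod t" | "tcod (s \<oplus> t) = tcod s @ tcod t"

text \<open>\<open>wob []\<close> is a zero object, so the star is the only possible value of
  \<open>Discard\<close> and \<open>Init\<close>. A merge is a codiagonal, and
  \<open>\<oplus>\<close> is the sum of two arrows, given on letters.\<close>

primrec sem :: "('o, 'a) tape \<Rightarrow> 'b" where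
  "sem (Split p U) = plus D p (win [U, U] 0) (win [U, U] 1)"
| "sem (Discard U) = star D (ob U) (wob [])"
| "sem (Merge U) = cop [U, U] (ob U) (\<lambda>_. idn D (ob U))"
| "sem (Init U) = star D (wob []) (ob U)"
| "sem (Swap U V) = cop [U, V] (wob [V, U]) (\<lambda>i. win [V, U] (1 - i))"
| "sem (Idt U) = idn D (ob U)"
| "sem Idt0 = idn D (wob [])"
| "sem (Box c) = bx c"
| "sem (s \<Zsemi> t) = sem s \<bullet> sem t"
| "sem (s \<oplus> t) = cop (tdom s @ tdom t) (wob (tcod s @ tcod t))
    (\<lambda>i. if i < length (tdom s) then win (tdom s) i \<bullet> (sem s \<bullet> lft (tcod s) (tcod t))
      else win (tdom t) (i - length (tdom s)) \<bullet> (sem t \<bullet> rgt (tcod s) (tcod t)))"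

lemma typed_tdom: "tape_typed C P Q t \<Longrightarrow> tdom t = P \<and> tcod t = Q"
  by (induction rule: tape_typed.induct) (auto simp: hom_iff)

text \<open>The typing of the two values is a hypothesis because the lemma is applied inside the
  induction that proves \<open>sem_hom\<close>.\<close>

lemma par_aux:
  assumes t: "tape_typed C P Q s" "tape_typed C P' Q' t"
    and h: "sem s \<in> hom D (wob P) (wob Q)" "sem t \<in> hom D (wob P') (wob Q')"
  shows "sem (s \<oplus> t) \<in> hom D (wob (P @ P')) (wob (Q @ Q')) \<and>
    lft P P' \<bullet> sem (s \<oplus> t) = sem s \<bullet> lft Q Q' \<and> rgt P P' \<bullet> sem (s \<oplus> t) = sem t \<bullet> rgt Q Q'"
proof -
  have w [simp]: "P \<in> words C" "Q \<in> words C" "P' \<in> words C" "Q' \<in> words C"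
    using typed_words[OF t(1)] typed_words[OF t(2)] by auto
  note [simp] = typed_tdom[OF t(1)] typed_tdom[OF t(2)] h[unfolded hom_iff] D.cmp_arr
  let ?g = "\<lambda>i. if i < length P then win P i \<bullet> (sem s \<bullet> lft Q Q')
      else win P' (i - length P) \<bullet> (sem t \<bullet> rgt Q Q')"
  have e: "sem (s \<oplus> t) = cop (P @ P') (wob (Q @ Q')) ?g" by (simp cong: if_cong)
  have g: "?g i \<in> hom D (ob ((P @ P') ! i)) (wob (Q @ Q'))" if "i < length (P @ P')" for i
    using that by (auto simp: hom_iff nth_append)
  have hom: "sem (s \<oplus> t) \<in> hom D (wob (P @ P')) (wob (Q @ Q'))"
    unfolding e using g by (intro cop_hom) simp_all
  have win: "win (P @ P') i \<bullet> sem (s \<oplus> t) = ?g i" if "i < length (P @ P')" for i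
    unfolding e using g that by (intro win_cop) simp_all
  note [simp] = hom[unfolded hom_iff] and [simp del] = sem.simps(10)
  have "lft P P' \<bullet> sem (s \<oplus> t) = sem s \<bullet> lft Q Q'"
  proof (rule win_ext[OF w(1), of _ "wob (Q @ Q')"])
    fix i assume i: "i < length P"
    have "win P i \<bullet> (lft P P' \<bullet> sem (s \<oplus> t)) = win (P @ P') i \<bullet> sem (s \<oplus> t)"
      using i by (simp add: D.assoc_arr[symmetric] win_lft)
    then show "win P i \<bullet> (lft P P' \<bullet> sem (s \<oplus> t)) = win P i \<bullet> (sem s \<bullet> lft Q Q')"
      using i win[of i] by simp
  qed (simp_all add: hom_iff)
  moreover have "rgt P P' \<bullet> sem (s \<oplus> t) = sem t \<bullet> rgt Q Q'"
  proof (rule win_ext[OF w(3), of _ "wob (Q @ Q')"])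
    fix i assume i: "i < length P'"
    have "win P' i \<bullet> (rgt P P' \<bullet> sem (s \<oplus> t)) = win (P @ P') (length P + i) \<bullet> sem (s \<oplus> t)"
      using i by (simp add: D.assoc_arr[symmetric] win_rgt)
    then show "win P' i \<bullet> (rgt P P' \<bullet> sem (s \<oplus> t)) = win P' i \<bullet> (sem t \<bullet> rgt Q Q')"
      using i win[of "length P + i"] by simp
  qed (simp_all add: hom_iff)
  ultimately show ?thesis using hom by blast
qed

lemma Merge_sem:
  assumes "U \<in> obj C"
  shows "sem (Merge U) \<in> hom D (wob [U, U]) (wob [U])"
    "i < 2 \<Longrightarrow> win [U, U] i \<bullet> sem (Merge U) = win [U] 0"
  using assms by (auto intro!: cop_hom win_cop simp: wob_single win_single D.idn_hom less_Suc_eq numeral_2_eq_2)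

lemma Swap_sem:
  assumes "U \<in> obj C" "V \<in> obj C"
  shows "sem (Swap U V) \<in> hom D (wob [U, V]) (wob [V, U])"
    "i < 2 \<Longrightarrow> win [U, V] i \<bullet> sem (Swap U V) = win [V, U] (1 - i)"
proof -
  have *: "win [V, U] (1 - i) \<in> hom D (ob ([U, V] ! i)) (wob [V, U])" if "i < length [U, V]" for i
    using that assms win_hom[of "[V, U]" "1 - i"] by (cases i) auto
  show "sem (Swap U V) \<in> hom D (wob [U, V]) (wob [V, U])"
    unfolding sem.simps using assms * by (intro cop_hom) simp_all
  show "i < 2 \<Longrightarrow> win [U, V] i \<bullet> sem (Swap U V) = win [V, U] (1 - i)"
    unfolding sem.simps using assms * by (subst win_cop) simp_all
qed

lemma sem_hom: "tape_typed C P Q t \<Longrightarrow> sem t \<in> hom D (wob P) (wob Q)"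
proof (induction rule: tape_typed.induct)
  case (1 p U)
  then have "win [U, U] 0 \<in> hom D (wob [U]) (wob [U, U])" "win [U, U] 1 \<in> hom D (wob [U]) (wob [U, U])"
    using win_hom[of "[U, U]" 0] win_hom[of "[U, U]" 1] by (simp_all add: wob_single)
  then show ?case using 1 by (simp add: D.plus_hom)
next
  case (3 U)
  then show ?case by (rule Merge_sem)
next
  case (5 U V)
  then show ?case by (rule Swap_sem)
next
  case (9 P Q s R t)
  then show ?case by (auto intro: D.cmp_hom)
next
  case (10 P Q s P' Q' t)
  then show ?case using par_aux by blast
qed (auto simp: wob_single D.star_hom D.idn_hom bx_hom)

lemma sem_arr:
  assumes "tape_typed C P Q t"
  shows "sem t \<in> arr D" "src D (sem t) = wob P" "tgt D (sem t) = wob Q"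
  using sem_hom[OF assms] by (simp_all add: hom_iff)

declare sem.simps(10) [simp del]

lemma sem_par:
  assumes "tape_typed C P Q s" "tape_typed C P' Q' t"
  shows "lft P P' \<bullet> sem (s \<oplus> t) = sem s \<bullet> lft Q Q'" "rgt P P' \<bullet> sem (s \<oplus> t) = sem t \<bullet> rgt Q Q'"
  using par_aux[OF assms sem_hom[OF assms(1)] sem_hom[OF assms(2)]] by auto

lemma sem_par_assoc:
  assumes t: "tape_typed C P Q s" "tape_typed C P' Q' t" and h: "h \<in> arr D" "src D h = wob (Q @ Q')"
  shows "lft P P' \<bullet> (sem (s \<oplus> t) \<bullet> h) = sem s \<bullet> (lft Q Q' \<bullet> h)"
    "rgt P P' \<bullet> (sem (s \<oplus> t) \<bullet> h) = sem t \<bullet> (rgt Q Q' \<bullet> h)"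
proof -
  have w [simp]: "P \<in> words C" "Q \<in> words C" "P' \<in> words C" "Q' \<in> words C"
    using typed_words[OF t(1)] typed_words[OF t(2)] by auto
  note [simp] = h sem_arr[OF t(1)] sem_arr[OF t(2)] sem_arr[OF tape_typed.intros(10)[OF t]] D.cmp_arr
  show "lft P P' \<bullet> (sem (s \<oplus> t) \<bullet> h) = sem s \<bullet> (lft Q Q' \<bullet> h)"
    "rgt P P' \<bullet> (sem (s \<oplus> t) \<bullet> h) = sem t \<bullet> (rgt Q Q' \<bullet> h)"
    by (simp_all add: D.assoc_arr[symmetric] sem_par[OF t])
qed

text \<open>A structural tape permutes, merges and inserts letters: it acts on injections through a
  function on positions, which determines it.\<close>

definition structural :: "'o list \<Rightarrow> 'o list \<Rightarrow> (nat \<Rightarrow> nat) \<Rightarrow> ('o, 'a) tape \<Rightarrow> bool" where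
  "structural P Q \<theta> t \<longleftrightarrow> tape_typed C P Q t \<and>
    (\<forall>i<length P. \<theta> i < length Q \<and> win P i \<bullet> sem t = win Q (\<theta> i))"

lemma structural_unique:
  assumes "structural P Q \<theta> s" "structural P Q \<theta>' t" "\<And>i. i < length P \<Longrightarrow> \<theta> i = \<theta>' i"
  shows "sem s = sem t"
  using assms typed_words[of C P Q s] sem_hom unfolding structural_def
  by (rule_tac win_ext[of P _ "wob Q"]) auto

lemma structural_cong:
  "structural P Q \<theta> t \<Longrightarrow> (\<And>i. i < length P \<Longrightarrow> \<theta> i = \<theta>' i) \<Longrightarrow> structural P Q \<theta>' t"
  unfolding structural_def by auto

lemma structural_seq:
  assumes s: "structural P Q \<theta> s" and t: "structural Q R \<phi> t"
  shows "structural P R (\<lambda>i. \<phi> (\<theta> i)) (s \<Zsemi> t)"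
proof -
  have st: "tape_typed C P Q s" "tape_typed C Q R t" using s t unfolding structural_def by auto
  have w [simp]: "P \<in> words C" "Q \<in> words C" "R \<in> words C"
    using typed_words[OF st(1)] typed_words[OF st(2)] by auto
  note [simp] = sem_arr[OF st(1)] sem_arr[OF st(2)]
  have "win P i \<bullet> (sem s \<bullet> sem t) = win R (\<phi> (\<theta> i))" if "i < length P" for i
    using that s t unfolding structural_def by (simp flip: D.assoc_arr)
  then show ?thesis using s t tape_typed.intros(9)[OF st] unfolding structural_def by simp
qed

lemma structural_par:
  assumes s: "structural P Q \<theta> s" and t: "structural P' Q' \<phi> t"
  shows "structural (P @ P') (Q @ Q')
    (\<lambda>i. if i < length P then \<theta> i else length Q + \<phi> (i - length P)) (s \<oplus> t)"
proof -
  have st: "tape_typed C P Q s" "tape_typed C P' Q' t" using s t unfolding structural_def by auto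
  have w [simp]: "P \<in> words C" "Q \<in> words C" "P' \<in> words C" "Q' \<in> words C"
    using typed_words[OF st(1)] typed_words[OF st(2)] by auto
  note [simp] = sem_arr[OF st(1)] sem_arr[OF st(2)] sem_arr[OF tape_typed.intros(10)[OF st]]
  have "win (P @ P') i \<bullet> sem (s \<oplus> t) = win (Q @ Q') (\<theta> i) \<and> \<theta> i < length Q" if i: "i < length P" for i
  proof -
    have "win (P @ P') i \<bullet> sem (s \<oplus> t) = win P i \<bullet> (lft P P' \<bullet> sem (s \<oplus> t))"
      using i by (simp add: D.assoc_arr[symmetric] win_lft)
    also have "\<dots> = (win P i \<bullet> sem s) \<bullet> lft Q Q'"
      using i by (simp add: sem_par[OF st] D.assoc_arr)
    finally show ?thesis using i s unfolding structural_def by (simp add: win_lft)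
  qed
  moreover have "win (P @ P') (length P + i) \<bullet> sem (s \<oplus> t) = win (Q @ Q') (length Q + \<phi> i) \<and> \<phi> i < length Q'"
    if i: "i < length P'" for i
  proof -
    have "win (P @ P') (length P + i) \<bullet> sem (s \<oplus> t) = win P' i \<bullet> (rgt P P' \<bullet> sem (s \<oplus> t))"
      using i by (simp add: D.assoc_arr[symmetric] win_rgt)
    also have "\<dots> = (win P' i \<bullet> sem t) \<bullet> rgt Q Q'"
      using i by (simp add: sem_par[OF st] D.assoc_arr)
    finally show ?thesis using i t unfolding structural_def by (simp add: win_rgt)
  qed
  ultimately have "(if i < length P then \<theta> i else length Q + \<phi> (i - length P)) < length (Q @ Q') \<and>
      win (P @ P') i \<bullet> sem (s \<oplus> t) =
        win (Q @ Q') (if i < length P then \<theta> i else length Q + \<phi> (i - length P))"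
    if "i < length (P @ P')" for i
    using that by (cases "i < length P")
      (simp_all add: trans_less_add1, metis add_diff_inverse_nat add_less_cancel_left)
  then show ?thesis using tape_typed.intros(10)[OF st] unfolding structural_def by blast
qed

text \<open>Words and position function enter up to equations, so that the arithmetic of offsets
  becomes a side condition.\<close>

lemma structural_par':
  assumes "structural P Q \<theta> s" "structural P' Q' \<phi> t" "R = P @ P'" "R' = Q @ Q'"
    "\<And>i. i < length P \<Longrightarrow> \<psi> i = \<theta> i"
    "\<And>i. i < length P' \<Longrightarrow> \<psi> (length P + i) = length Q + \<phi> i"
  shows "structural R R' \<psi> (s \<oplus> t)"
  unfolding assms(3,4)
proof (rule structural_cong[OF structural_par[OF assms(1,2)]])
  fix i assume "i < length (P @ P')"
  then show "(if i < length P then \<theta> i else length Q + \<phi> (i - length P)) = \<psi> i"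
    using assms(5)[of i] assms(6)[of "i - length P"] by auto
qed

lemma structural_Idt: "U \<in> obj C \<Longrightarrow> structural [U] [U] (\<lambda>i. i) (Idt U)"
  unfolding structural_def by (simp add: tape_typed.intros win_single D.idn_arr D.idl_arr)

lemma structural_Idt0: "structural [] [] \<theta> Idt0"
  unfolding structural_def by (auto simp: tape_typed.intros)

lemma structural_Merge: "U \<in> obj C \<Longrightarrow> structural [U, U] [U] (\<lambda>_. 0) (Merge U)"
  unfolding structural_def using Merge_sem[of U] by (simp add: tape_typed.intros numeral_2_eq_2 del: sem.simps)

lemma structural_Swap: "U \<in> obj C \<Longrightarrow> V \<in> obj C \<Longrightarrow> structural [U, V] [V, U] (\<lambda>i. 1 - i) (Swap U V)"
  unfolding structural_def using Swap_sem(2)[of U V]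
  by (simp add: tape_typed.intros numeral_2_eq_2 less_Suc_eq_le del: sem.simps)

lemma structural_idw: "P \<in> words C \<Longrightarrow> structural P P (\<lambda>i. i) (idw P)"
proof (induction P)
  case (Cons U P)
  then show ?case
    by (auto intro!: structural_par'[OF structural_Idt[of U], of P P "\<lambda>i. i"])
qed (simp add: structural_Idt0)

lemma structural_swap1: "U \<in> obj C \<Longrightarrow> Q \<in> words C \<Longrightarrow>
    structural (U # Q) (Q @ [U]) (\<lambda>i. if i = 0 then length Q else i - 1) (swap1 U Q)"
proof (induction Q)
  case Nil
  then show ?case using structural_cong[OF structural_Idt[of U]] by simp
next
  case (Cons V Q)
  then have *: "V \<in> obj C" "Q \<in> words C" and IH:
    "structural (U # Q) (Q @ [U]) (\<lambda>i. if i = 0 then length Q else i - 1) (swap1 U Q)" by auto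
  have 1: "structural (U # V # Q) (V # U # Q) (\<lambda>i. if i < 2 then 1 - i else i) (Swap U V \<oplus> idw Q)"
    using * Cons.prems by (intro structural_par'[OF structural_Swap structural_idw]) auto
  have 2: "structural (V # U # Q) (V # Q @ [U]) (\<lambda>i. if i = 0 then 0 else if i = 1 then Suc (length Q) else i - 1)
      (Idt V \<oplus> swap1 U Q)"
    using * Cons.prems by (intro structural_par'[OF structural_Idt IH]) auto
  show ?case using structural_cong[OF structural_seq[OF 1 2]] by simp
qed

text \<open>The block transposition, exchanging adjacent blocks of lengths \<open>m\<close> and
  \<open>n\<close>.\<close>

definition sw :: "nat \<Rightarrow> nat \<Rightarrow> nat \<Rightarrow> nat" where "sw m n i = (if i < m then n + i else i - m)"

lemma structural_swapw: "P \<in> words C \<Longrightarrow> Q \<in> words C \<Longrightarrow>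
    structural (P @ Q) (Q @ P) (sw (length P) (length Q)) (swapw P Q)"
proof (induction P)
  case Nil
  then show ?case using structural_cong[OF structural_idw[of Q]] by (simp add: sw_def)
next
  case (Cons U P)
  then have *: "U \<in> obj C" "P \<in> words C" and IH:
    "structural (P @ Q) (Q @ P) (sw (length P) (length Q)) (swapw P Q)" by auto
  have 1: "structural (U # P @ Q) (U # Q @ P) (\<lambda>i. if i = 0 then 0 else Suc (sw (length P) (length Q) (i - 1)))
      (Idt U \<oplus> swapw P Q)"
    using * Cons.prems by (intro structural_par'[OF structural_Idt IH]) auto
  have 2: "structural (U # Q @ P) (Q @ U # P) (\<lambda>i. if i = 0 then length Q else if i \<le> length Q then i - 1 else i)
      (swap1 U Q \<oplus> idw P)"
    using * Cons.prems by (intro structural_par'[OF structural_swap1 structural_idw]) auto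
  have "structural (U # P @ Q) (Q @ U # P) (sw (length (U # P)) (length Q)) ((Idt U \<oplus> swapw P Q) \<Zsemi> (swap1 U Q \<oplus> idw P))"
    by (rule structural_cong[OF structural_seq[OF 1 2]]) (auto simp: sw_def)
  then show ?case by simp
qed

text \<open>The codiagonal on positions, folding two blocks of length \<open>m\<close> onto
  one.\<close>

definition fo :: "nat \<Rightarrow> nat \<Rightarrow> nat" where "fo m i = (if i < m then i else i - m)"

text \<open>Position arithmetic of the recursive merge: \<open>i\<close> is a position in the
  doubled word and \<open>j\<close> its place after the inner swap. The merge then sends the two
  leading letters to 0 and folds the rest.\<close>

lemma fo_Suc:
  assumes "i = 0 \<Longrightarrow> j = 0" "0 < i \<Longrightarrow> i < Suc (Suc n) \<Longrightarrow> j = Suc (sw n 1 (i - 1))"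
    "Suc (Suc n) \<le> i \<Longrightarrow> j = i"
  shows "(if j < 2 then 0 else Suc (fo n (j - 2))) = fo (Suc n) i"
proof (cases "i = 0 \<or> Suc (Suc n) \<le> i")
  case True
  then show ?thesis using assms by (auto simp: fo_def)
next
  case False
  then show ?thesis using assms(2) by (cases "i = Suc n") (auto simp: fo_def sw_def)
qed

lemma structural_mergew: "P \<in> words C \<Longrightarrow> structural (P @ P) P (fo (length P)) (mergew P)"
proof (induction P)
  case Nil
  then show ?case by (simp add: structural_Idt0)
next
  case (Cons U P)
  then have *: "U \<in> obj C" "P \<in> words C" and IH: "structural (P @ P) P (fo (length P)) (mergew P)" by auto
  let ?n = "length P"
  have 0: "structural (P @ U # P) (U # P @ P) (\<lambda>i. if i < Suc ?n then sw ?n 1 i else i)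
      (swapw P [U] \<oplus> idw P)"
    using * by (intro structural_par'[OF structural_swapw[of P "[U]"] structural_idw[of P]]) auto
  have 1: "structural (U # P @ U # P) (U # U # P @ P)
      (\<lambda>i. if i = 0 then 0 else if i < Suc (Suc ?n) then Suc (sw ?n 1 (i - 1)) else i)
      (Idt U \<oplus> (swapw P [U] \<oplus> idw P))"
    using * by (intro structural_par'[OF structural_Idt 0]) auto
  have 2: "structural (U # U # P @ P) (U # P) (\<lambda>i. if i < 2 then 0 else Suc (fo ?n (i - 2))) (Merge U \<oplus> mergew P)"
    using * by (intro structural_par'[OF structural_Merge IH]) auto
  have "structural (U # P @ U # P) (U # P) (fo (length (U # P)))
      ((Idt U \<oplus> (swapw P [U] \<oplus> idw P)) \<Zsemi> (Merge U \<oplus> mergew P))"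
    by (rule structural_cong[OF structural_seq[OF 1 2]]) (simp only: length_Cons, rule fo_Suc, simp_all)
  then show ?case by simp
qed

lemma structural_initw: "P \<in> words C \<Longrightarrow> structural [] P \<theta> (initw P)"
  unfolding structural_def by (simp add: typed_initw)

lemma structural_hom:
  assumes "structural P Q \<theta> t"
  shows "sem t \<in> hom D (wob P) (wob Q)" "tape_typed C P Q t" "P \<in> words C" "Q \<in> words C"
    "i < length P \<Longrightarrow> win P i \<bullet> sem t = win Q (\<theta> i)"
  using assms typed_words[of C P Q t] sem_hom unfolding structural_def by blast+

lemma sem_id: "P \<in> words C \<Longrightarrow> sem (idw P) = idn D (wob P)"
  using structural_hom[OF structural_idw[of P]]
  by (rule_tac win_ext[of P _ "wob P"]) (simp_all add: D.idn_hom D.idr_arr)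

lemma lr_structural:
  assumes "structural (P @ Q) R \<theta> t" "P \<in> words C" "Q \<in> words C"
  shows "i < length P \<Longrightarrow> win P i \<bullet> (lft P Q \<bullet> sem t) = win R (\<theta> i)"
    "j < length Q \<Longrightarrow> win Q j \<bullet> (rgt P Q \<bullet> sem t) = win R (\<theta> (length P + j))"
    "lft P Q \<bullet> sem t \<in> hom D (wob P) (wob R)" "rgt P Q \<bullet> sem t \<in> hom D (wob Q) (wob R)"
proof -
  note h = structural_hom[OF assms(1)]
  note [simp] = assms(2,3) h(1)[unfolded hom_iff]
  show "i < length P \<Longrightarrow> win P i \<bullet> (lft P Q \<bullet> sem t) = win R (\<theta> i)"
    using h(5)[of i] by (simp add: D.assoc_arr[symmetric] win_lft)
  show "j < length Q \<Longrightarrow> win Q j \<bullet> (rgt P Q \<bullet> sem t) = win R (\<theta> (length P + j))"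
    using h(5)[of "length P + j"] by (simp add: D.assoc_arr[symmetric] win_rgt)
  show "lft P Q \<bullet> sem t \<in> hom D (wob P) (wob R)" "rgt P Q \<bullet> sem t \<in> hom D (wob Q) (wob R)"
    by (simp_all add: hom_iff D.cmp_arr)
qed

lemma sem_swap:
  assumes "P \<in> words C" "Q \<in> words C"
  shows "lft P Q \<bullet> sem (swapw P Q) = rgt Q P" "rgt P Q \<bullet> sem (swapw P Q) = lft Q P"
proof -
  note s = lr_structural[OF structural_swapw[OF assms] assms]
  show "lft P Q \<bullet> sem (swapw P Q) = rgt Q P"
    by (rule win_ext[OF assms(1) s(3) rgt_hom]) (use assms s(1) in \<open>simp_all add: win_rgt sw_def\<close>)
  show "rgt P Q \<bullet> sem (swapw P Q) = lft Q P"
    by (rule win_ext[OF assms(2) s(4) lft_hom]) (use assms s(2) in \<open>simp_all add: win_lft sw_def\<close>)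
qed

lemma sem_merge:
  assumes "P \<in> words C"
  shows "lft P P \<bullet> sem (mergew P) = idn D (wob P)" "rgt P P \<bullet> sem (mergew P) = idn D (wob P)"
proof -
  note s = lr_structural[OF structural_mergew[OF assms] assms assms]
  have i: "idn D (wob P) \<in> hom D (wob P) (wob P)" using assms by (simp add: D.idn_hom)
  show "lft P P \<bullet> sem (mergew P) = idn D (wob P)"
    by (rule win_ext[OF assms s(3) i]) (use assms s(1) in \<open>simp_all add: D.idr_arr fo_def\<close>)
  show "rgt P P \<bullet> sem (mergew P) = idn D (wob P)"
    by (rule win_ext[OF assms s(4) i]) (use assms s(2) in \<open>simp_all add: D.idr_arr fo_def\<close>)
qed

lemma wob_Nil_initial: "f \<in> hom D (wob []) Z \<Longrightarrow> g \<in> hom D (wob []) Z \<Longrightarrow> f = g"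
  by (rule win_ext[of "[]"]) auto

lemma sem_init: "P \<in> words C \<Longrightarrow> sem (initw P) = star D (wob []) (wob P)"
  by (rule wob_Nil_initial[OF sem_hom[OF typed_initw]]) (simp_all add: D.star_hom)

text \<open>With stars in the hom-sets an initial object is also terminal: its identity is the star,
  and composing with a star yields a star.\<close>

lemma wob_Nil_terminal:
  assumes "f \<in> hom D Z (wob [])" shows "f = star D Z (wob [])"
proof -
  have "idn D (wob []) = star D (wob []) (wob [])"
    by (rule wob_Nil_initial[of _ "wob []"]) (simp_all add: D.idn_hom D.star_hom)
  then show ?thesis using D.cmp_idr[OF assms] D.cmp_star_right[OF _ assms, of "wob []"] by simp
qed

lemma sem_discard: "P \<in> words C \<Longrightarrow> sem (discardw P) = star D (wob P) (wob [])"
  by (rule wob_Nil_terminal) (rule sem_hom[OF typed_discardw])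

lemma plus_arr:
  assumes "p \<in> {0<..<1}" "f \<in> arr D" "g \<in> arr D" "src D f = src D g" "tgt D f = tgt D g"
  shows "plus D p f g \<in> arr D" "src D (plus D p f g) = src D g" "tgt D (plus D p f g) = tgt D g"
  using D.plus_hom[of p f "src D g" "tgt D g" g] assms by (simp_all add: hom_iff)

lemma plus_cmp:
  assumes "p \<in> {0<..<1}" "f \<in> arr D" "g \<in> arr D" "src D f = src D g" "tgt D f = tgt D g"
    and "h \<in> arr D" "src D h = tgt D f"
  shows "plus D p f g \<bullet> h = plus D p (f \<bullet> h) (g \<bullet> h)"
  using D.cmp_plus_left[of p f "src D f" "tgt D f" g h "tgt D h"] assms by (simp add: hom_iff)

lemma cmp_plus:
  assumes "p \<in> {0<..<1}" "f \<in> arr D" "g \<in> arr D" "src D f = src D g" "tgt D f = tgt D g"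
    and "h \<in> arr D" "tgt D h = src D f"
  shows "h \<bullet> plus D p f g = plus D p (h \<bullet> f) (h \<bullet> g)"
  using D.cmp_plus_right[of p h "src D h" "tgt D h" f "tgt D f" g] assms by (simp add: hom_iff)

text \<open>A split is not structural, as it sends a letter to a proper combination of its two
  copies. In the recursion the final rearrangement \<open>Z\<close> is structural, and both copies
  of each letter are followed through it.\<close>

lemma win_split: "P \<in> words C \<Longrightarrow> p \<in> {0<..<1} \<Longrightarrow> i < length P \<Longrightarrow>
    win P i \<bullet> sem (splitw p P) = plus D p (win (P @ P) i) (win (P @ P) (length P + i))"
proof (induction P arbitrary: i)
  case (Cons U P)
  note [simp del] = greaterThanLessThan_iff
  from Cons.prems have U: "U \<in> obj C" and P: "P \<in> words C" and p: "p \<in> {0<..<1}"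
    and w: "[U] \<in> words C" "[U, U] \<in> words C" by auto
  let ?n = "length P"
  define Z where "Z = Idt U \<oplus> (swapw [U] P \<oplus> (idw P :: ('o, 'a) tape))"
  \<comment> \<open>The position map of \<open>Z\<close>: the first copy of \<open>U\<close> stays,
    the second moves behind the first copy of \<open>P\<close>.\<close>
  define \<theta> where "\<theta> i = (if i = 0 then 0 else if i < Suc (Suc ?n) then Suc (sw 1 ?n (i - 1)) else i)" for i
  have 0: "structural (U # P @ P) (P @ U # P) (\<lambda>i. if i < Suc ?n then sw 1 ?n i else i)
      (swapw [U] P \<oplus> idw P)"
    using P w by (intro structural_par'[OF structural_swapw[of "[U]" P] structural_idw[of P]]) auto
  have Zs: "structural (U # U # P @ P) (U # P @ U # P) \<theta> Z"
    unfolding \<theta>_def Z_def using U by (intro structural_par'[OF structural_Idt 0]) auto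
  note z = structural_hom[OF Zs]
  have t: "tape_typed C [U] [U, U] (Split p U)" "tape_typed C P (P @ P) (splitw p P)"
    using U P p by (auto intro: tape_typed.intros typed_splitw)
  have st: "tape_typed C (U # P) (U # U # P @ P) (Split p U \<oplus> splitw p P)"
    using tape_typed.intros(10)[OF t] by simp
  note s = sem_par[OF t, simplified]
  note [simp] = U P p z(1)[unfolded hom_iff] sem_arr[OF st]
    sem_arr[OF t(1)] sem_arr[OF t(2)] D.cmp_arr
  have lr [simp]: "lft [U] P \<in> arr D" "src D (lft [U] P) = wob [U]" "tgt D (lft [U] P) = wob (U # P)"
    "rgt [U] P \<in> arr D" "src D (rgt [U] P) = wob P" "tgt D (rgt [U] P) = wob (U # P)"
    "lft [U, U] (P @ P) \<in> arr D" "src D (lft [U, U] (P @ P)) = wob [U, U]"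
    "tgt D (lft [U, U] (P @ P)) = wob (U # U # P @ P)"
    "rgt [U, U] (P @ P) \<in> arr D" "src D (rgt [U, U] (P @ P)) = wob (P @ P)"
    "tgt D (rgt [U, U] (P @ P)) = wob (U # U # P @ P)"
    using lr_arr[of "[U]" P] lr_arr[of "[U, U]" "P @ P"] by simp_all
  have e: "sem (splitw p (U # P)) = sem (Split p U \<oplus> splitw p P) \<bullet> sem Z" by (simp add: Z_def)
  show ?case
  proof (cases i)
    case 0
    have "win (U # P) 0 \<bullet> sem (splitw p (U # P)) =
        (win [U] 0 \<bullet> lft [U] P) \<bullet> (sem (Split p U \<oplus> splitw p P) \<bullet> sem Z)"
      unfolding e using win_lft[of "[U]" P 0] by simp
    also have "\<dots> = win [U] 0 \<bullet> ((lft [U] P \<bullet> sem (Split p U \<oplus> splitw p P)) \<bullet> sem Z)"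
      by (simp add: D.assoc_arr wob_single del: sem.simps)
    also have "\<dots> = plus D p (win [U, U] 0) (win [U, U] 1) \<bullet> (lft [U, U] (P @ P) \<bullet> sem Z)"
      unfolding s using win_single[OF U] by (simp add: D.assoc_arr D.idl_arr wob_single plus_arr)
    also have "\<dots> = plus D p ((win [U, U] 0 \<bullet> lft [U, U] (P @ P)) \<bullet> sem Z)
        ((win [U, U] 1 \<bullet> lft [U, U] (P @ P)) \<bullet> sem Z)"
      by (subst plus_cmp) (simp_all add: D.assoc_arr)
    finally show ?thesis using 0 win_lft[of "[U, U]" "P @ P" 0] win_lft[of "[U, U]" "P @ P" 1]
        z(5)[of 0] z(5)[of 1] by (simp add: \<theta>_def sw_def)
  next
    case (Suc k)
    then have k: "k < ?n" using Cons.prems by simp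
    have "win (U # P) i \<bullet> sem (splitw p (U # P)) =
        (win P k \<bullet> rgt [U] P) \<bullet> (sem (Split p U \<oplus> splitw p P) \<bullet> sem Z)"
      unfolding e using win_rgt[of "[U]" P k] k Suc by simp
    also have "\<dots> = win P k \<bullet> ((rgt [U] P \<bullet> sem (Split p U \<oplus> splitw p P)) \<bullet> sem Z)"
      using k by (simp add: D.assoc_arr wob_single del: sem.simps)
    also have "\<dots> = (win P k \<bullet> sem (splitw p P)) \<bullet> (rgt [U, U] (P @ P) \<bullet> sem Z)"
      unfolding s using k by (simp add: D.assoc_arr)
    also have "\<dots> = plus D p (win (P @ P) k) (win (P @ P) (?n + k)) \<bullet> (rgt [U, U] (P @ P) \<bullet> sem Z)"
      using Cons.IH[OF P p k] by simp
    also have "\<dots> = plus D p ((win (P @ P) k \<bullet> rgt [U, U] (P @ P)) \<bullet> sem Z)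
        ((win (P @ P) (?n + k) \<bullet> rgt [U, U] (P @ P)) \<bullet> sem Z)"
      using k by (subst plus_cmp) (simp_all add: D.assoc_arr nth_append)
    finally show ?thesis using Suc k win_rgt[of "[U, U]" "P @ P" k] win_rgt[of "[U, U]" "P @ P" "?n + k"]
        z(5)[of "Suc (Suc k)"] z(5)[of "Suc (Suc (?n + k))"] by (simp add: \<theta>_def sw_def)
  qed
qed simp

lemma sem_split:
  assumes P: "P \<in> words C" and p: "p \<in> {0<..<1}"
  shows "sem (splitw p P) = plus D p (lft P P) (rgt P P)"
proof (rule win_ext[OF P])
  note [simp del] = greaterThanLessThan_iff
  show "sem (splitw p P) \<in> hom D (wob P) (wob (P @ P))" using P p by (intro sem_hom typed_splitw)
  show "plus D p (lft P P) (rgt P P) \<in> hom D (wob P) (wob (P @ P))"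
    using P p by (simp add: hom_iff plus_arr)
  show "win P i \<bullet> sem (splitw p P) = win P i \<bullet> plus D p (lft P P) (rgt P P)" if "i < length P" for i
    using that P p by (simp add: win_split cmp_plus win_lft win_rgt)
qed

section \<open>Soundness of the interpretation\<close>

text \<open>Most rules are of three kinds. Between structural tapes it is enough to compare position
  functions; monoidal and naturality rules are tested on the two injections of a concatenation by
  \<open>lr_ext\<close>; rules about splits turn into pca laws and distributivity in
  \<open>D\<close> through \<open>sem_split\<close>.\<close>

theorem sem_sound: "tape_eq C P Q s t \<Longrightarrow> sem s = sem t"
proof (induction rule: tape_eq.induct)
  case (cong_par P Q s s' P' Q' t t')
  have t: "tape_typed C P Q s" "tape_typed C P' Q' t" "tape_typed C P Q s'" "tape_typed C P' Q' t'"
    using C.tape_eq_typed[OF cong_par(1)] C.tape_eq_typed[OF cong_par(2)] by simp_all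
  have w: "P \<in> words C" "P' \<in> words C" using typed_words[OF t(1)] typed_words[OF t(2)] by simp_all
  show ?case
    by (rule lr_ext[OF w sem_hom[OF tape_typed.intros(10)[OF t(1,2)]] sem_hom[OF tape_typed.intros(10)[OF t(3,4)]]])
      (simp_all add: sem_par[OF t(1,2)] sem_par[OF t(3,4)] cong_par(3,4))
next
  case (seq_assoc P Q s R t S u)
  then show ?case using D.cmp_assoc[OF sem_hom sem_hom sem_hom] by simp
next
  case (seq_idl P Q t)
  then show ?case using typed_words[OF seq_idl] D.cmp_idl[OF sem_hom[OF seq_idl]] by (simp add: sem_id)
next
  case (seq_idr P Q t)
  then show ?case using typed_words[OF seq_idr] D.cmp_idr[OF sem_hom[OF seq_idr]] by (simp add: sem_id)
next
  case (par_assoc P Q s P' Q' t P'' Q'' u)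
  have w: "P \<in> words C" "Q \<in> words C" "P' \<in> words C" "Q' \<in> words C" "P'' \<in> words C" "Q'' \<in> words C"
    using typed_words[OF par_assoc(1)] typed_words[OF par_assoc(2)] typed_words[OF par_assoc(3)] by simp_all
  note st = tape_typed.intros(10)[OF par_assoc(1,2)] and tu = tape_typed.intros(10)[OF par_assoc(2,3)]
  note l = tape_typed.intros(10)[OF st par_assoc(3)] and r = tape_typed.intros(10)[OF par_assoc(1) tu]
  note [simp] = w sem_arr[OF par_assoc(1)] sem_arr[OF par_assoc(2)] sem_arr[OF par_assoc(3)]
    sem_arr[OF st] sem_arr[OF tu] sem_arr[OF l] sem_arr[OF r] D.cmp_arr
  note e = sem_par[OF st par_assoc(3)] sem_par[OF par_assoc(1) tu] sem_par[OF par_assoc(1,2)] sem_par[OF par_assoc(2,3)]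
  have l': "sem ((s \<oplus> t) \<oplus> u) \<in> hom D (wob (P @ P' @ P'')) (wob (Q @ Q' @ Q''))"
    and r': "sem (s \<oplus> (t \<oplus> u)) \<in> hom D (wob (P @ P' @ P'')) (wob (Q @ Q' @ Q''))"
    by (simp_all add: hom_iff)
  show ?case
  proof (rule lr_ext[OF _ _ l' r'])
    have "lft P (P' @ P'') \<bullet> sem ((s \<oplus> t) \<oplus> u) = lft P P' \<bullet> (lft (P @ P') P'' \<bullet> sem ((s \<oplus> t) \<oplus> u))"
      by (simp add: lr_assoc(1)[symmetric] D.assoc_arr)
    also have "\<dots> = sem s \<bullet> (lft Q Q' \<bullet> lft (Q @ Q') Q'')"
      by (simp add: e sem_par_assoc[OF par_assoc(1,2)])
    also have "\<dots> = lft P (P' @ P'') \<bullet> sem (s \<oplus> (t \<oplus> u))" by (simp add: e lr_assoc)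
    finally show "lft P (P' @ P'') \<bullet> sem ((s \<oplus> t) \<oplus> u) = lft P (P' @ P'') \<bullet> sem (s \<oplus> (t \<oplus> u))" .
    have m: "rgt P (P' @ P'') \<bullet> sem ((s \<oplus> t) \<oplus> u) = sem (t \<oplus> u) \<bullet> rgt Q (Q' @ Q'')"
    proof (rule lr_ext[OF w(3,5), of _ "wob (Q @ Q' @ Q'')"])
      have "lft P' P'' \<bullet> (rgt P (P' @ P'') \<bullet> sem ((s \<oplus> t) \<oplus> u)) =
          rgt P P' \<bullet> (lft (P @ P') P'' \<bullet> sem ((s \<oplus> t) \<oplus> u))"
        using lr_assoc(2)[of P P' P''] by (simp flip: D.assoc_arr)
      also have "\<dots> = sem t \<bullet> (rgt Q Q' \<bullet> lft (Q @ Q') Q'')"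
        by (simp add: e sem_par_assoc[OF par_assoc(1,2)])
      finally show "lft P' P'' \<bullet> (rgt P (P' @ P'') \<bullet> sem ((s \<oplus> t) \<oplus> u)) =
          lft P' P'' \<bullet> (sem (t \<oplus> u) \<bullet> rgt Q (Q' @ Q''))"
        by (simp add: lr_assoc sem_par_assoc[OF par_assoc(2,3)])
      have "rgt P' P'' \<bullet> (rgt P (P' @ P'') \<bullet> sem ((s \<oplus> t) \<oplus> u)) =
          rgt (P @ P') P'' \<bullet> sem ((s \<oplus> t) \<oplus> u)"
        using lr_assoc(3)[of P P' P''] by (simp flip: D.assoc_arr)
      also have "\<dots> = sem u \<bullet> rgt (Q @ Q') Q''" by (simp add: e)
      finally show "rgt P' P'' \<bullet> (rgt P (P' @ P'') \<bullet> sem ((s \<oplus> t) \<oplus> u)) =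
          rgt P' P'' \<bullet> (sem (t \<oplus> u) \<bullet> rgt Q (Q' @ Q''))"
        by (simp add: lr_assoc(3) sem_par_assoc[OF par_assoc(2,3)])
    qed (simp_all add: hom_iff)
    show "rgt P (P' @ P'') \<bullet> sem ((s \<oplus> t) \<oplus> u) = rgt P (P' @ P'') \<bullet> sem (s \<oplus> (t \<oplus> u))"
      using m by (simp add: e)
  qed simp_all
next
  case (par_idl P Q t)
  have w: "P \<in> words C" "Q \<in> words C" using typed_words[OF par_idl] by auto
  have z: "tape_typed C [] [] Idt0" by (rule tape_typed.intros)
  have "rgt [] P \<bullet> sem (Idt0 \<oplus> t) = sem t \<bullet> rgt [] Q" using sem_par(2)[OF z par_idl] .
  moreover have "sem (Idt0 \<oplus> t) \<in> hom D (wob P) (wob Q)"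
    using sem_hom[OF tape_typed.intros(10)[OF z par_idl]] by simp
  ultimately show ?case using w sem_hom[OF par_idl] by (simp add: rgt_Nil D.idl_arr D.idr_arr hom_iff)
next
  case (par_idr P Q t)
  have w: "P \<in> words C" "Q \<in> words C" using typed_words[OF par_idr] by auto
  have z: "tape_typed C [] [] Idt0" by (rule tape_typed.intros)
  have "lft P [] \<bullet> sem (t \<oplus> Idt0) = sem t \<bullet> lft Q []" using sem_par(1)[OF par_idr z] .
  moreover have "sem (t \<oplus> Idt0) \<in> hom D (wob P) (wob Q)"
    using sem_hom[OF tape_typed.intros(10)[OF par_idr z]] by simp
  ultimately show ?case using w sem_hom[OF par_idr] by (simp add: lft_Nil D.idl_arr D.idr_arr hom_iff)
next
  case (interchange P Q s R t P' Q' s' R' t')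
  have w: "P \<in> words C" "Q \<in> words C" "R \<in> words C" "P' \<in> words C" "Q' \<in> words C" "R' \<in> words C"
    using typed_words[OF interchange(1)] typed_words[OF interchange(2)]
      typed_words[OF interchange(3)] typed_words[OF interchange(4)] by simp_all
  note a = tape_typed.intros(9)[OF interchange(1,2)] and b = tape_typed.intros(9)[OF interchange(3,4)]
  note c = tape_typed.intros(10)[OF interchange(1,3)] and d = tape_typed.intros(10)[OF interchange(2,4)]
  note [simp] = w sem_arr[OF interchange(1)] sem_arr[OF interchange(2)] sem_arr[OF interchange(3)]
    sem_arr[OF interchange(4)] sem_arr[OF c] sem_arr[OF d]
  show ?case
    by (rule lr_ext[OF w(1,4) sem_hom[OF tape_typed.intros(10)[OF a b]] sem_hom[OF tape_typed.intros(9)[OF c d]]])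
      (simp_all add: sem_par[OF a b] sem_par_assoc[OF interchange(1,3)] sem_par[OF interchange(2,4)] D.assoc_arr)
next
  case (par_id P Q)
  note t = typed_idw[OF par_id(1)] typed_idw[OF par_id(2)]
  have "idn D (wob (P @ Q)) \<in> hom D (wob (P @ Q)) (wob (P @ Q))"
    using par_id by (intro D.idn_hom wob_obj) simp
  then have "sem (idw P \<oplus> idw Q) = idn D (wob (P @ Q))"
    using par_id by (rule_tac lr_ext[OF par_id sem_hom[OF tape_typed.intros(10)[OF t]]])
      (simp_all add: sem_par[OF t] sem_id D.idl_arr D.idr_arr)
  then show ?case using par_id by (simp add: sem_id)
next
  case (swap_inverse P Q)
  note t = typed_swapw[OF swap_inverse] typed_swapw[OF swap_inverse(2,1)]
  have i: "idn D (wob (P @ Q)) \<in> hom D (wob (P @ Q)) (wob (P @ Q))"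
    using swap_inverse by (intro D.idn_hom wob_obj) simp
  note [simp] = swap_inverse sem_arr[OF t(1)] sem_arr[OF t(2)]
  have "sem (swapw P Q \<Zsemi> swapw Q P) = idn D (wob (P @ Q))"
  proof (rule lr_ext[OF swap_inverse sem_hom[OF tape_typed.intros(9)[OF t]] i])
    show "lft P Q \<bullet> sem (swapw P Q \<Zsemi> swapw Q P) = lft P Q \<bullet> idn D (wob (P @ Q))"
      by (simp add: sem_swap D.idr_arr flip: D.assoc_arr)
    show "rgt P Q \<bullet> sem (swapw P Q \<Zsemi> swapw Q P) = rgt P Q \<bullet> idn D (wob (P @ Q))"
      by (simp add: sem_swap D.idr_arr flip: D.assoc_arr)
  qed
  then show ?case by (simp add: sem_id)
next
  case (swap_natural P Q s P' Q' t)
  have w: "P \<in> words C" "Q \<in> words C" "P' \<in> words C" "Q' \<in> words C"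
    using typed_words[OF swap_natural(1)] typed_words[OF swap_natural(2)] by simp_all
  note a = tape_typed.intros(9)[OF tape_typed.intros(10)[OF swap_natural] typed_swapw[OF w(2,4)]]
    and b = tape_typed.intros(9)[OF typed_swapw[OF w(1,3)] tape_typed.intros(10)[OF swap_natural(2,1)]]
  note [simp] = w sem_arr[OF typed_swapw[OF w(2,4)]] sem_arr[OF typed_swapw[OF w(1,3)]]
    sem_arr[OF tape_typed.intros(10)[OF swap_natural(2,1)]]
  have e: "lft P P' \<bullet> (sem (swapw P P') \<bullet> sem (t \<oplus> s)) = sem s \<bullet> rgt Q' Q"
    "rgt P P' \<bullet> (sem (swapw P P') \<bullet> sem (t \<oplus> s)) = sem t \<bullet> lft Q' Q"
    by (simp_all add: sem_swap sem_par[OF swap_natural(2,1)] flip: D.assoc_arr)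
  show ?case
    by (rule lr_ext[OF w(1,3) sem_hom[OF a] sem_hom[OF b]])
      (simp_all add: sem_par_assoc[OF swap_natural] sem_swap e)
next
  case (hexagon P Q R)
  note w = hexagon
  have 1: "structural (P @ Q @ R) (R @ P @ Q) (sw (length P + length Q) (length R)) (swapw (P @ Q) R)"
    using structural_swapw[of "P @ Q" R] w by simp
  have 2: "structural (P @ Q @ R) (P @ R @ Q)
      (\<lambda>i. if i < length P then i else length P + sw (length Q) (length R) (i - length P)) (idw P \<oplus> swapw Q R)"
    using w by (intro structural_par'[OF structural_idw structural_swapw]) auto
  have 3: "structural (P @ R @ Q) (R @ P @ Q)
      (\<lambda>i. if i < length P + length R then sw (length P) (length R) i else i) (swapw P R \<oplus> idw Q)"
    using w by (intro structural_par'[OF structural_swapw[of P R] structural_idw[of Q]]) auto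
  show ?case by (rule structural_unique[OF 1 structural_seq[OF 2 3]]) (auto simp: sw_def)
next
  case (swap_gen U V)
  then have w: "[U] \<in> words C" "[V] \<in> words C" by auto
  have "structural [U, V] [V, U] (sw 1 1) (swapw [U] [V])" using structural_swapw[OF w] by simp
  then show ?case by (rule structural_unique[OF _ structural_Swap[OF swap_gen]]) (auto simp: sw_def less_Suc_eq)
next
  case (box_id U)
  then show ?case by (simp add: bx_idn)
next
  case (box_cmp U V W c d)
  then show ?case by (simp add: bx_cmp)
next
  case (merge_assoc P)
  have 1: "structural (P @ P @ P) (P @ P) (\<lambda>i. if i < length P + length P then fo (length P) i else i - length P)
      (mergew P \<oplus> idw P)"
    using merge_assoc by (intro structural_par'[OF structural_mergew[of P] structural_idw[of P]]) auto
  have 2: "structural (P @ P @ P) (P @ P)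
      (\<lambda>i. if i < length P then i else length P + fo (length P) (i - length P)) (idw P \<oplus> mergew P)"
    using merge_assoc by (intro structural_par'[OF structural_idw[of P] structural_mergew[of P]]) auto
  note m = structural_mergew[OF merge_assoc]
  show ?case by (rule structural_unique[OF structural_seq[OF 1 m] structural_seq[OF 2 m]]) (auto simp: fo_def)
next
  case (merge_unit P)
  have 1: "structural P (P @ P) (\<lambda>i. length P + i) (initw P \<oplus> idw P)"
    using merge_unit by (intro structural_par'[OF structural_initw[of P "\<lambda>i. i"] structural_idw[of P]]) auto
  show ?case
    by (rule structural_unique[OF structural_seq[OF 1 structural_mergew[OF merge_unit]] structural_idw[OF merge_unit]])
      (auto simp: fo_def)
next
  case (merge_comm P)
  note m = structural_mergew[OF merge_comm]
  show ?case
    by (rule structural_unique[OF structural_seq[OF structural_swapw[OF merge_comm merge_comm] m] m])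
      (auto simp: fo_def sw_def)
next
  case (init_natural P Q f)
  have w: "P \<in> words C" "Q \<in> words C" using typed_words[OF init_natural] by auto
  show ?case
    by (rule wob_Nil_initial[OF sem_hom[OF tape_typed.intros(9)[OF typed_initw[OF w(1)] init_natural]]
      sem_hom[OF typed_initw[OF w(2)]]])
next
  case (merge_natural P Q f)
  have w: "P \<in> words C" "Q \<in> words C" using typed_words[OF merge_natural] by auto
  note ff = tape_typed.intros(10)[OF merge_natural merge_natural]
  note m = typed_mergew[OF w(1)] typed_mergew[OF w(2)]
  note [simp] = w sem_arr[OF merge_natural] sem_arr[OF m(1)] sem_arr[OF m(2)]
  have e: "lft P P \<bullet> (sem (mergew P) \<bullet> sem f) = sem f" "rgt P P \<bullet> (sem (mergew P) \<bullet> sem f) = sem f"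
    by (simp_all add: sem_merge D.idl_arr flip: D.assoc_arr)
  show ?case
    by (rule lr_ext[OF w(1,1) sem_hom[OF tape_typed.intros(9)[OF m(1) merge_natural]]
        sem_hom[OF tape_typed.intros(9)[OF ff m(2)]]])
      (simp_all add: e sem_par_assoc[OF merge_natural merge_natural] sem_merge D.idr_arr)
next
  case (split_assoc P p q)
  note [simp del] = greaterThanLessThan_iff
  define t where "t = p * (1 - q) / (1 - p * q)"
  have pq: "p * q \<in> {0<..<1}" "t \<in> {0<..<1}"
    using assoc_params[OF split_assoc(2,3)] by (simp_all add: t_def)
  note w = split_assoc(1)
  note q = typed_splitw[OF w split_assoc(3)] and i = typed_idw[OF w] and tt = typed_splitw[OF w pq(2)]
  note qi = tape_typed.intros(10)[OF q i] and it = tape_typed.intros(10)[OF i tt]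
  note [simp] = split_assoc pq sem_arr[OF qi] sem_arr[OF it] plus_arr D.cmp_arr
  have "sem (splitw p P \<Zsemi> (splitw q P \<oplus> idw P)) =
      plus D p (plus D q (lft P P \<bullet> lft (P @ P) P) (rgt P P \<bullet> lft (P @ P) P)) (rgt (P @ P) P)"
    by (simp add: sem_split plus_cmp sem_par[OF q i] sem_id D.idl_arr)
  also have "\<dots> = plus D (p * q) (lft P P \<bullet> lft (P @ P) P)
      (plus D t (rgt P P \<bullet> lft (P @ P) P) (rgt (P @ P) P))"
    unfolding t_def
    by (rule pca_gens.pl_assoc[OF D.pca_gens0[of "wob P" "wob (P @ P @ P)"]])
      (use split_assoc in \<open>simp_all add: hom_iff greaterThanLessThan_iff\<close>)
  also have "\<dots> = sem (splitw (p * q) P \<Zsemi> (idw P \<oplus> splitw t P))"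
    by (simp add: sem_split plus_cmp cmp_plus sem_par[OF i tt] sem_id D.idl_arr lr_assoc)
  finally show ?case by (simp add: t_def)
next
  case (split_merge P p)
  note [simp del] = greaterThanLessThan_iff
  note [simp] = split_merge sem_arr[OF typed_mergew[OF split_merge(1)]]
  have i: "idn D (wob P) \<in> hom D (wob P) (wob P)" by (simp add: D.idn_hom)
  have "plus D p (idn D (wob P)) (idn D (wob P)) = idn D (wob P)"
    by (rule pca_gens.pl_idem[OF D.pca_gens0[of "wob P" "wob P"]])
      (use split_merge(2) i in \<open>simp_all add: greaterThanLessThan_iff\<close>)
  then show ?case by (simp add: sem_split plus_cmp sem_merge sem_id)
next
  case (split_swap P p)
  note [simp del] = greaterThanLessThan_iff
  have q: "1 - p \<in> {0<..<1}" using split_swap(2) by (simp add: greaterThanLessThan_iff)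
  note [simp] = split_swap q sem_arr[OF typed_swapw[OF split_swap(1,1)]]
  have "plus D p (rgt P P) (lft P P) = plus D (1 - p) (lft P P) (rgt P P)"
    by (rule pca_gens.pl_comm[OF D.pca_gens0[of "wob P" "wob (P @ P)"]])
      (use split_swap(2) in \<open>simp_all add: greaterThanLessThan_iff lft_hom rgt_hom\<close>)
  then show ?case by (simp add: sem_split plus_cmp sem_swap)
next
  case (discard_natural P Q f)
  have w: "P \<in> words C" "Q \<in> words C" using typed_words[OF discard_natural] by auto
  show ?case using w D.cmp_star_right[OF _ sem_hom[OF discard_natural]] by (simp add: sem_discard)
next
  case (split_natural P Q f p)
  note [simp del] = greaterThanLessThan_iff
  have w: "P \<in> words C" "Q \<in> words C" using typed_words[OF split_natural(1)] by auto
  note [simp] = w split_natural sem_arr[OF split_natural(1)]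
    sem_arr[OF tape_typed.intros(10)[OF split_natural(1,1)]]
  show ?case by (simp add: sem_split plus_cmp cmp_plus sem_par[OF split_natural(1,1)])
qed auto

end

context tape_theory
begin

text \<open>The sum computed on representatives, the form in which both the interpretation and the
  relabelling of tapes can evaluate it.\<close>

lemma plus_cls:
  assumes s: "tape_typed C P Q s" and t: "tape_typed C P Q t" and p: "p \<in> {0<..<1}"
  shows "tape_plus C p (cls P Q s) (cls P Q t) = cls P Q ((splitw p P \<Zsemi> (s \<oplus> t)) \<Zsemi> mergew Q)"
proof -
  have w: "P \<in> words C" "Q \<in> words C" using typed_words[OF s] by simp_all
  note sp = typed_splitw[OF w(1) p] and m = typed_mergew[OF w(2)] and st = tape_typed.intros(10)[OF s t]
  show ?thesis
    unfolding tape_plus_def Let_def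
    using par_cls[OF s t] seq_cls[OF sp st] seq_cls[OF tape_typed.intros(9)[OF sp st] m]
    by (simp add: tape_class_def)
qed

end

section \<open>The functor induced by an interpretation\<close>

context tape_interp
begin

sublocale t: tape_theory C ..

text \<open>Some representative of the class is interpreted; \<open>sem_sound\<close> makes the
  choice immaterial.\<close>

definition semF :: "('o list, ('o, 'a) tape_arr, 'p, 'b) ftor" where
  "semF = \<lparr>fob = (\<lambda>P\<in>words C. wob P), far = (\<lambda>f\<in>arr (tape_cat C). sem (SOME t. t \<in> fst (snd f)))\<rparr>"

lemma semF_fob: "P \<in> words C \<Longrightarrow> fob semF P = wob P"
  by (simp add: semF_def)

lemma semF_cls:
  assumes "tape_typed C P Q t"
  shows "far semF (tape_class C P Q t) = sem t"
proof -
  have "tape_class C P Q t \<in> arr (tape_cat C)" using assms by (auto simp: tape_cat_def)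
  moreover have "tape_eq C P Q t (SOME s. s \<in> fst (snd (tape_class C P Q t)))"
    using assms tape_eq.refl unfolding tape_class_def by (simp add: someI_ex[of "tape_eq C P Q t"]) (rule someI, rule tape_eq.refl)
  ultimately show ?thesis using sem_sound by (simp add: semF_def)
qed

lemma semF_hom: "f \<in> hom (tape_cat C) P Q \<Longrightarrow> far semF f \<in> hom D (wob P) (wob Q)"
  using t.hom_cls[of f P Q] semF_cls sem_hom by auto

lemma semF_seq:
  "f \<in> hom (tape_cat C) P Q \<Longrightarrow> g \<in> hom (tape_cat C) Q R \<Longrightarrow> far semF (tape_seq C f g) = far semF f \<bullet> far semF g"
  using t.hom_cls[of f P Q] t.hom_cls[of g Q R]
  by (auto simp: t.seq_cls semF_cls tape_typed.intros(9))

lemma semF_functor: "cat_functor (tape_cat C) D semF"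
proof
  show "fob semF \<in> obj t.T \<rightarrow>\<^sub>E obj D" by (auto simp: semF_def)
  show "far semF \<in> arr t.T \<rightarrow>\<^sub>E arr D"
  proof (rule PiE_I)
    show "far semF f \<in> arr D" if "f \<in> arr t.T" for f
      using semF_hom[of f "src t.T f" "tgt t.T f"] that by (simp add: hom_iff)
  qed (simp add: semF_def)
  show "far semF f \<in> hom D (fob semF P) (fob semF Q)" if "f \<in> hom t.T P Q" for f P Q
    using semF_hom[OF that] t.TC.hom_objD[OF that] by (simp add: semF_fob)
  show "far semF (idn t.T P) = idn D (fob semF P)" if "P \<in> obj t.T" for P
    using that by (simp add: t.aI_def semF_cls typed_idw sem_id semF_fob)
  show "far semF (cmp t.T f g) = far semF f \<bullet> far semF g"
    if "f \<in> hom t.T P Q" "g \<in> hom t.T Q R" for f g P Q R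
    using semF_seq[OF that] by simp
qed

lemma semF_star: "P \<in> words C \<Longrightarrow> Q \<in> words C \<Longrightarrow> far semF (star t.T P Q) = star D (wob P) (wob Q)"
  using D.cmp_star_left[of "wob P" "star D (wob []) (wob Q)" "wob []" "wob Q"]
  by (simp add: tape_cat_def semF_cls tape_typed.intros(9)[OF typed_discardw typed_initw] sem_discard sem_init D.star_hom)

lemma semF_plus:
  assumes p: "p \<in> {0<..<1}" and f: "f \<in> hom t.T P Q" and g: "g \<in> hom t.T P Q"
  shows "far semF (tape_plus C p f g) = plus D p (far semF f) (far semF g)"
proof -
  note [simp del] = greaterThanLessThan_iff
  obtain s t where s: "tape_typed C P Q s" "f = tape_class C P Q s" and t: "tape_typed C P Q t" "g = tape_class C P Q t"
    using f g t.hom_cls by auto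
  have w: "P \<in> words C" "Q \<in> words C" using typed_words[OF s(1)] by simp_all
  note sp = typed_splitw[OF w(1) p] and m = typed_mergew[OF w(2)]
  note st = tape_typed.intros(10)[OF s(1) t(1)]
  note [simp] = w p sem_arr[OF s(1)] sem_arr[OF t(1)] sem_arr[OF st] sem_arr[OF m] D.cmp_arr plus_arr
  have "far semF (tape_plus C p f g) = (plus D p (lft P P) (rgt P P) \<bullet> sem (s \<oplus> t)) \<bullet> sem (mergew Q)"
    by (simp add: s t t.plus_cls[OF s(1) t(1) p] sem_split
      semF_cls[OF tape_typed.intros(9)[OF tape_typed.intros(9)[OF sp st] m]])
  also have "\<dots> = plus D p (sem s) (sem t)"
    by (simp add: plus_cmp sem_par[OF s(1) t(1)] D.assoc_arr sem_merge D.idr_arr)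
  finally show ?thesis by (simp add: s t semF_cls)
qed

lemma semF_inj:
  assumes "P \<in> words C" "Q \<in> words C"
  shows "far semF (inj1 t.T P Q) = lft P Q" "far semF (inj2 t.T P Q) = rgt P Q"
proof -
  note i = typed_idw[OF assms(1)] typed_idw[OF assms(2)] and n = typed_initw[OF assms(1)] typed_initw[OF assms(2)]
  note [simp] = assms
  have "lft P Q = sem (idw P \<oplus> initw Q)"
    using sem_par(1)[OF i(1) n(2)] sem_arr[OF tape_typed.intros(10)[OF i(1) n(2)]]
    by (simp add: lft_Nil sem_id D.idl_arr)
  then show "far semF (inj1 t.T P Q) = lft P Q"
    using tape_typed.intros(10)[OF i(1) n(2)] by (simp add: tape_cat_def semF_cls)
  have "rgt P Q = sem (initw P \<oplus> idw Q)"
    using sem_par(2)[OF n(1) i(2)] sem_arr[OF tape_typed.intros(10)[OF n(1) i(2)]]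
    by (simp add: rgt_Nil sem_id D.idl_arr)
  then show "far semF (inj2 t.T P Q) = rgt P Q"
    using tape_typed.intros(10)[OF n(1) i(2)] by (simp add: tape_cat_def semF_cls)
qed

lemma semF_box: "c \<in> hom C U V \<Longrightarrow> far semF (t.box c) = bx c"
  using C.hom_objD[of c U V] tape_typed.intros(8)[of c C U V]
  by (auto simp: t.box_def hom_iff semF_cls)

lemma semF_tinj: "P \<in> words C \<Longrightarrow> i < length P \<Longrightarrow> far semF (t.tinj P i) = win P i"
proof (induction P arbitrary: i)
  case (Cons U P)
  then have U: "[U] \<in> words C" "P \<in> words C" by auto
  note inj = t.inj_hom[OF U]
  show ?case
  proof (cases i)
    case 0
    have "t.tinj (U # P) 0 = inj1 t.T [U] P"
      using t.tinj_inj1[OF U, of 0] t.idl[of "inj1 t.T [U] P" "[U]"] U by (simp add: t.tinj_single)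
    moreover have "lft [U] P = win (U # P) 0"
      using win_lft[OF U, of 0] U lr_arr[OF U] by (simp add: win_single D.idl_arr wob_single)
    ultimately show ?thesis using 0 semF_inj[OF U] by simp
  next
    case (Suc k)
    then have k: "k < length P" using Cons by simp
    then show ?thesis
      using Suc t.tinj_inj2[OF U k] semF_seq[OF t.tinj_hom[OF U(2) k] inj(2)] Cons.IH[OF U(2) k]
        semF_inj[OF U] win_rgt[OF U k] by simp
  qed
qed simp

end

section \<open>A linear model\<close>

text \<open>A box \<open>c : U \<rightarrow> V\<close> acts on real functions on the arrows out of \<open>U\<close> by
  \<open>\<phi> \<mapsto> (\<lambda>d. \<phi> (c ;; d))\<close>. Evaluating at identities recovers the weights of a convex combination of
  boxes, so these weights are invariants of arrows of the tape category.\<close>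

context category
begin

text \<open>Vectors are total functions forced to 0 off the index set, so equality of functions is
  equality of vectors. Supports may be infinite, as a letter may have infinitely many arrows out of
  it; sums range over positions only.\<close>

definition vec :: "'o list \<Rightarrow> (nat \<times> 'a \<Rightarrow> real) set" where
  "vec P = {\<phi>. \<forall>i d. \<not> (i < length P \<and> d \<in> arr C \<and> src C d = P ! i) \<longrightarrow> \<phi> (i, d) = 0}"

definition lin :: "'o list \<Rightarrow> 'o list \<Rightarrow> ((nat \<times> 'a \<Rightarrow> real) \<Rightarrow> (nat \<times> 'a \<Rightarrow> real)) \<Rightarrow> bool" where
  "lin P Q f \<longleftrightarrow> f \<in> vec P \<rightarrow>\<^sub>E vec Q \<and>
    (\<forall>\<phi>\<in>vec P. \<forall>\<psi>\<in>vec P. \<forall>a b. f (\<lambda>x. a * \<phi> x + b * \<psi> x) = (\<lambda>x. a * f \<phi> x + b * f \<psi> x))"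

text \<open>The words are stored with the map, which alone does not determine them. Maps are
  extensional on \<open>vec P\<close>, so that equality of triples is equality of linear
  maps.\<close>

definition lin_cat :: "('o list, 'o list \<times> ((nat \<times> 'a \<Rightarrow> real) \<Rightarrow> (nat \<times> 'a \<Rightarrow> real)) \<times> 'o list) pcacat" where
  "lin_cat = \<lparr>obj = UNIV, arr = {(P, f, Q). lin P Q f}, src = fst, tgt = (\<lambda>f. snd (snd f)),
    idn = (\<lambda>P. (P, \<lambda>\<phi>\<in>vec P. \<phi>, P)),
    cmp = (\<lambda>(P, f, _) (_, g, Q). (P, \<lambda>\<phi>\<in>vec P. g (f \<phi>), Q)),
    plus = (\<lambda>p (P, f, Q) (_, g, _). (P, \<lambda>\<phi>\<in>vec P. \<lambda>x. p * f \<phi> x + (1 - p) * g \<phi> x, Q)),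
    star = (\<lambda>P Q. (P, \<lambda>\<phi>\<in>vec P. \<lambda>_. 0, Q))\<rparr>"

lemma vec_comb: "\<phi> \<in> vec P \<Longrightarrow> \<psi> \<in> vec P \<Longrightarrow> (\<lambda>x. a * \<phi> x + b * \<psi> x) \<in> vec P"
  and vec_zero: "(\<lambda>_. 0) \<in> vec P"
  and vec_sum: "(\<And>i. i \<in> I \<Longrightarrow> \<Phi> i \<in> vec P) \<Longrightarrow> (\<lambda>x. \<Sum>i\<in>I. \<Phi> i x) \<in> vec P"
  by (simp_all add: vec_def)

lemma lin_vec: "lin P Q f \<Longrightarrow> \<phi> \<in> vec P \<Longrightarrow> f \<phi> \<in> vec Q"
  unfolding lin_def by auto

lemma lin_comb: "lin P Q f \<Longrightarrow> \<phi> \<in> vec P \<Longrightarrow> \<psi> \<in> vec P \<Longrightarrow>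
    f (\<lambda>x. a * \<phi> x + b * \<psi> x) = (\<lambda>x. a * f \<phi> x + b * f \<psi> x)"
  unfolding lin_def by blast

lemma linI:
  assumes "\<And>\<phi>. \<phi> \<in> vec P \<Longrightarrow> f \<phi> \<in> vec Q"
    "\<And>\<phi> \<psi> a b. \<phi> \<in> vec P \<Longrightarrow> \<psi> \<in> vec P \<Longrightarrow> f (\<lambda>x. a * \<phi> x + b * \<psi> x) = (\<lambda>x. a * f \<phi> x + b * f \<psi> x)"
  shows "lin P Q (\<lambda>\<phi>\<in>vec P. f \<phi>)"
  using assms unfolding lin_def by (auto simp: vec_comb)

lemma lin_restrict: "lin P Q f \<Longrightarrow> (\<lambda>\<phi>\<in>vec P. f \<phi>) = f"
  unfolding lin_def by (auto intro: PiE_restrict)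

lemma lin_zero: "lin P Q f \<Longrightarrow> f (\<lambda>_. 0) = (\<lambda>_. 0)"
  using lin_comb[of P Q f "\<lambda>_. 0" "\<lambda>_. 0" 0 0] vec_zero by simp

lemma lin_sum:
  assumes f: "lin P Q f" and "finite I" and "\<And>i. i \<in> I \<Longrightarrow> \<Phi> i \<in> vec P"
  shows "f (\<lambda>x. \<Sum>i\<in>I. \<Phi> i x) = (\<lambda>x. \<Sum>i\<in>I. f (\<Phi> i) x)"
  using assms(2,3)
proof (induction I)
  case empty
  then show ?case using lin_zero[OF f] by simp
next
  case (insert i I)
  then show ?case
    using lin_comb[OF f, of "\<Phi> i" "\<lambda>x. \<Sum>i\<in>I. \<Phi> i x" 1 1] by (simp add: vec_sum)
qed

lemma lin_cat_hom: "h \<in> hom lin_cat P Q \<longleftrightarrow> (\<exists>f. lin P Q f \<and> h = (P, f, Q))"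
  by (auto simp: hom_def lin_cat_def)

lemma lin_cat_simps [simp]: "obj lin_cat = UNIV" "idn lin_cat P = (P, \<lambda>\<phi>\<in>vec P. \<phi>, P)"
  "cmp lin_cat (P, f, Q) (Q', g, R) = (P, \<lambda>\<phi>\<in>vec P. g (f \<phi>), R)"
  "plus lin_cat p (P, f, Q) (P', g, Q') = (P, \<lambda>\<phi>\<in>vec P. \<lambda>x. p * f \<phi> x + (1 - p) * g \<phi> x, Q)"
  "star lin_cat P Q = (P, \<lambda>\<phi>\<in>vec P. \<lambda>_. 0, Q)"
  by (simp_all add: lin_cat_def)

lemma lin_cmp: "lin P Q f \<Longrightarrow> lin Q R g \<Longrightarrow> lin P R (\<lambda>\<phi>\<in>vec P. g (f \<phi>))"
  by (rule linI) (simp_all add: lin_vec lin_comb)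

lemma lin_plus: "lin P Q f \<Longrightarrow> lin P Q g \<Longrightarrow> lin P Q (\<lambda>\<phi>\<in>vec P. \<lambda>x. p * f \<phi> x + (1 - p) * g \<phi> x)"
  by (rule linI) (simp add: lin_vec vec_comb, simp add: lin_comb algebra_simps)

lemma lin_star: "lin P Q (\<lambda>\<phi>\<in>vec P. \<lambda>_. 0)"
  by (rule linI) (simp_all add: vec_zero)

lemma lin_pca_category: "pca_category lin_cat"
proof
  fix P Q R S
  show "idn lin_cat P \<in> hom lin_cat P P" by (auto simp: lin_cat_hom intro!: linI)
  show "cmp lin_cat f g \<in> hom lin_cat P R" if "f \<in> hom lin_cat P Q" "g \<in> hom lin_cat Q R" for f g
    using that by (auto simp: lin_cat_hom intro!: lin_cmp)
  show "cmp lin_cat (idn lin_cat P) f = f" if "f \<in> hom lin_cat P Q" for f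
    using that by (auto simp: lin_cat_hom lin_restrict cong: restrict_cong)
  show "cmp lin_cat f (idn lin_cat Q) = f" if "f \<in> hom lin_cat P Q" for f
    using that by (auto simp: lin_cat_hom lin_restrict lin_vec cong: restrict_cong)
  show "cmp lin_cat (cmp lin_cat f g) h = cmp lin_cat f (cmp lin_cat g h)"
    if "f \<in> hom lin_cat P Q" "g \<in> hom lin_cat Q R" "h \<in> hom lin_cat R S" for f g h
    using that by (auto simp: lin_cat_hom lin_vec cong: restrict_cong)
  show "cmp lin_cat (plus lin_cat p f g) h = plus lin_cat p (cmp lin_cat f h) (cmp lin_cat g h)"
    if "f \<in> hom lin_cat P Q" "g \<in> hom lin_cat P Q" "h \<in> hom lin_cat Q R" for p f g h
    using that by (auto simp: lin_cat_hom lin_vec lin_comb cong: restrict_cong)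
  show "cmp lin_cat h (plus lin_cat p f g) = plus lin_cat p (cmp lin_cat h f) (cmp lin_cat h g)"
    if "h \<in> hom lin_cat P Q" "f \<in> hom lin_cat Q R" "g \<in> hom lin_cat Q R" for p f g h
    using that by (auto simp: lin_cat_hom lin_vec cong: restrict_cong)
  show "cmp lin_cat (star lin_cat P Q) h = star lin_cat P R" if "h \<in> hom lin_cat Q R" for h
    using that by (auto simp: lin_cat_hom lin_zero cong: restrict_cong)
  show "cmp lin_cat h (star lin_cat Q R) = star lin_cat P R" if "h \<in> hom lin_cat P Q" for h
    using that by (auto simp: lin_cat_hom lin_vec cong: restrict_cong)
  show "pca (hom lin_cat P Q) (plus lin_cat) (star lin_cat P Q)"
    unfolding pca_def
  proof (intro conjI ballI)
    show "star lin_cat P Q \<in> hom lin_cat P Q" by (simp add: lin_cat_hom lin_star)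
    fix p :: real assume p: "p \<in> {0<..<1}"
    fix x y assume x: "x \<in> hom lin_cat P Q" and y: "y \<in> hom lin_cat P Q"
    obtain f g where f: "lin P Q f" "x = (P, f, Q)" and g: "lin P Q g" "y = (P, g, Q)"
      using x y by (auto simp: lin_cat_hom)
    show "plus lin_cat p x y \<in> hom lin_cat P Q" using lin_plus[OF f(1) g(1)] by (simp add: f g lin_cat_hom)
    show "plus lin_cat p x y = plus lin_cat (1 - p) y x" by (simp add: f g add.commute)
    fix z q assume z: "z \<in> hom lin_cat P Q" and q: "q \<in> {0<..<1::real}"
    have pq: "1 - p * q \<noteq> 0" using assoc_params(1)[OF p q] by auto
    \<comment> \<open>The scalar identity behind associativity, proved by multiplying the inner
      parameter by \<open>1 - p * q\<close>.\<close>
    have e: "p * (q * a + (1 - q) * b) + (1 - p) * c = p * q * a +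
        (1 - p * q) * (p * (1 - q) / (1 - p * q) * b + (1 - p * (1 - q) / (1 - p * q)) * c)" for a b c
    proof -
      have t: "(1 - p * q) * (p * (1 - q) / (1 - p * q)) = p * (1 - q)"
        unfolding times_divide_eq_right using pq by (rule nonzero_mult_div_cancel_left)
      then have "(1 - p * q) * (1 - p * (1 - q) / (1 - p * q)) = (1 - p * q) - p * (1 - q)"
        by (simp only: right_diff_distrib[of "1 - p * q"] mult_1_right)
      note t this
      then have "(1 - p * q) * (p * (1 - q) / (1 - p * q) * b + (1 - p * (1 - q) / (1 - p * q)) * c) =
          p * (1 - q) * b + ((1 - p * q) - p * (1 - q)) * c"
        by (simp only: distrib_left mult.assoc[symmetric])
      then show ?thesis by (simp add: algebra_simps)
    qed
    show "plus lin_cat p (plus lin_cat q x y) z =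
        plus lin_cat (p * q) x (plus lin_cat (p * (1 - q) / (1 - p * q)) y z)"
      using z by (auto simp: f g lin_cat_hom e intro!: restrict_ext)
  next
    fix p :: real and x assume "x \<in> hom lin_cat P Q"
    then show "plus lin_cat p x x = x"
      by (auto simp: lin_cat_hom algebra_simps lin_restrict)
  qed
qed (auto simp: lin_cat_def)

definition lin_win :: "'o list \<Rightarrow> nat \<Rightarrow> (nat \<times> 'a \<Rightarrow> real) \<Rightarrow> nat \<times> 'a \<Rightarrow> real" where
  "lin_win P i = (\<lambda>\<phi>\<in>vec [P ! i]. \<lambda>(j, d). if j = i then \<phi> (0, d) else 0)"

definition lin_box :: "'a \<Rightarrow> (nat \<times> 'a \<Rightarrow> real) \<Rightarrow> nat \<times> 'a \<Rightarrow> real" where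
  "lin_box c = (\<lambda>\<phi>\<in>vec [src C c]. \<lambda>(j, d).
    if j = 0 \<and> d \<in> arr C \<and> src C d = tgt C c then \<phi> (0, c ;; d) else 0)"

text \<open>The component at position \<open>i\<close>, moved to position 0 so that it lies in the
  space of a one-letter word.\<close>

definition lin_comp :: "nat \<Rightarrow> (nat \<times> 'a \<Rightarrow> real) \<Rightarrow> nat \<times> 'a \<Rightarrow> real" where
  "lin_comp i \<phi> = (\<lambda>(j, d). if j = 0 then \<phi> (i, d) else 0)"

lemma lin_lin_win: "i < length P \<Longrightarrow> lin [P ! i] P (lin_win P i)"
  unfolding lin_win_def by (rule linI) (auto simp: vec_def)

lemma lin_lin_box: "c \<in> hom C U V \<Longrightarrow> lin [U] [V] (lin_box c)"
  unfolding lin_box_def by (simp only: hom_iff, elim conjE, hypsubst) (rule linI, auto simp: vec_def)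

lemma lin_comp_vec: "\<phi> \<in> vec P \<Longrightarrow> i < length P \<Longrightarrow> lin_comp i \<phi> \<in> vec [P ! i]"
  by (auto simp: vec_def lin_comp_def)

lemma lin_comp_win: "\<phi> \<in> vec [P ! i] \<Longrightarrow> lin_comp k (lin_win P i \<phi>) = (if k = i then \<phi> else (\<lambda>_. 0))"
  by (auto simp: vec_def lin_comp_def lin_win_def fun_eq_iff)

lemma vec_decomp:
  assumes "\<phi> \<in> vec P"
  shows "\<phi> = (\<lambda>x. \<Sum>i<length P. lin_win P i (lin_comp i \<phi>) x)"
proof
  fix x :: "nat \<times> 'a"
  obtain j d where x: "x = (j, d)" by force
  have "(\<Sum>i<length P. lin_win P i (lin_comp i \<phi>) x) = (\<Sum>i<length P. if i = j then \<phi> (i, d) else 0)"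
    using lin_comp_vec[OF assms] by (intro sum.cong) (auto simp: lin_win_def lin_comp_def x)
  also have "\<dots> = \<phi> x" using assms by (auto simp: vec_def x)
  finally show "\<phi> x = (\<Sum>i<length P. lin_win P i (lin_comp i \<phi>) x)" by simp
qed

text \<open>Finite direct sums of vector spaces. By \<open>vec_decomp\<close> a linear map is
  determined by its values on the summands, and adding up given maps on the components provides
  one.\<close>

lemma lin_ncop: "is_ncop lin_cat (map (\<lambda>U. [U]) P) P (\<lambda>i. ([P ! i], lin_win P i, P))"
  unfolding is_ncop_def
proof (intro conjI ballI allI impI)
  show "([P ! i], lin_win P i, P) \<in> hom lin_cat (map (\<lambda>U. [U]) P ! i) P" if "i < length (map (\<lambda>U. [U]) P)" for i
    using that lin_lin_win by (simp add: lin_cat_hom)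
  fix Z g assume "\<forall>i<length (map (\<lambda>U. [U]) P). g i \<in> hom lin_cat (map (\<lambda>U. [U]) P ! i) Z"
  then have "\<forall>i<length P. \<exists>f. lin [P ! i] Z f \<and> g i = ([P ! i], f, Z)" by (simp add: lin_cat_hom)
  then obtain G where G: "\<And>i. i < length P \<Longrightarrow> lin [P ! i] Z (G i)"
    "\<And>i. i < length P \<Longrightarrow> g i = ([P ! i], G i, Z)" by metis
  define h where "h = (\<lambda>\<phi>\<in>vec P. \<lambda>x. \<Sum>i<length P. G i (lin_comp i \<phi>) x)"
  have h: "lin P Z h"
    unfolding h_def
  proof (rule linI)
    fix \<phi> \<psi> a b assume v: "\<phi> \<in> vec P" "\<psi> \<in> vec P"
    have "G i (lin_comp i (\<lambda>x. a * \<phi> x + b * \<psi> x)) = (\<lambda>x. a * G i (lin_comp i \<phi>) x + b * G i (lin_comp i \<psi>) x)"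
      if "i < length P" for i
    proof -
      have "lin_comp i (\<lambda>x. a * \<phi> x + b * \<psi> x) = (\<lambda>x. a * lin_comp i \<phi> x + b * lin_comp i \<psi> x)"
        by (auto simp: lin_comp_def)
      then show ?thesis using lin_comb[OF G(1)[OF that]] lin_comp_vec v that by simp
    qed
    then show "(\<lambda>x. \<Sum>i<length P. G i (lin_comp i (\<lambda>x. a * \<phi> x + b * \<psi> x)) x) =
        (\<lambda>x. a * (\<Sum>i<length P. G i (lin_comp i \<phi>) x) + b * (\<Sum>i<length P. G i (lin_comp i \<psi>) x))"
      by (simp add: sum.distrib sum_distrib_left)
  next
    show "(\<lambda>x. \<Sum>i<length P. G i (lin_comp i \<phi>) x) \<in> vec Z" if "\<phi> \<in> vec P" for \<phi>
      using lin_vec[OF G(1) lin_comp_vec[OF that]] by (intro vec_sum) simp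
  qed
  show "\<exists>!k. k \<in> hom lin_cat P Z \<and>
      (\<forall>i<length (map (\<lambda>U. [U]) P). cmp lin_cat ([P ! i], lin_win P i, P) k = g i)"
  proof (intro ex1I[of _ "(P, h, Z)"] conjI allI impI)
    show "(P, h, Z) \<in> hom lin_cat P Z" using h by (simp add: lin_cat_hom)
    fix i assume "i < length (map (\<lambda>U. [U]) P)"
    then have i: "i < length P" by simp
    have "h (lin_win P i \<phi>) = G i \<phi>" if "\<phi> \<in> vec [P ! i]" for \<phi>
    proof -
      have "h (lin_win P i \<phi>) = (\<lambda>x. \<Sum>k<length P. G k (if k = i then \<phi> else (\<lambda>_. 0)) x)"
        using lin_vec[OF lin_lin_win[OF i] that] by (simp add: h_def lin_comp_win[OF that])
      also have "\<dots> = (\<lambda>x. \<Sum>k<length P. if k = i then G k \<phi> x else 0)"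
        using lin_zero[OF G(1)] by (intro ext sum.cong) auto
      finally show ?thesis using i by simp
    qed
    then show "cmp lin_cat ([P ! i], lin_win P i, P) (P, h, Z) = g i"
      using G(2)[OF i] lin_restrict[OF G(1)[OF i]] by (simp cong: restrict_cong)
  next
    fix k assume "k \<in> hom lin_cat P Z \<and>
      (\<forall>i<length (map (\<lambda>U. [U]) P). cmp lin_cat ([P ! i], lin_win P i, P) k = g i)"
    then obtain K where K: "lin P Z K" "k = (P, K, Z)"
      and e: "\<And>i. i < length P \<Longrightarrow> (\<lambda>\<phi>\<in>vec [P ! i]. K (lin_win P i \<phi>)) = G i"
      using G(2) by (auto simp: lin_cat_hom)
    have "K \<phi> = h \<phi>" if v: "\<phi> \<in> vec P" for \<phi>
    proof -
      have "K \<phi> = K (\<lambda>x. \<Sum>i<length P. lin_win P i (lin_comp i \<phi>) x)" using vec_decomp[OF v] by simp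
      also have "\<dots> = (\<lambda>x. \<Sum>i<length P. K (lin_win P i (lin_comp i \<phi>)) x)"
        by (rule lin_sum[OF K(1)]) (auto intro!: lin_vec[OF lin_lin_win] lin_comp_vec[OF v])
      also have "\<dots> = (\<lambda>x. \<Sum>i<length P. G i (lin_comp i \<phi>) x)"
        using lin_comp_vec[OF v] by (intro ext sum.cong) (simp_all flip: e)
      finally show ?thesis using v by (simp add: h_def)
    qed
    then have "K = h" using lin_restrict[OF K(1)] lin_restrict[OF h] by (metis restrict_ext)
    then show "k = (P, h, Z)" using K by simp
  qed
qed simp_all

lemma lin_interp:
  "tape_interp C lin_cat (\<lambda>U. [U]) (\<lambda>P. P) (\<lambda>P i. ([P ! i], lin_win P i, P))
    (\<lambda>c. ([src C c], lin_box c, [tgt C c]))"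
proof -
  interpret M: pca_category lin_cat by (rule lin_pca_category)
  show ?thesis
  proof
    show "is_ncop lin_cat (map (\<lambda>U. [U]) P) P (\<lambda>i. ([P ! i], lin_win P i, P))" for P
      by (rule lin_ncop)
    show "([[U] ! 0], lin_win [U] 0, [U]) = idn lin_cat [U]" for U
      by (auto simp: lin_win_def vec_def fun_eq_iff intro!: restrict_ext)
    show "([src C c], lin_box c, [tgt C c]) \<in> hom lin_cat [U] [V]" if "c \<in> hom C U V" for c U V
      using that[unfolded hom_iff] lin_lin_box[OF that] by (simp add: lin_cat_hom)
    show "([src C (idn C U)], lin_box (idn C U), [tgt C (idn C U)]) = idn lin_cat [U]" if "U \<in> obj C" for U
      using that by (auto simp: lin_box_def idn_arr idl_arr vec_def fun_eq_iff intro!: restrict_ext)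
        (metis neq0_conv nth_Cons_0)
    show "([src C (c ;; d)], lin_box (c ;; d), [tgt C (c ;; d)]) =
        cmp lin_cat ([src C c], lin_box c, [tgt C c]) ([src C d], lin_box d, [tgt C d])"
      if "c \<in> hom C U V" "d \<in> hom C V W" for c d U V W
    proof -
      have cd: "c \<in> arr C" "d \<in> arr C" "tgt C c = src C d" using that by (auto simp: hom_iff)
      have "lin_box (c ;; d) \<phi> = lin_box d (lin_box c \<phi>)" if v: "\<phi> \<in> vec [src C c]" for \<phi>
      proof -
        have "lin_box c \<phi> \<in> vec [src C d]"
          using lin_vec[OF lin_lin_box[of c "src C c" "src C d"] v] cd by (simp add: hom_iff)
        then show ?thesis using v cd by (auto simp: lin_box_def cmp_arr assoc_arr fun_eq_iff)
      qed
      moreover have "lin_box (c ;; d) = (\<lambda>\<phi>\<in>vec [src C c]. lin_box (c ;; d) \<phi>)"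
        using cd by (simp add: lin_box_def cmp_arr cong: restrict_cong)
      ultimately have "lin_box (c ;; d) = (\<lambda>\<phi>\<in>vec [src C c]. lin_box d (lin_box c \<phi>))"
        by (metis (no_types, lifting) restrict_ext)
      then show ?thesis using cd by (simp add: cmp_arr)
    qed
  qed simp_all
qed

end

section \<open>Invariance of weights and joint monicity of the projections\<close>

context tape_theory
begin

text \<open>The weights are read off the linear interpretation of the arrow \<open>x\<close>, which
  does not see the derivation.\<close>

lemma comb_weight:
  assumes U: "U \<in> obj C" and Q: "Q \<in> words C"
  shows "comb U Q w x \<Longrightarrow> comb U Q w' x \<Longrightarrow> w = w'"
proof -
  interpret M: tape_interp C lin_cat "\<lambda>U. [U]" "\<lambda>P. P" "\<lambda>P i. ([P ! i], lin_win P i, P)"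
    "\<lambda>c. ([src C c], lin_box c, [tgt C c])" by (rule lin_interp)
  interpret g: pca_gens "hom T [U] Q" "plus T" "star T [U] Q" "gens U Q" "gen Q"
    using U Q by (rule pca_gens_T)
  \<comment> \<open>For a generator \<open>(k, b)\<close> the interpretation sends the indicator of
    \<open>(0, c)\<close> to a vector whose entry at \<open>(j, id)\<close> is 0 unless
    \<open>j = k\<close>, and then tells whether \<open>b ;; id\<close> is \<open>c\<close>. So the
    entry is 1 exactly when the generator is \<open>(j, c)\<close>, and convex combinations are
    respected.\<close>
  define wt where "wt x s = fst (snd (far M.semF x)) (indicator {(0, snd s)}) (fst s, idn C (tgt C (snd s)))" for x s
  have wt: "w s = wt x s" if s: "s \<in> gens U Q" and c: "comb U Q w x" for w x s
    using c
  proof (induction rule: wrep.induct)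
    obtain j c where s': "s = (j, c)" "j < length Q" "c \<in> hom C U (Q ! j)" using s by (auto simp: gens_def)
    have d: "indicator {(0, c)} \<in> vec [U]" using s' by (auto simp: vec_def hom_iff indicator_def)
    {
      case wrep_star
      show ?case using U Q d s' by (simp add: wt_def M.semF_star)
    next
      case (wrep_gen t)
      obtain k b where t: "t = (k, b)" "k < length Q" "b \<in> hom C U (Q ! k)"
        using wrep_gen by (auto simp: gens_def)
      have "far M.semF (gen Q t) =
          cmp lin_cat ([src C b], lin_box b, [tgt C b]) ([Q ! k], lin_win Q k, Q)"
        using t Q M.semF_seq[OF box_hom[OF t(3)] tinj_hom[OF Q t(2)]] M.semF_box[OF t(3)] M.semF_tinj[OF Q t(2)]
        by (simp add: gen_def)
      also have "\<dots> = ([U], \<lambda>\<phi>\<in>vec [U]. lin_win Q k (lin_box b \<phi>), Q)" using t by (simp add: hom_iff)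
      finally have "wt (gen Q t) s = lin_win Q k (lin_box b (indicator {(0, c)})) (j, idn C (tgt C c))"
        using d s' by (simp add: wt_def)
      also have "\<dots> = (if j = k then lin_box b (indicator {(0, c)}) (0, idn C (tgt C c)) else 0)"
        using lin_vec[OF lin_lin_box[OF t(3)] d] by (simp add: lin_win_def)
      also have "\<dots> = indicator {t} s"
        using d s' t tgt_obj[of c] idr_arr[of b "tgt C b"]
        by (auto simp: lin_box_def hom_iff idn_arr indicator_def)
      finally show ?case by simp
    next
      case (wrep_plus p u x v y)
      have x: "x \<in> hom T [U] Q" "y \<in> hom T [U] Q" using wrep_plus g.W_in by auto
      obtain f g where "far M.semF x = ([U], f, Q)" "far M.semF y = ([U], g, Q)"
        using M.semF_hom[OF x(1)] M.semF_hom[OF x(2)] by (auto simp: lin_cat_hom)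
      then show ?case using wrep_plus M.semF_plus[OF _ x, of p] d s' by (simp add: wt_def)
    }
  qed
  assume w: "comb U Q w x" "comb U Q w' x"
  show "w = w'"
  proof
    fix s show "w s = w' s"
      using wt[OF _ w(1)] wt[OF _ w(2)] g.W_supp[OF w(1)] g.W_supp[OF w(2)] by (cases "s \<in> gens U Q") auto
  qed
qed

lemma prj_ext_letter:
  assumes w: "P \<in> words C" "Q \<in> words C" and h: "h \<in> hom T [U] (P @ Q)" and k: "k \<in> hom T [U] (P @ Q)"
    and e: "h \<odot> prj1 T P Q = k \<odot> prj1 T P Q" "h \<odot> prj2 T P Q = k \<odot> prj2 T P Q"
  shows "h = k"
proof -
  have U: "U \<in> obj C" using TC.hom_objD[OF h] by simp
  have PQ: "P @ Q \<in> words C" using w by simp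
  obtain u where u: "comb U (P @ Q) u h" using conv_all[OF h] unfolding conv_def by blast
  obtain v where v: "comb U (P @ Q) v k" using conv_all[OF k] unfolding conv_def by blast
  have 1: "(\<lambda>(j, c). if j < length P then u (j, c) else 0) = (\<lambda>(j, c). if j < length P then v (j, c) else 0)"
    by (rule comb_weight[OF U w(1) comb_prj1[OF U w u, unfolded e(1)] comb_prj1[OF U w v]])
  have 2: "(\<lambda>(j, c). u (length P + j, c)) = (\<lambda>(j, c). v (length P + j, c))"
    by (rule comb_weight[OF U w(2) comb_prj2[OF U w u, unfolded e(2)] comb_prj2[OF U w v]])
  have "u (j, c) = v (j, c)" for j c
    using fun_cong[OF 1, of "(j, c)"] fun_cong[OF 2, of "(j - length P, c)"] by (cases "j < length P") auto
  then have "u = v" by (simp add: fun_eq_iff)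
  then show ?thesis using pca_gens.W_unique[OF pca_gens_T[OF U PQ]] u v by blast
qed

text \<open>A word is the coproduct of its letters, so arrows out of it are compared on letters,
  where the weights decide.\<close>

lemma prj_ext:
  assumes w: "P \<in> words C" "Q \<in> words C" and h: "h \<in> hom T R (P @ Q)" and k: "k \<in> hom T R (P @ Q)"
    and e: "h \<odot> prj1 T P Q = k \<odot> prj1 T P Q" "h \<odot> prj2 T P Q = k \<odot> prj2 T P Q"
  shows "h = k"
proof (rule TC.ncop_ext[OF ncop_T h k])
  show R: "R \<in> words C" using TC.hom_objD[OF h] by simp
  fix i assume "i < length (lt R)"
  then have i: "i < length R" by simp
  note t = tinj_hom[OF R i]
  have "tinj R i \<odot> h = tinj R i \<odot> k"
  proof (rule prj_ext_letter[OF w, where U = "R ! i"])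
    show "tinj R i \<odot> h \<in> hom T [R ! i] (P @ Q)" "tinj R i \<odot> k \<in> hom T [R ! i] (P @ Q)"
      using TC.cmp_hom[OF t h] TC.cmp_hom[OF t k] by simp_all
    show "(tinj R i \<odot> h) \<odot> prj1 T P Q = (tinj R i \<odot> k) \<odot> prj1 T P Q"
      using TC.cmp_assoc[OF t h inj_hom(3)[OF w]] TC.cmp_assoc[OF t k inj_hom(3)[OF w]] e by simp
    show "(tinj R i \<odot> h) \<odot> prj2 T P Q = (tinj R i \<odot> k) \<odot> prj2 T P Q"
      using TC.cmp_assoc[OF t h inj_hom(4)[OF w]] TC.cmp_assoc[OF t k inj_hom(4)[OF w]] e by simp
  qed
  then show "cmp T (tinj R i) h = cmp T (tinj R i) k" by simp
qed

sublocale TB: strict_convex_biproduct_category T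
proof
  fix P Q assume "P \<in> obj T" "Q \<in> obj T"
  then have w: "P \<in> words C" "Q \<in> words C" by simp_all
  note i = inj_hom[OF w]
  show "is_convex_product T P Q (osum T P Q) (prj1 T P Q) (prj2 T P Q)"
    unfolding is_convex_product_def
  proof (intro conjI ballI impI)
    fix R f g and p q :: real
    assume f: "f \<in> hom T R P" "g \<in> hom T R Q" and p: "p \<in> {0..1}" "q \<in> {0..1}" "p + q \<le> 1"
    obtain h where h: "h \<in> hom T R (P @ Q)" "cmp T h (prj1 T P Q) = scale T p f" "cmp T h (prj2 T P Q) = scale T q g"
      using TC.convex_product_ex[OF i, of f R g p q] inj_prj[OF w] f p by auto
    show "\<exists>!h. h \<in> hom T R (osum T P Q) \<and> cmp T h (prj1 T P Q) = scale T p f \<and>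
        cmp T h (prj2 T P Q) = scale T q g"
    proof (rule ex1I[of _ h])
      show "k = h" if "k \<in> hom T R (osum T P Q) \<and> cmp T k (prj1 T P Q) = scale T p f \<and>
          cmp T k (prj2 T P Q) = scale T q g" for k
        using that h by (rule_tac prj_ext[OF w, of _ R]) simp_all
    qed (use h in simp)
  qed (use w i in simp_all)
qed (simp_all add: initial_T terminal_T coproduct_T inj_prj inj_Nil inj_assoc)

end

section \<open>The tape functor\<close>

lemma strict_cb_functorI:
  assumes "cat_functor C D F" "strict_convex_biproduct_category C" "strict_convex_biproduct_category D"
    and "\<And>p f g A B. p \<in> {0<..<1} \<Longrightarrow> f \<in> hom C A B \<Longrightarrow> g \<in> hom C A B \<Longrightarrow>
      far F (plus C p f g) = plus D p (far F f) (far F g)"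
    and "\<And>A B. A \<in> obj C \<Longrightarrow> B \<in> obj C \<Longrightarrow> far F (star C A B) = star D (fob F A) (fob F B)"
    and z: "fob F (zob C) = zob D"
    and o: "\<And>X1 X2. X1 \<in> obj C \<Longrightarrow> X2 \<in> obj C \<Longrightarrow> fob F (osum C X1 X2) = osum D (fob F X1) (fob F X2)"
    and i: "\<And>X1 X2. X1 \<in> obj C \<Longrightarrow> X2 \<in> obj C \<Longrightarrow> far F (inj1 C X1 X2) = inj1 D (fob F X1) (fob F X2)"
      "\<And>X1 X2. X1 \<in> obj C \<Longrightarrow> X2 \<in> obj C \<Longrightarrow> far F (inj2 C X1 X2) = inj2 D (fob F X1) (fob F X2)"
  shows "strict_cb_functor C D F"
proof -
  interpret cat_functor C D F by fact
  interpret C: strict_convex_biproduct_category C by fact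
  interpret D: strict_convex_biproduct_category D by fact
  have ob: "fob F A \<in> obj D" if "A \<in> obj C" for A using fob_ext that by auto
  have "cb_functor C D F"
    by (rule cb_functorI)
      (use assms C.convex_biproduct_category_axioms D.convex_biproduct_category_axioms
        D.zob_initial D.osum_coproduct ob in simp_all)
  then interpret cb_functor C D F .
  show ?thesis by unfold_locales (use z o i in simp_all)
qed

section \<open>Relabelling tapes along a functor\<close>

lemma map_tape_words:
  "map_tape f g (idw P) = idw (map f P)"
  "map_tape f g (swap1 U P) = swap1 (f U) (map f P)"
  "map_tape f g (swapw P Q) = swapw (map f P) (map f Q)"
  "map_tape f g (splitw p P) = splitw p (map f P)"
  "map_tape f g (discardw P) = discardw (map f P)"
  "map_tape f g (mergew P) = mergew (map f P)"
  "map_tape f g (initw P) = initw (map f P)"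
proof -
  show i: "map_tape f g (idw P) = idw (map f P)" for P by (induction P) simp_all
  show s: "map_tape f g (swap1 U P) = swap1 (f U) (map f P)" for U P by (induction P) (simp_all add: i)
  show w: "map_tape f g (swapw P Q) = swapw (map f P) (map f Q)" for P Q
    by (induction P) (simp_all add: i s)
  show "map_tape f g (splitw p P) = splitw p (map f P)" by (induction P) (simp_all add: i s w)
  show "map_tape f g (discardw P) = discardw (map f P)" by (induction P) simp_all
  show "map_tape f g (mergew P) = mergew (map f P)" by (induction P) (simp_all add: i w)
  show "map_tape f g (initw P) = initw (map f P)" by (induction P) simp_all
qed

text \<open>Identity and composite functors are \<open>undefined\<close> off the carriers, so the
  laws of \<open>map_tape\<close> carry over to them only on typed tapes, whose labels lie in the
  carriers.\<close>

lemma map_tape_typed_cong: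
  "tape_typed C P Q t \<Longrightarrow> (\<And>U. U \<in> obj C \<Longrightarrow> f U = f' U) \<Longrightarrow> (\<And>c. c \<in> arr C \<Longrightarrow> g c = g' c) \<Longrightarrow>
    map_tape f g t = map_tape f' g' t"
  by (induction rule: tape_typed.induct) (auto simp: hom_iff)

context cat_functor
begin

abbreviation "mw \<equiv> map (fob F)"
abbreviation "mt \<equiv> map_tape (fob F) (far F)"

lemma fob_obj: "A \<in> obj C \<Longrightarrow> fob F A \<in> obj D"
  using fob_ext by auto

lemma mw_words: "P \<in> words C \<Longrightarrow> mw P \<in> words D"
  by (auto simp: in_lists_conv_set fob_obj)

lemma map_typed: "tape_typed C P Q t \<Longrightarrow> tape_typed D (mw P) (mw Q) (mt t)"
  by (induction rule: tape_typed.induct) (auto intro!: tape_typed.intros fob_obj far_hom intro: tape_typed.intros(9))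

text \<open>Each rule is mapped to an instance of itself, because relabelling commutes with the
  structural tapes on words and \<open>F\<close> preserves identities and composites.\<close>

lemma map_eq: "tape_eq C P Q s t \<Longrightarrow> tape_eq D (mw P) (mw Q) (mt s) (mt t)"
proof (induction rule: tape_eq.induct)
  case (trans P Q s t u)
  then show ?case using tape_eq.trans by blast
next
  case (cong_seq P Q s s' R t t')
  then show ?case using tape_eq.cong_seq by auto
next
  case (seq_assoc P Q s R t S u)
  then show ?case using tape_eq.seq_assoc[OF map_typed map_typed map_typed] by simp
next
  case (interchange P Q s R t P' Q' s' R' t')
  then show ?case using tape_eq.interchange[OF map_typed map_typed map_typed map_typed] by simp
next
  case (box_id U)
  then show ?case using tape_eq.box_id[of "fob F U" D] by (simp add: fob_obj far_idn)
next
  case (box_cmp U V W c d)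
  then show ?case using tape_eq.box_cmp[of "fob F U" D "fob F V" "fob F W" "far F c" "far F d"]
    by (simp add: fob_obj far_cmp far_hom)
next
  case (hexagon P Q R)
  then show ?case using tape_eq.hexagon[of "mw P" D "mw Q" "mw R"] by (simp add: map_tape_words mw_words)
next
  case (swap_gen U V)
  then show ?case using tape_eq.swap_gen[of "fob F U" D "fob F V"] by (simp add: fob_obj)
next
  case (par_assoc P Q s P' Q' t P'' Q'' u)
  then show ?case using tape_eq.par_assoc[OF map_typed map_typed map_typed] by auto
next
  case (swap_natural P Q s P' Q' t)
  then show ?case using tape_eq.swap_natural[OF map_typed map_typed] by (auto simp: map_tape_words)
next
  case (refl P Q t)
  then show ?case using tape_eq.refl[OF map_typed]
    by (simp add: map_tape_words mw_words del: greaterThanLessThan_iff)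
next
  case (sym P Q s t)
  then show ?case using tape_eq.sym[of D]
    by (simp add: map_tape_words mw_words del: greaterThanLessThan_iff)
next
  case (cong_par P Q s s' P' Q' t t')
  then show ?case using tape_eq.cong_par[of D]
    by (simp add: map_tape_words mw_words del: greaterThanLessThan_iff)
next
  case (seq_idl P Q t)
  then show ?case using tape_eq.seq_idl[OF map_typed[of P Q t]]
    by (simp add: map_tape_words mw_words del: greaterThanLessThan_iff)
next
  case (seq_idr P Q t)
  then show ?case using tape_eq.seq_idr[OF map_typed[of P Q t]]
    by (simp add: map_tape_words mw_words del: greaterThanLessThan_iff)
next
  case (par_idl P Q t)
  then show ?case using tape_eq.par_idl[OF map_typed[of P Q t]]
    by (simp add: map_tape_words mw_words del: greaterThanLessThan_iff)
next
  case (par_idr P Q t)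
  then show ?case using tape_eq.par_idr[OF map_typed[of P Q t]]
    by (simp add: map_tape_words mw_words del: greaterThanLessThan_iff)
next
  case (par_id P Q)
  then show ?case using tape_eq.par_id[of "mw P" D "mw Q"]
    by (simp add: map_tape_words mw_words del: greaterThanLessThan_iff)
next
  case (swap_inverse P Q)
  then show ?case using tape_eq.swap_inverse[of "mw P" D "mw Q"]
    by (simp add: map_tape_words mw_words del: greaterThanLessThan_iff)
next
  case (merge_assoc P)
  then show ?case using tape_eq.merge_assoc[of "mw P" D]
    by (simp add: map_tape_words mw_words del: greaterThanLessThan_iff)
next
  case (merge_unit P)
  then show ?case using tape_eq.merge_unit[of "mw P" D]
    by (simp add: map_tape_words mw_words del: greaterThanLessThan_iff)
next
  case (merge_comm P)
  then show ?case using tape_eq.merge_comm[of "mw P" D]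
    by (simp add: map_tape_words mw_words del: greaterThanLessThan_iff)
next
  case (init_natural P Q f)
  then show ?case using tape_eq.init_natural[OF map_typed[of P Q f]]
    by (simp add: map_tape_words mw_words del: greaterThanLessThan_iff)
next
  case (merge_natural P Q f)
  then show ?case using tape_eq.merge_natural[OF map_typed[of P Q f]]
    by (simp add: map_tape_words mw_words del: greaterThanLessThan_iff)
next
  case (discard_natural P Q f)
  then show ?case using tape_eq.discard_natural[OF map_typed[of P Q f]]
    by (simp add: map_tape_words mw_words del: greaterThanLessThan_iff)
next
  case (split_assoc P p q)
  then show ?case using tape_eq.split_assoc[of "mw P" D p q]
    by (simp add: map_tape_words mw_words del: greaterThanLessThan_iff)
next
  case (split_merge P p)
  then show ?case using tape_eq.split_merge[of "mw P" D p]
    by (simp add: map_tape_words mw_words del: greaterThanLessThan_iff)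
next
  case (split_swap P p)
  then show ?case using tape_eq.split_swap[of "mw P" D p]
    by (simp add: map_tape_words mw_words del: greaterThanLessThan_iff)
next
  case (split_natural P Q f p)
  then show ?case using tape_eq.split_natural[OF map_typed[of P Q f], of p]
    by (simp add: map_tape_words mw_words del: greaterThanLessThan_iff)
qed

abbreviation "tF \<equiv> tape_functor C D F"

lemma tF_cls:
  assumes "tape_typed C P Q t"
  shows "far tF (tape_class C P Q t) = tape_class D (mw P) (mw Q) (mt t)"
proof -
  have "(\<Union>s\<in>{s. tape_eq C P Q t s}. {u. tape_eq D (mw P) (mw Q) (mt s) u}) = {u. tape_eq D (mw P) (mw Q) (mt t) u}"
  proof (intro equalityI subsetI)
    fix u assume "u \<in> {u. tape_eq D (mw P) (mw Q) (mt t) u}"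
    then show "u \<in> (\<Union>s\<in>{s. tape_eq C P Q t s}. {u. tape_eq D (mw P) (mw Q) (mt s) u})"
      by (intro UN_I[of t] CollectI tape_eq.refl assms) simp
  next
    fix u assume "u \<in> (\<Union>s\<in>{s. tape_eq C P Q t s}. {u. tape_eq D (mw P) (mw Q) (mt s) u})"
    then show "u \<in> {u. tape_eq D (mw P) (mw Q) (mt t) u}"
      by (elim UN_E CollectE) (rule CollectI, rule tape_eq.trans[OF map_eq])
  qed
  moreover have "tape_class C P Q t \<in> arr (tape_cat C)" using assms by (auto simp: tape_cat_def)
  ultimately show ?thesis by (simp add: tape_functor_def tape_class_def)
qed

lemma tF_fob: "P \<in> words C \<Longrightarrow> fob tF P = mw P"
  by (simp add: tape_functor_def)

interpretation tc: tape_theory C ..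
interpretation td: tape_theory D ..

lemma tF_seq:
  assumes "f \<in> hom (tape_cat C) P Q" "g \<in> hom (tape_cat C) Q R"
  shows "far tF (tape_seq C f g) = tape_seq D (far tF f) (far tF g)"
proof -
  obtain s t where s: "tape_typed C P Q s" "f = tape_class C P Q s" and t: "tape_typed C Q R t" "g = tape_class C Q R t"
    using assms tc.hom_cls by auto
  show ?thesis
    using tape_typed.intros(9)[OF s(1) t(1)] td.seq_cls[OF map_typed[OF s(1)] map_typed[OF t(1)]]
    by (simp add: s t tc.seq_cls tF_cls)
qed

lemma tF_par:
  assumes "f \<in> hom (tape_cat C) P Q" "g \<in> hom (tape_cat C) P' Q'"
  shows "far tF (tape_par C f g) = tape_par D (far tF f) (far tF g)"
proof -
  obtain s t where s: "tape_typed C P Q s" "f = tape_class C P Q s" and t: "tape_typed C P' Q' t" "g = tape_class C P' Q' t"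
    using assms tc.hom_cls by auto
  show ?thesis
    using tape_typed.intros(10)[OF s(1) t(1)] td.par_cls[OF map_typed[OF s(1)] map_typed[OF t(1)]]
    by (simp add: s t tc.par_cls tF_cls)
qed

lemma tF_hom: "f \<in> hom (tape_cat C) P Q \<Longrightarrow> far tF f \<in> hom (tape_cat D) (mw P) (mw Q)"
  unfolding tc.hom_cls td.hom_cls using map_typed tF_cls by blast

lemma tF_functor: "cat_functor (tape_cat C) (tape_cat D) tF"
proof
  show "fob tF \<in> obj (tape_cat C) \<rightarrow>\<^sub>E obj (tape_cat D)"
    using mw_words by (auto simp: tape_functor_def)
  show "far tF \<in> arr (tape_cat C) \<rightarrow>\<^sub>E arr (tape_cat D)"
  proof (rule PiE_I)
    show "far tF f \<in> arr (tape_cat D)" if "f \<in> arr (tape_cat C)" for f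
      using tF_hom[of f "src (tape_cat C) f" "tgt (tape_cat C) f"] that by (simp add: hom_iff)
  qed (simp add: tape_functor_def)
  show "far tF f \<in> hom (tape_cat D) (fob tF P) (fob tF Q)" if "f \<in> hom (tape_cat C) P Q" for f P Q
    using tF_hom[OF that] tc.TC.hom_objD[OF that] by (simp add: tF_fob)
  show "far tF (idn (tape_cat C) P) = idn (tape_cat D) (fob tF P)" if "P \<in> obj (tape_cat C)" for P
    using that by (simp add: tc.aI_def td.aI_def tF_cls typed_idw map_tape_words tF_fob)
  show "far tF (cmp (tape_cat C) f g) = cmp (tape_cat D) (far tF f) (far tF g)"
    if "f \<in> hom (tape_cat C) P Q" "g \<in> hom (tape_cat C) Q R" for f g P Q R
    using tF_seq[OF that] by simp
qed

lemma tF_plus: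
  assumes p: "p \<in> {0<..<1}" and f: "f \<in> hom (tape_cat C) P Q" and g: "g \<in> hom (tape_cat C) P Q"
  shows "far tF (tape_plus C p f g) = tape_plus D p (far tF f) (far tF g)"
proof -
  obtain s t where s: "tape_typed C P Q s" "f = tape_class C P Q s" and t: "tape_typed C P Q t" "g = tape_class C P Q t"
    using f g tc.hom_cls by auto
  have w: "P \<in> words C" "Q \<in> words C" using typed_words[OF s(1)] by simp_all
  note y = tape_typed.intros(9)[OF tape_typed.intros(9)[OF typed_splitw[OF w(1) p]
    tape_typed.intros(10)[OF s(1) t(1)]] typed_mergew[OF w(2)]]
  show ?thesis
    by (simp add: s t tc.plus_cls[OF s(1) t(1) p] tF_cls[OF y] tF_cls[OF s(1)] tF_cls[OF t(1)]
      td.plus_cls[OF map_typed[OF s(1)] map_typed[OF t(1)] p] map_tape_words)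
qed

lemma tF_strict: "strict_cb_functor (tape_cat C) (tape_cat D) tF"
proof (rule strict_cb_functorI[OF tF_functor tc.TB.strict_convex_biproduct_category_axioms
      td.TB.strict_convex_biproduct_category_axioms])
  show "far tF (plus (tape_cat C) p f g) = plus (tape_cat D) p (far tF f) (far tF g)"
    if "p \<in> {0<..<1}" "f \<in> hom (tape_cat C) P Q" "g \<in> hom (tape_cat C) P Q" for p f g P Q
    using tF_plus[OF that] by simp
  fix P Q assume "P \<in> obj (tape_cat C)" "Q \<in> obj (tape_cat C)"
  then have w [simp]: "P \<in> words C" "Q \<in> words C" by simp_all
  note t = tape_typed.intros(9)[OF typed_discardw[OF w(1)] typed_initw[OF w(2)]]
    tape_typed.intros(10)[OF typed_idw[OF w(1)] typed_initw[OF w(2)]]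
    tape_typed.intros(10)[OF typed_initw[OF w(1)] typed_idw[OF w(2)]]
  show "far tF (star (tape_cat C) P Q) = star (tape_cat D) (fob tF P) (fob tF Q)"
    using tF_cls[OF t(1)] by (simp add: tF_fob map_tape_words) (simp add: tape_cat_def)
  show "far tF (inj1 (tape_cat C) P Q) = inj1 (tape_cat D) (fob tF P) (fob tF Q)"
    using tF_cls[OF t(2)] by (simp add: tF_fob map_tape_words) (simp add: tape_cat_def)
  show "far tF (inj2 (tape_cat C) P Q) = inj2 (tape_cat D) (fob tF P) (fob tF Q)"
    using tF_cls[OF t(3)] by (simp add: tF_fob map_tape_words) (simp add: tape_cat_def)
  show "fob tF (osum (tape_cat C) P Q) = osum (tape_cat D) (fob tF P) (fob tF Q)"
    by (simp add: tF_fob)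
qed (simp add: tF_fob)

lemma tF_box: "c \<in> arr C \<Longrightarrow> far tF (tc.box c) = td.box (far F c)"
  using tF_cls[of "[src C c]" "[tgt C c]" "Box c"] far_hom[of c "src C c" "tgt C c"]
    S.src_obj[of c] S.tgt_obj[of c] tape_typed.intros(8)[of c C "src C c" "tgt C c"]
  by (simp add: tc.box_def td.box_def hom_iff)

end

lemma obj_tape_cat: "obj (tape_cat C) = words C"
  by (simp add: tape_cat_def)

lemma tape_functor_id:
  assumes "category C"
  shows "tape_functor C C (id_functor C) = id_functor (tape_cat C)"
proof -
  interpret category C by fact
  interpret cat_functor C C "id_functor C"
    by unfold_locales (simp_all add: id_functor_def hom_iff idn_arr cmp_arr src_obj tgt_obj)
  have m: "map (fob (id_functor C)) P = P" if "P \<in> words C" for P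
    using that by (induction P) (auto simp: id_functor_def)
  have mt: "mt t = t" if "tape_typed C P Q t" for P Q t
    using map_tape_typed_cong[OF that, of "fob (id_functor C)" id "far (id_functor C)" id]
    by (simp add: id_functor_def tape.map_id)
  have "far tF f = f" if "f \<in> arr (tape_cat C)" for f
  proof -
    obtain P Q t where t: "tape_typed C P Q t" "f = tape_class C P Q t"
      using \<open>f \<in> arr (tape_cat C)\<close> by (auto simp: tape_cat_def)
    then show ?thesis using tF_cls[OF t(1)] mt[OF t(1)] m typed_words[OF t(1)] by simp
  qed
  then have "far tF = (\<lambda>f\<in>arr (tape_cat C). f)"
    by (auto simp: fun_eq_iff restrict_def) (simp add: tape_functor_def)
  moreover have "fob tF = (\<lambda>P\<in>words C. P)"
    using m by (auto simp: tape_functor_def intro!: restrict_ext)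
  ultimately show ?thesis
    by (intro ftor.equality) (simp_all add: id_functor_def[of "tape_cat C"] obj_tape_cat)
qed

lemma tape_functor_comp:
  assumes "cat_functor C D F" "cat_functor D E G"
  shows "tape_functor C E (comp_functor C F G) =
    comp_functor (tape_cat C) (tape_functor C D F) (tape_functor D E G)"
proof -
  interpret F: cat_functor C D F by fact
  interpret G: cat_functor D E G by fact
  interpret FG: cat_functor C E "comp_functor C F G"
  proof
    show "fob (comp_functor C F G) \<in> obj C \<rightarrow>\<^sub>E obj E"
      by (auto simp: comp_functor_def intro!: G.fob_obj F.fob_obj)
    have *: "far G (far F f) \<in> hom E (fob G (fob F A)) (fob G (fob F B))" if "f \<in> hom C A B" for f A B
      using G.far_hom[OF F.far_hom[OF that]] .
    show "far (comp_functor C F G) \<in> arr C \<rightarrow>\<^sub>E arr E"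
    proof (rule PiE_I)
      show "far (comp_functor C F G) f \<in> arr E" if "f \<in> arr C" for f
        using *[of f "src C f" "tgt C f"] that by (simp add: comp_functor_def hom_iff)
    qed (simp add: comp_functor_def)
    show "far (comp_functor C F G) f \<in> hom E (fob (comp_functor C F G) A) (fob (comp_functor C F G) B)"
      if "f \<in> hom C A B" for f A B
      using *[OF that] F.S.hom_objD[OF that] that by (simp add: comp_functor_def hom_iff[of f C])
    show "far (comp_functor C F G) (idn C A) = idn E (fob (comp_functor C F G) A)" if "A \<in> obj C" for A
      using that by (simp add: comp_functor_def F.far_idn G.far_idn F.fob_obj F.S.idn_arr)
    show "far (comp_functor C F G) (f ;;\<^bsub>C\<^esub> g) = far (comp_functor C F G) f ;;\<^bsub>E\<^esub> far (comp_functor C F G) g"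
      if "f \<in> hom C A B" "g \<in> hom C B B'" for f g A B B'
      using F.far_cmp[OF that] G.far_cmp[OF F.far_hom[OF that(1)] F.far_hom[OF that(2)]] that
        F.S.cmp_hom[OF that] by (simp add: comp_functor_def hom_iff[of _ C])
  qed
  have m: "map (fob (comp_functor C F G)) P = map (fob G) (map (fob F) P)" if "P \<in> words C" for P
    using that by (induction P) (auto simp: comp_functor_def)
  have mt: "FG.mt t = G.mt (F.mt t)" if "tape_typed C P Q t" for P Q t
    using map_tape_typed_cong[OF that, of "fob (comp_functor C F G)" "fob G \<circ> fob F"
        "far (comp_functor C F G)" "far G \<circ> far F"]
    by (simp add: comp_functor_def tape.map_comp)
  have "far FG.tF f = far G.tF (far F.tF f)" if "f \<in> arr (tape_cat C)" for f
  proof -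
    obtain P Q t where t: "tape_typed C P Q t" "f = tape_class C P Q t"
      using \<open>f \<in> arr (tape_cat C)\<close> by (auto simp: tape_cat_def)
    then show ?thesis
      using FG.tF_cls[OF t(1)] F.tF_cls[OF t(1)] G.tF_cls[OF F.map_typed[OF t(1)]] mt[OF t(1)] m
        typed_words[OF t(1)] by simp
  qed
  then have "far FG.tF = (\<lambda>f\<in>arr (tape_cat C). far G.tF (far F.tF f))"
    by (auto simp: fun_eq_iff restrict_def) (simp add: tape_functor_def)
  moreover have "fob FG.tF = (\<lambda>P\<in>words C. fob G.tF (fob F.tF P))"
    using m by (auto simp: tape_functor_def F.fob_obj intro!: restrict_ext)
  ultimately show ?thesis
    by (intro ftor.equality) (simp_all add: comp_functor_def[of "tape_cat C"] obj_tape_cat)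
qed

section \<open>The adjunction\<close>

lemma forget_simps [simp]:
  "obj (forget D) = obj D" "arr (forget D) = arr D" "src (forget D) = src D" "tgt (forget D) = tgt D"
  "idn (forget D) = idn D" "cmp (forget D) = cmp D" "hom (forget D) A B = hom D A B"
  by (simp_all add: forget_def cat.truncate_def hom_def)

lemma category_forget: "category D \<Longrightarrow> category (forget D)"
  unfolding category_def by simp

context tape_theory
begin

lemma unit_far: "c \<in> arr C \<Longrightarrow> far (tape_unit C) c = box c"
  by (simp add: tape_unit_def box_def)

lemma unit_fob: "U \<in> obj C \<Longrightarrow> fob (tape_unit C) U = [U]"
  by (simp add: tape_unit_def)

lemma box_arr: "c \<in> arr C \<Longrightarrow> box c \<in> arr T"
  using box_hom[of c "src C c" "tgt C c"] by (simp add: hom_iff)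

lemma unit_functor: "cat_functor C (forget T) (tape_unit C)"
proof -
  interpret F: category "forget T" by (rule category_forget) (rule TC.category_axioms)
  show ?thesis
  proof
    show "fob (tape_unit C) \<in> obj C \<rightarrow>\<^sub>E obj (forget T)" by (auto simp: tape_unit_def)
    show "far (tape_unit C) \<in> arr C \<rightarrow>\<^sub>E arr (forget T)"
    proof (rule PiE_I)
      show "far (tape_unit C) c \<in> arr (forget T)" if "c \<in> arr C" for c
        using box_arr that by (simp add: unit_far)
    qed (simp add: tape_unit_def)
    show "far (tape_unit C) f \<in> hom (forget T) (fob (tape_unit C) U) (fob (tape_unit C) V)"
      if "f \<in> hom C U V" for f U V
      using box_hom[OF that] hom_objD[OF that] that by (simp add: unit_far unit_fob hom_iff[of f C])
    show "far (tape_unit C) (idn C U) = idn (forget T) (fob (tape_unit C) U)" if "U \<in> obj C" for U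
      using that by (simp add: unit_far unit_fob idn_arr box_idn)
    show "far (tape_unit C) (cmp C f g) = cmp (forget T) (far (tape_unit C) f) (far (tape_unit C) g)"
      if "f \<in> hom C U V" "g \<in> hom C V W" for f g U V W
      using that box_cmp[OF that] cmp_hom[OF that] by (simp add: unit_far hom_iff[of _ C])
  qed
qed

lemma adjunct_eq: "adjunct C G = \<lparr>fob = (\<lambda>U\<in>obj C. fob G [U]), far = (\<lambda>c\<in>arr C. far G (box c))\<rparr>"
  by (simp add: adjunct_def comp_functor_def unit_far unit_fob cong: restrict_cong)

lemma adjunct_functor:
  assumes "cat_functor T D G"
  shows "cat_functor C (forget D) (adjunct C G)"
proof -
  interpret G: cat_functor T D G by fact
  interpret F: category "forget D" by (rule category_forget) (rule G.T.category_axioms)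
  have ob: "fob G [U] \<in> obj D" if "U \<in> obj C" for U using G.fob_obj[of "[U]"] that by simp
  have ar: "far G (box f) \<in> hom D (fob G [U]) (fob G [V])" if "f \<in> hom C U V" for f U V
    using G.far_hom[OF box_hom[OF that]] .
  show ?thesis
  proof
    show "fob (adjunct C G) \<in> obj C \<rightarrow>\<^sub>E obj (forget D)" by (auto simp: adjunct_eq ob)
    show "far (adjunct C G) \<in> arr C \<rightarrow>\<^sub>E arr (forget D)"
    proof (rule PiE_I)
      show "far (adjunct C G) c \<in> arr (forget D)" if "c \<in> arr C" for c
        using ar[of c "src C c" "tgt C c"] that by (simp add: adjunct_eq hom_iff)
    qed (simp add: adjunct_eq)
    show "far (adjunct C G) f \<in> hom (forget D) (fob (adjunct C G) U) (fob (adjunct C G) V)"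
      if "f \<in> hom C U V" for f U V
      using ar[OF that] hom_objD[OF that] that by (simp add: adjunct_eq hom_iff[of f C])
    show "far (adjunct C G) (idn C U) = idn (forget D) (fob (adjunct C G) U)" if "U \<in> obj C" for U
      using that G.far_idn[of "[U]"] by (simp add: adjunct_eq idn_arr box_idn)
    show "far (adjunct C G) (cmp C f g) = cmp (forget D) (far (adjunct C G) f) (far (adjunct C G) g)"
      if "f \<in> hom C U V" "g \<in> hom C V W" for f g U V W
      using that box_cmp[OF that] cmp_hom[OF that] G.far_cmp[OF box_hom[OF that(1)] box_hom[OF that(2)]]
      by (simp add: adjunct_eq hom_iff[of _ C])
  qed
qed

end

lemma interp_of_functor:
  assumes "pca_coproduct_category D" "cat_functor C (forget D) H"
  shows "tape_interp C D (fob H) (\<lambda>P. nob D (map (fob H) P)) (\<lambda>P. nin D (map (fob H) P)) (far H)"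
proof -
  interpret D: pca_coproduct_category D by fact
  interpret H: cat_functor C "forget D" H by fact
  show ?thesis
  proof
    show "is_ncop D (map (fob H) P) (nob D (map (fob H) P)) (nin D (map (fob H) P))" if "P \<in> words C" for P
      using that H.fob_obj by (intro D.ncop_nob) (auto simp: in_lists_conv_set)
    show "far H c \<in> hom D (fob H U) (fob H V)" if "c \<in> hom C U V" for c U V
      using H.far_hom[OF that] by simp
    show "far H (idn C U) = idn D (fob H U)" if "U \<in> obj C" for U using H.far_idn[OF that] by simp
    show "far H (cmp C c d) = cmp D (far H c) (far H d)" if "c \<in> hom C U V" "d \<in> hom C V W" for c d U V W
      using H.far_cmp[OF that] by simp
  qed simp_all
qed

sublocale strict_convex_biproduct_category \<subseteq> strict: strict_pca_coproduct_category
  by unfold_locales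
    (simp_all add: osum_zob_left inj2_zob osum_zob_right inj1_zob osum_assoc inj_assoc1 inj_assoc2 inj_assoc3)

context tape_interp
begin

lemma adjunct_semF:
  assumes "fob H \<in> extensional (obj C)" "far H \<in> extensional (arr C)"
    and "\<And>U. U \<in> obj C \<Longrightarrow> ob U = fob H U" "\<And>c. c \<in> arr C \<Longrightarrow> bx c = far H c"
  shows "adjunct C semF = (H :: ('o, 'a, 'p, 'b) ftor)"
proof (rule ftor.equality)
  show "fob (adjunct C semF) = fob H"
    using assms(1) by (intro extensionalityI[of _ "obj C"])
      (auto simp: t.adjunct_eq semF_fob wob_single assms(3))
  show "far (adjunct C semF) = far H"
    using assms(2) semF_box[OF _]
    by (intro extensionalityI[of _ "arr C"]) (auto simp: t.adjunct_eq assms(4) hom_iff)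
qed simp

end

lemma functor_extensional:
  assumes "cat_functor C D F"
  shows "fob F \<in> extensional (obj C)" "far F \<in> extensional (arr C)"
  using cat_functor.fob_ext[OF assms] cat_functor.far_ext[OF assms] by (auto simp: PiE_def)

section \<open>Existence of the induced morphism\<close>

text \<open>The strict conclusion concerns the same functor: in a strict target the iterated sum
  \<open>nob\<close> is additive under concatenation, so the interpretation respects chosen sums and
  injections by itself.\<close>

lemma free_cb_functor:
  assumes D: "convex_biproduct_category D" and H: "cat_functor C (forget D) H"
  obtains G where "cb_functor (tape_cat C) D G" "adjunct C G = H"
    "strict_convex_biproduct_category D \<Longrightarrow> strict_cb_functor (tape_cat C) D G"
proof -
  interpret D: convex_biproduct_category D by fact
  interpret H: cat_functor C "forget D" H by fact
  interpret I: tape_interp C D "fob H" "\<lambda>P. nob D (map (fob H) P)" "\<lambda>P. nin D (map (fob H) P)" "far H"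
    using D.pca_coproduct_category_axioms H by (rule interp_of_functor)
  have 1: "cb_functor (tape_cat C) D I.semF"
    by (rule cb_functorI[OF I.semF_functor I.t.TB.convex_biproduct_category_axioms D])
      (simp_all add: I.semF_plus I.semF_star I.semF_fob I.semF_inj I.lr_coproduct D.zob_initial
        del: map_append)
  have 2: "adjunct C I.semF = H"
    using functor_extensional[OF H] by (intro I.adjunct_semF) simp_all
  have 3: "strict_cb_functor (tape_cat C) D I.semF" if "strict_convex_biproduct_category D"
  proof -
    interpret D: strict_convex_biproduct_category D by fact
    have o: "set (map (fob H) P) \<subseteq> obj D" if "P \<in> words C" for P
      using that H.fob_obj by (auto simp: in_lists_conv_set)
    \<comment> \<open>Both sides are arrows out of a sum of letters and agree on every letter
      injection.\<close>
    have lr: "I.lft P Q = inj1 D (nob D (map (fob H) P)) (nob D (map (fob H) Q))"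
      "I.rgt P Q = inj2 D (nob D (map (fob H) P)) (nob D (map (fob H) Q))"
      if w: "P \<in> words C" "Q \<in> words C" for P Q
    proof -
      note i = D.strict.inj_hom'[OF I.wob_obj[OF w(1)] I.wob_obj[OF w(2)]]
      have e: "nob D (map (fob H) (P @ Q)) = osum D (nob D (map (fob H) P)) (nob D (map (fob H) Q))"
        using D.strict.nob_append[OF o[OF w(1)] o[OF w(2)]] by simp
      show "I.lft P Q = inj1 D (nob D (map (fob H) P)) (nob D (map (fob H) Q))"
        by (rule I.win_ext[OF w(1) I.lft_hom[OF w]])
          (use i e I.win_lft[OF w] D.strict.nin_inj1[OF o[OF w(1)] o[OF w(2)]] in simp_all)
      show "I.rgt P Q = inj2 D (nob D (map (fob H) P)) (nob D (map (fob H) Q))"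
        by (rule I.win_ext[OF w(2) I.rgt_hom[OF w]])
          (use i e I.win_rgt[OF w] D.strict.nin_inj2[OF o[OF w(1)] o[OF w(2)]] in simp_all)
    qed
    show ?thesis
      by (rule strict_cb_functorI[OF I.semF_functor I.t.TB.strict_convex_biproduct_category_axioms that])
        (use D.strict.nob_append o in \<open>simp_all add: I.semF_plus I.semF_star I.semF_fob I.semF_inj lr\<close>)
  qed
  show ?thesis using that 1 2 3 by blast
qed

section \<open>Uniqueness and natural transformations\<close>

text \<open>This allows arrows out of \<open>fob G P\<close> to be compared and constructed letter
  by letter.\<close>

lemma cb_functor_ncop:
  assumes "category C" "cb_functor (tape_cat C) D G" "P \<in> words C"
  shows "is_ncop D (map (\<lambda>U. fob G [U]) P) (fob G P) (\<lambda>i. far G (tape_theory.tinj C P i))"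
proof -
  interpret t: tape_theory C unfolding tape_theory_def by fact
  interpret G: cb_functor t.T D G by fact
  show ?thesis using G.far_ncop[OF t.lt_obj[OF assms(3)]] assms(3)
    by (simp add: t.nob_lt t.tinj_def[abs_def] comp_def)
qed

text \<open>Strictness enters through the objects and the letter injections: a functor that merely
  preserves coproducts has \<open>fob G P\<close> and \<open>far G (tinj P i)\<close> determined by
  the letters only up to isomorphism. Stars, boxes and sums then fix the arrows out of
  letters.\<close>

lemma strict_cb_functor_unique:
  assumes C: "category C" and "strict_cb_functor (tape_cat C) D G" "strict_cb_functor (tape_cat C) D G'"
    and e: "adjunct C G = adjunct C G'"
  shows "G = G'"
proof -
  interpret t: tape_theory C unfolding tape_theory_def by (rule C)
  interpret G: strict_cb_functor t.T D G by fact
  interpret G': strict_cb_functor t.T D G' by fact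
  have ob1: "fob G [U] = fob G' [U]" if "U \<in> obj C" for U
    using fun_cong[OF arg_cong[OF e, of fob], of U] that by (simp add: t.adjunct_eq)
  have box: "far G (t.box c) = far G' (t.box c)" if "c \<in> arr C" for c
    using fun_cong[OF arg_cong[OF e, of far], of c] that by (simp add: t.adjunct_eq)
  have ob: "fob G P = fob G' P" if "P \<in> words C" for P
    using that
  proof (induction P)
    case (Cons U P)
    then show ?case using G.fob_osum[of "[U]" P] G'.fob_osum[of "[U]" P] ob1 by simp
  qed (use G.fob_zob G'.fob_zob in simp)
  have tinj: "far G (t.tinj P i) = far G' (t.tinj P i)" if "P \<in> words C" "i < length P" for P i
    using that
  proof (induction P arbitrary: i)
    case (Cons U P)
    then have U: "[U] \<in> words C" "P \<in> words C" by auto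
    note inj = t.inj_hom[OF U]
    show ?case
    proof (cases i)
      case 0
      have "t.tinj (U # P) 0 = inj1 t.T [U] P"
        using t.tinj_inj1[OF U, of 0] t.idl[of "inj1 t.T [U] P" "[U]"] U by (simp add: t.tinj_single)
      then show ?thesis using 0 U G.far_inj1[of "[U]" P] G'.far_inj1[of "[U]" P] ob by simp
    next
      case (Suc k)
      then have k: "k < length P" using Cons by simp
      have e: "t.tinj (U # P) i = cmp t.T (t.tinj P k) (inj2 t.T [U] P)"
        using t.tinj_inj2[OF U k] Suc by simp
      show ?thesis unfolding e
        using G.far_cmp[OF t.tinj_hom[OF U(2) k] inj(2)] G'.far_cmp[OF t.tinj_hom[OF U(2) k] inj(2)]
          Cons.IH[of k] k G.far_inj2[of "[U]" P] G'.far_inj2[of "[U]" P] ob U by simp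
    qed
  qed simp
  have letter: "far G f = far G' f" if f: "f \<in> hom t.T [U] Q" for f U Q
  proof -
    have w: "U \<in> obj C" "Q \<in> words C" using t.TC.hom_objD[OF f] by auto
    show ?thesis using t.conv_all[OF f]
    proof (induction rule: t.conv_induct)
      case star
      then show ?case using G.far_star[of "[U]" Q] G'.far_star[of "[U]" Q] w ob by simp
    next
      case (gen j c)
      then show ?case
        using G.far_cmp[OF t.box_hom t.tinj_hom[OF w(2)]] G'.far_cmp[OF t.box_hom t.tinj_hom[OF w(2)]]
          box[of c] tinj[OF w(2)] by (simp add: hom_iff[of c])
    next
      case (plus p x y)
      note h = t.conv_hom[OF w plus(2)] t.conv_hom[OF w plus(3)]
      show ?case using G.far_plus[OF plus(1) h] G'.far_plus[OF plus(1) h] plus(4,5) by simp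
    qed
  qed
  have hom: "far G f = far G' f" if f: "f \<in> hom t.T P Q" for f P Q
  proof -
    have w: "P \<in> words C" "Q \<in> words C" using t.TC.hom_objD[OF f] by auto
    show ?thesis
    proof (rule G.T.ncop_ext[OF cb_functor_ncop[OF C G.cb_functor_axioms w(1)] G.far_hom[OF f]])
      show "far G' f \<in> hom D (fob G P) (fob G Q)" using G'.far_hom[OF f] ob w by simp
      fix i assume "i < length (map (\<lambda>U. fob G [U]) P)"
      then have i: "i < length P" by simp
      note t = t.tinj_hom[OF w(1) i]
      show "cmp D (far G (t.tinj P i)) (far G f) = cmp D (far G (t.tinj P i)) (far G' f)"
        using G.far_cmp[OF t f] G'.far_cmp[OF t f] letter[OF t.TC.cmp_hom[OF t f]] tinj[OF w(1) i] by simp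
    qed
  qed
  show ?thesis
  proof (rule ftor.equality)
    show "fob G = fob G'"
      using functor_extensional(1)[OF G.cat_functor_axioms] functor_extensional(1)[OF G'.cat_functor_axioms] ob
      by (intro extensionalityI) auto
    have "far G f = far G' f" if "f \<in> arr t.T" for f
      using hom[of f "src t.T f" "tgt t.T f"] that by (simp add: hom_iff)
    then show "far G = far G'"
      using functor_extensional(2)[OF G.cat_functor_axioms] functor_extensional(2)[OF G'.cat_functor_axioms]
      by (intro extensionalityI) auto
  qed simp
qed

text \<open>Naturality at the letter injections forces the component at a word, whence injectivity.
  Conversely, the components so obtained are natural for arrows out of a letter, by induction on
  convex combinations, and then for all arrows, as \<open>fob G P\<close> is a coproduct of images
  of letters.\<close>

lemma nat_trans_bij:
  assumes C: "category C" and "cb_functor (tape_cat C) D G" "cb_functor (tape_cat C) D G'"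
  shows "bij_betw (\<lambda>\<alpha>. \<lambda>U\<in>obj C. \<alpha> (fob (tape_unit C) U)) (nat_trans (tape_cat C) D G G')
    (nat_trans C (forget D) (adjunct C G) (adjunct C G'))"
proof -
  interpret t: tape_theory C unfolding tape_theory_def by (rule C)
  interpret G: cb_functor t.T D G by fact
  interpret G': cb_functor t.T D G' by fact
  note n = cb_functor_ncop[OF C G.cb_functor_axioms]
  let ?r = "\<lambda>\<alpha>. \<lambda>U\<in>obj C. \<alpha> (fob (tape_unit C) U)"
  have r: "?r \<alpha> = (\<lambda>U\<in>obj C. \<alpha> [U])" for \<alpha>
    by (simp add: t.unit_fob cong: restrict_cong)
  have comp: "cmp D (far G (t.tinj P i)) (\<alpha> P) = cmp D (\<alpha> [P ! i]) (far G' (t.tinj P i))"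
    if "\<alpha> \<in> nat_trans t.T D G G'" "P \<in> words C" "i < length P" for \<alpha> P i
    using that t.tinj_hom[OF that(2,3)] unfolding nat_trans_def by blast
  have inj: "\<alpha> = \<beta>" if a: "\<alpha> \<in> nat_trans t.T D G G'" and b: "\<beta> \<in> nat_trans t.T D G G'" and e: "?r \<alpha> = ?r \<beta>" for \<alpha> \<beta>
  proof -
    have l: "\<alpha> [U] = \<beta> [U]" if "U \<in> obj C" for U
      using fun_cong[OF e, of U] that by (simp add: t.unit_fob)
    have "\<alpha> P = \<beta> P" if P: "P \<in> words C" for P
    proof (rule G.T.ncop_ext[OF n[OF P]])
      show "\<alpha> P \<in> hom D (fob G P) (fob G' P)" "\<beta> P \<in> hom D (fob G P) (fob G' P)"
        using a b P unfolding nat_trans_def by auto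
      show "cmp D (far G (t.tinj P i)) (\<alpha> P) = cmp D (far G (t.tinj P i)) (\<beta> P)"
        if "i < length (map (\<lambda>U. fob G [U]) P)" for i
        using comp[OF a P, of i] comp[OF b P, of i] l[of "P ! i"] that P by (simp add: in_lists_conv_set)
    qed
    then show ?thesis using a b unfolding nat_trans_def
      by (intro extensionalityI[of _ "obj t.T"]) (auto simp: PiE_def)
  qed
  have into: "?r \<alpha> \<in> nat_trans C (forget D) (adjunct C G) (adjunct C G')"
    if a: "\<alpha> \<in> nat_trans t.T D G G'" for \<alpha>
  proof -
    have h: "\<alpha> [U] \<in> hom D (fob G [U]) (fob G' [U])" if "U \<in> obj C" for U
      using a that unfolding nat_trans_def by auto
    have "cmp D (far G (t.box f)) (\<alpha> [V]) = cmp D (\<alpha> [U]) (far G' (t.box f))" if "f \<in> hom C U V" for f U V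
      using a t.box_hom[OF that] unfolding nat_trans_def by blast
    then show ?thesis using h t.hom_objD unfolding nat_trans_def r
      by (auto simp: t.adjunct_eq hom_iff)
  qed
  have onto: "\<exists>\<beta>\<in>nat_trans t.T D G G'. ?r \<beta> = \<alpha>"
    if a: "\<alpha> \<in> nat_trans C (forget D) (adjunct C G) (adjunct C G')" for \<alpha>
  proof -
    have \<alpha>: "\<alpha> U \<in> hom D (fob G [U]) (fob G' [U])" if "U \<in> obj C" for U
      using a that unfolding nat_trans_def by (auto simp: t.adjunct_eq)
    have nat: "cmp D (far G (t.box f)) (\<alpha> V) = cmp D (\<alpha> U) (far G' (t.box f))" if "f \<in> hom C U V" for f U V
    proof -
      have "cmp (forget D) (far (adjunct C G) f) (\<alpha> V) = cmp (forget D) (\<alpha> U) (far (adjunct C G') f)"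
        using a that unfolding nat_trans_def by blast
      then show ?thesis using that by (simp add: t.adjunct_eq hom_iff)
    qed
    have ti': "far G' (t.tinj P i) \<in> hom D (fob G' [P ! i]) (fob G' P)" if "P \<in> words C" "i < length P" for P i
      using G'.far_hom[OF t.tinj_hom[OF that]] .
    have "\<exists>h. h \<in> hom D (fob G P) (fob G' P) \<and>
        (\<forall>i<length P. cmp D (far G (t.tinj P i)) h = cmp D (\<alpha> (P ! i)) (far G' (t.tinj P i)))"
      if P: "P \<in> words C" for P
    proof -
      obtain h where "h \<in> hom D (fob G P) (fob G' P)" "\<And>i. i < length (map (\<lambda>U. fob G [U]) P) \<Longrightarrow>
          cmp D (far G (t.tinj P i)) h = cmp D (\<alpha> (P ! i)) (far G' (t.tinj P i))"
      proof (rule G.T.ncop_ex[OF n[OF P], of "fob G' P" "\<lambda>i. cmp D (\<alpha> (P ! i)) (far G' (t.tinj P i))"])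
        show "fob G' P \<in> obj D" using G'.fob_obj P by simp
        show "cmp D (\<alpha> (P ! i)) (far G' (t.tinj P i)) \<in> hom D (map (\<lambda>U. fob G [U]) P ! i) (fob G' P)"
          if "i < length (map (\<lambda>U. fob G [U]) P)" for i
          using G.T.cmp_hom[OF \<alpha>[of "P ! i"] ti'[OF P, of i]] that P by (simp add: in_lists_conv_set)
      qed blast
      then show ?thesis by auto
    qed
    then obtain B where B: "\<And>P. P \<in> words C \<Longrightarrow> B P \<in> hom D (fob G P) (fob G' P)"
      "\<And>P i. P \<in> words C \<Longrightarrow> i < length P \<Longrightarrow>
        cmp D (far G (t.tinj P i)) (B P) = cmp D (\<alpha> (P ! i)) (far G' (t.tinj P i))"
      by metis
    \<comment> \<open>A mixed square with \<open>\<alpha> U\<close> in place of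
      \<open>B [U]\<close>, since the two are not yet known to be equal. Sums pass because
      composition in \<open>D\<close> preserves them in both arguments.\<close>
    have letter: "cmp D (far G f) (B Q) = cmp D (\<alpha> U) (far G' f)" if f: "f \<in> hom t.T [U] Q" for f U Q
    proof -
      have w: "U \<in> obj C" "Q \<in> words C" using t.TC.hom_objD[OF f] by auto
      note b = B(1)[OF w(2)] and u = \<alpha>[OF w(1)]
      show ?thesis using t.conv_all[OF f]
      proof (induction rule: t.conv_induct)
        case star
        then show ?case
          using G.far_star[of "[U]" Q] G'.far_star[of "[U]" Q] w G.fob_obj[of "[U]"] G'.fob_obj[of Q]
            G.T.cmp_star_left[OF _ b, of "fob G [U]"] G.T.cmp_star_right[OF _ u, of "fob G' Q"] by simp
      next
        case (gen j c)
        have j: "Q ! j \<in> obj C" using gen w by (simp add: in_lists_conv_set)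
        note c = t.box_hom[OF gen(2)] and t = t.tinj_hom[OF w(2) gen(1)]
        note h = G.far_hom[OF c] G.far_hom[OF t] G'.far_hom[OF c] G'.far_hom[OF t]
        have "cmp D (far G (tape_seq C (t.box c) (t.tinj Q j))) (B Q) =
            cmp D (far G (t.box c)) (cmp D (far G (t.tinj Q j)) (B Q))"
          using G.far_cmp[OF c t] G.T.cmp_assoc[OF h(1,2) b] by simp
        also have "\<dots> = cmp D (cmp D (far G (t.box c)) (\<alpha> (Q ! j))) (far G' (t.tinj Q j))"
          using B(2)[OF w(2) gen(1)] G.T.cmp_assoc[OF h(1) \<alpha>[OF j] h(4)] by simp
        also have "\<dots> = cmp D (\<alpha> U) (cmp D (far G' (t.box c)) (far G' (t.tinj Q j)))"
          using nat[OF gen(2)] G.T.cmp_assoc[OF u h(3,4)] by simp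
        finally show ?case using G'.far_cmp[OF c t] by simp
      next
        case (plus p x y)
        note h = t.conv_hom[OF w plus(2)] t.conv_hom[OF w plus(3)]
        show ?case
          using G.far_plus[OF plus(1) h] G'.far_plus[OF plus(1) h] plus(4,5)
            G.T.cmp_plus_left[OF plus(1) G.far_hom[OF h(1)] G.far_hom[OF h(2)] b]
            G.T.cmp_plus_right[OF plus(1) u G'.far_hom[OF h(1)] G'.far_hom[OF h(2)]] by simp
      qed
    qed
    have natB: "cmp D (far G f) (B Q) = cmp D (B P) (far G' f)" if f: "f \<in> hom t.T P Q" for f P Q
    proof -
      have w: "P \<in> words C" "Q \<in> words C" using t.TC.hom_objD[OF f] by auto
      note fh = G.far_hom[OF f] G'.far_hom[OF f] and b = B(1)[OF w(1)] B(1)[OF w(2)]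
      show ?thesis
      proof (rule G.T.ncop_ext[OF n[OF w(1)] G.T.cmp_hom[OF fh(1) b(2)] G.T.cmp_hom[OF b(1) fh(2)]])
        fix i assume "i < length (map (\<lambda>U. fob G [U]) P)"
        then have i: "i < length P" by simp
        then have u: "P ! i \<in> obj C" using w by (simp add: in_lists_conv_set)
        note t = t.tinj_hom[OF w(1) i]
        note h = G.far_hom[OF t] G'.far_hom[OF t]
        have "cmp D (far G (t.tinj P i)) (cmp D (far G f) (B Q)) = cmp D (far G (cmp t.T (t.tinj P i) f)) (B Q)"
          using G.far_cmp[OF t f] G.T.cmp_assoc[OF h(1) fh(1) b(2)] by simp
        also have "\<dots> = cmp D (\<alpha> (P ! i)) (far G' (cmp t.T (t.tinj P i) f))"
          using letter[OF t.TC.cmp_hom[OF t f]] .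
        also have "\<dots> = cmp D (cmp D (\<alpha> (P ! i)) (far G' (t.tinj P i))) (far G' f)"
          using G'.far_cmp[OF t f] G.T.cmp_assoc[OF \<alpha>[OF u] h(2) fh(2)] by simp
        also have "\<dots> = cmp D (far G (t.tinj P i)) (cmp D (B P) (far G' f))"
          using B(2)[OF w(1) i] G.T.cmp_assoc[OF h(1) b(1) fh(2)] by simp
        finally show "cmp D (far G (t.tinj P i)) (cmp D (far G f) (B Q)) =
            cmp D (far G (t.tinj P i)) (cmp D (B P) (far G' f))" .
      qed
    qed
    \<comment> \<open>On \<open>[U]\<close> too the component came from the coproduct property; the
      mixed square at the identity of \<open>[U]\<close> identifies it with
      \<open>\<alpha> U\<close>.\<close>
    have B1: "B [U] = \<alpha> U" if "U \<in> obj C" for U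
      using letter[OF t.TC.idn_hom, of U] that G.far_idn[of "[U]"] G'.far_idn[of "[U]"]
        G.T.cmp_idl[OF B(1)[of "[U]"]] G.T.cmp_idr[OF \<alpha>[OF that]] by simp
    \<comment> \<open>Restricted because \<open>nat_trans\<close> consists of extensional families
      and nothing is known of \<open>B\<close> off words.\<close>
    let ?B = "\<lambda>P\<in>words C. B P"
    have "?B \<in> nat_trans t.T D G G'"
    proof -
      have "B P \<in> arr D" if "P \<in> words C" for P using B(1)[OF that] by (simp add: hom_iff)
      moreover have "cmp D (far G f) (?B Q) = cmp D (?B P) (far G' f)" if "f \<in> hom t.T P Q" for f P Q
        using natB[OF that] t.TC.hom_objD[OF that] by simp
      ultimately show ?thesis using B(1) unfolding nat_trans_def by auto
    qed
    moreover have "?r ?B = \<alpha>"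
      using a B1 unfolding r nat_trans_def
      by (intro extensionalityI[of _ "obj C"]) (auto simp: PiE_def)
    ultimately show ?thesis by blast
  qed
  show ?thesis
    unfolding bij_betw_def inj_on_def using inj into onto by blast
qed

section \<open>Naturality of the unit and of the adjunct\<close>

lemma unit_natural:
  assumes "cat_functor C D F"
  shows "comp_functor C (tape_unit C) (tape_functor C D F) = comp_functor C F (tape_unit D)"
proof -
  interpret F: cat_functor C D F by fact
  interpret c: tape_theory C ..
  interpret d: tape_theory D ..
  have "far F c \<in> arr D" if "c \<in> arr C" for c using F.far_ext that by auto
  then show ?thesis
    by (simp add: comp_functor_def c.unit_far c.unit_fob d.unit_far d.unit_fob F.fob_obj F.tF_box F.tF_fob
      cong: restrict_cong)
qed

lemma adjunct_natural_left:
  assumes "cat_functor C' C F"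
  shows "adjunct C' (comp_functor (tape_cat C') (tape_functor C' C F) G) = comp_functor C' F (adjunct C G)"
proof -
  interpret F: cat_functor C' C F by fact
  interpret c: tape_theory C' ..
  interpret d: tape_theory C ..
  have "far F c \<in> arr C" if "c \<in> arr C'" for c using F.far_ext that by auto
  then show ?thesis
    by (simp add: c.adjunct_eq d.adjunct_eq comp_functor_def F.fob_obj F.tF_box F.tF_fob c.box_arr
      cong: restrict_cong)
qed

lemma adjunct_natural_right:
  assumes "category C"
  shows "adjunct C (comp_functor (tape_cat C) G K) = comp_functor C (adjunct C G) K"
proof -
  interpret c: tape_theory C unfolding tape_theory_def by fact
  show ?thesis by (simp add: c.adjunct_eq comp_functor_def c.box_arr cong: restrict_cong)
qed

theorem theorem4:
  fixes C :: "('o, 'a) cat" and C' :: "('o1, 'a1) cat" and C'' :: "('o2, 'a2) cat"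
    and D :: "('p, 'b) cbcat" and D' :: "('p1, 'b1) cbcat"
  shows
    \<comment> \<open>the functor on objects and on morphisms\<close>
    "(category C \<longrightarrow> strict_convex_biproduct_category (tape_cat C)) \<and>
     (\<forall>F. cat_functor C C' F \<longrightarrow>
        strict_cb_functor (tape_cat C) (tape_cat C') (tape_functor C C' F) \<and>
        (\<forall>P\<in>words C. fob (tape_functor C C' F) P = map (fob F) P) \<and>
        (\<forall>c\<in>arr C. far (tape_functor C C' F) (far (tape_unit C) c) = far (tape_unit C') (far F c)) \<and>
        (\<forall>P Q t. tape_typed C P Q t \<longrightarrow>
           far (tape_functor C C' F) (tape_class C P Q t) =
             tape_class C' (map (fob F) P) (map (fob F) Q) (map_tape (fob F) (far F) t)) \<and>
        (\<forall>f\<in>arr (tape_cat C). \<forall>g\<in>arr (tape_cat C).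
           far (tape_functor C C' F) (tape_par C f g) =
             tape_par C' (far (tape_functor C C' F) f) (far (tape_functor C C' F) g))) \<and>
     (category C \<longrightarrow> tape_functor C C (id_functor C) = id_functor (tape_cat C)) \<and>
     (\<forall>F G. cat_functor C C' F \<longrightarrow> cat_functor C' C'' G \<longrightarrow>
        tape_functor C C'' (comp_functor C F G) =
          comp_functor (tape_cat C) (tape_functor C C' F) (tape_functor C' C'' G)) \<and>
     \<comment> \<open>the unit\<close>
     (category C \<longrightarrow> cat_functor C (forget (tape_cat C)) (tape_unit C)) \<and>
     (\<forall>F. cat_functor C C' F \<longrightarrow>
        comp_functor C (tape_unit C) (tape_functor C C' F) = comp_functor C F (tape_unit C')) \<and>
     \<comment> \<open>strict morphisms: a bijection of hom-sets\<close>
     (category C \<longrightarrow> strict_convex_biproduct_category D \<longrightarrow>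
        bij_betw (adjunct C)
          {G. strict_cb_functor (tape_cat C) D G} {H. cat_functor C (forget D) H}) \<and>
     \<comment> \<open>arbitrary morphisms: an equivalence of hom-categories, surjective on objects\<close>
     (category C \<longrightarrow> convex_biproduct_category D \<longrightarrow>
        adjunct C ` {G. cb_functor (tape_cat C) D G} = {H. cat_functor C (forget D) H} \<and>
        (\<forall>G G'. cb_functor (tape_cat C) D G \<longrightarrow> cb_functor (tape_cat C) D G' \<longrightarrow>
           bij_betw (\<lambda>\<alpha>. \<lambda>A\<in>obj C. \<alpha> (fob (tape_unit C) A))
             (nat_trans (tape_cat C) D G G')
             (nat_trans C (forget D) (adjunct C G) (adjunct C G')))) \<and>
     \<comment> \<open>naturality in both arguments\<close>
     (\<forall>F G. cat_functor C' C F \<longrightarrow> cb_functor (tape_cat C) D G \<longrightarrow>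
        adjunct C' (comp_functor (tape_cat C') (tape_functor C' C F) G) =
          comp_functor C' F (adjunct C G)) \<and>
     (\<forall>G K. category C \<longrightarrow> cb_functor (tape_cat C) D G \<longrightarrow> cb_functor D D' K \<longrightarrow>
        adjunct C (comp_functor (tape_cat C) G K) =
          comp_functor C (adjunct C G) K)"
proof (intro conjI impI allI)
  assume C: "category C"
  interpret t: tape_theory C unfolding tape_theory_def by (rule C)
  show "strict_convex_biproduct_category (tape_cat C)" by (rule t.TB.strict_convex_biproduct_category_axioms)
  show "tape_functor C C (id_functor C) = id_functor (tape_cat C)" using C by (rule tape_functor_id)
  show "cat_functor C (forget (tape_cat C)) (tape_unit C)" by (rule t.unit_functor)
  show "bij_betw (adjunct C) {G. strict_cb_functor (tape_cat C) D G} {H. cat_functor C (forget D) H}"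
    if D: "strict_convex_biproduct_category D"
  proof -
    have D': "convex_biproduct_category D" using D by (rule strict_convex_biproduct_category.axioms(1))
    have "adjunct C G \<in> {H. cat_functor C (forget D) H}" if "strict_cb_functor (tape_cat C) D G" for G
      using t.adjunct_functor[of D G] that by (simp add: strict_cb_functor_def cb_functor_def)
    moreover have "\<exists>G\<in>{G. strict_cb_functor (tape_cat C) D G}. H = adjunct C G"
      if "cat_functor C (forget D) H" for H
      using free_cb_functor[OF D' that] D by (metis mem_Collect_eq)
    ultimately show ?thesis
      unfolding bij_betw_def inj_on_def using strict_cb_functor_unique[OF C] by blast
  qed
  assume D: "convex_biproduct_category D"
  have "adjunct C G \<in> {H. cat_functor C (forget D) H}" if "cb_functor (tape_cat C) D G" for G
    using t.adjunct_functor[of D G] that by (simp add: cb_functor_def)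
  moreover have "H \<in> adjunct C ` {G. cb_functor (tape_cat C) D G}" if "cat_functor C (forget D) H" for H
    using free_cb_functor[OF D that] by (metis imageI mem_Collect_eq)
  ultimately show "adjunct C ` {G. cb_functor (tape_cat C) D G} = {H. cat_functor C (forget D) H}" by blast
  fix G G' assume "cb_functor (tape_cat C) D G" "cb_functor (tape_cat C) D G'"
  then show "bij_betw (\<lambda>\<alpha>. \<lambda>A\<in>obj C. \<alpha> (fob (tape_unit C) A)) (nat_trans (tape_cat C) D G G')
      (nat_trans C (forget D) (adjunct C G) (adjunct C G'))" by (rule nat_trans_bij[OF C])
next
  fix F assume F: "cat_functor C C' F"
  interpret F: cat_functor C C' F by fact
  interpret c: tape_theory C ..
  interpret d: tape_theory C' ..
  show "strict_cb_functor (tape_cat C) (tape_cat C') (tape_functor C C' F)" by (rule F.tF_strict)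
  show "\<forall>P\<in>words C. fob (tape_functor C C' F) P = map (fob F) P" by (simp add: F.tF_fob)
  have "far F c \<in> arr C'" if "c \<in> arr C" for c using F.far_ext that by auto
  then show "\<forall>c\<in>arr C. far (tape_functor C C' F) (far (tape_unit C) c) = far (tape_unit C') (far F c)"
    by (simp add: c.unit_far d.unit_far F.tF_box)
  show "far (tape_functor C C' F) (tape_class C P Q t) =
      tape_class C' (map (fob F) P) (map (fob F) Q) (map_tape (fob F) (far F) t)"
    if "tape_typed C P Q t" for P Q t using F.tF_cls[OF that] .
  show "\<forall>f\<in>arr (tape_cat C). \<forall>g\<in>arr (tape_cat C). far (tape_functor C C' F) (tape_par C f g) =
      tape_par C' (far (tape_functor C C' F) f) (far (tape_functor C C' F) g)"
    using F.tF_par by (simp add: hom_iff)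
  show "comp_functor C (tape_unit C) (tape_functor C C' F) = comp_functor C F (tape_unit C')"
    using F by (rule unit_natural)
next
  fix F G assume "cat_functor C C' F" "cat_functor C' C'' G"
  then show "tape_functor C C'' (comp_functor C F G) =
      comp_functor (tape_cat C) (tape_functor C C' F) (tape_functor C' C'' G)" by (rule tape_functor_comp)
next
  fix F G assume "cat_functor C' C F"
  then show "adjunct C' (comp_functor (tape_cat C') (tape_functor C' C F) G) = comp_functor C' F (adjunct C G)"
    by (rule adjunct_natural_left)
next
  fix G K assume "category C"
  then show "adjunct C (comp_functor (tape_cat C) G K) = comp_functor C (adjunct C G) K"
    by (rule adjunct_natural_right)
qed

end
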